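(* Let $\mathcal H=\mathbb R^d$ with $d<\infty$ (with the standard Euclidean inner product), and let $\mu$ be any Borel probability measure on $\mathcal H$. Then for any $\epsilon>0$ there exists a $C^\infty$ map $\Phi:\mathbb R^2\to\mathcal H$ such that $\mu(\mathcal H\setminus F_\Phi)<\epsilon$.
   Context: For a map $\Phi:\mathbb R^2\to\mathbb R^d$ and a target $\mathbf f\in\mathbb R^d$, let $L_{\mathbf f}(\mathbf w)=\frac12\|\mathbf f-\Phi(\mathbf w)\|^2$ and let $\mathbf w(t)$, $t\ge0$, be the solution of the gradient flow $\frac{d\mathbf w}{dt}=-\nabla_{\mathbf w}L_{\mathbf f}(\mathbf w(t))$ with $\mathbf w(0)=\mathbf 0$. The set of GF-learnable targets is $F_\Phi=\{\mathbf f\in\mathbb R^d:\inf_{t\ge0}L_{\mathbf f}(\mathbf w(t))=0\}$ (a Borel set). *)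

theory Defs
  imports "HOL-Probability.Probability"
begin

text \<open>C^k maps between finite-dimensional spaces, defined recursively: C^0 = continuous;
  C^(k+1) = everywhere (Frechet) differentiable with every directional derivative
  x \<mapsto> D x v of class C^k. Over a finite-dimensional domain this is the usual C^k.\<close>
fun Ck :: "nat \<Rightarrow> ('a::euclidean_space \<Rightarrow> 'b::real_normed_vector) \<Rightarrow> bool" where
  "Ck 0 f = continuous_on UNIV f"
| "Ck (Suc k) f = (\<exists>D. (\<forall>x. (f has_derivative D x) (at x)) \<and> (\<forall>v. Ck k (\<lambda>x. D x v)))"

definition smooth :: "('a::euclidean_space \<Rightarrow> 'b::real_normed_vector) \<Rightarrow> bool" where
  "smooth f \<longleftrightarrow> (\<forall>k. Ck k f)"

definition loss :: "(real^2 \<Rightarrow> real^'d) \<Rightarrow> real^'d \<Rightarrow> real^2 \<Rightarrow> real" where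
  "loss \<Phi> f w = (1/2) * (norm (f - \<Phi> w))\<^sup>2"

definition grad :: "('a::euclidean_space \<Rightarrow> real) \<Rightarrow> 'a \<Rightarrow> 'a" where
  "grad L w = (SOME g. (L has_derivative (\<lambda>h. g \<bullet> h)) (at w))"

definition GF_solution :: "(real^2 \<Rightarrow> real^'d) \<Rightarrow> real^'d \<Rightarrow> (real \<Rightarrow> real^2) \<Rightarrow> bool" where
  "GF_solution \<Phi> f w \<longleftrightarrow> w 0 = 0 \<and>
     (\<forall>t\<ge>0. (w has_vector_derivative (- grad (loss \<Phi> f) (w t))) (at t within {0..}))"

definition GF_learnable :: "(real^2 \<Rightarrow> real^'d) \<Rightarrow> (real^'d) set" where
  "GF_learnable \<Phi> = {f. \<exists>w. GF_solution \<Phi> f w \<and> (INF t\<in>{0..}. loss \<Phi> f (w t)) = 0}"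

end

theory Submission
  imports Defs
begin

text \<open>
  For \<open>d \<ge> 2\<close> let \<open>w = (u, v)\<close>. Almost all of the mass lies in a Cantor-like set: a large ball minus thin
  slabs around hyperplanes orthogonal to the coordinate directions, which cut boxes into a binary tree
  with the coordinates taken cyclically. At \<open>u = 2k\<close> the value of \<open>v\<close> encodes the level-\<open>k\<close> box containing
  the target, and \<open>\<Phi>\<close> lies at a distance from this box that is large compared with its size. Decreasing
  this distance along an approach direction keeps \<open>u\<close> increasing for all targets of the box at once.
  During a stage, the component of \<open>\<Phi>\<close> in the direction to be cut is kept near the cut but depends on
  \<open>v\<close> through a sine of small amplitude; so \<open>v\<close> is pushed up or down according to the side on which the
  target lies, provided that \<open>u\<close> moves slowly enough. Then \<open>v\<close> encodes the child box, and the base point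
  and the approach direction are changed to those of the next stage. The distances tend to \<open>0\<close> because
  they decay at the same rate as the sizes of the boxes. The learnable set is a \<open>G\<^sub>\<delta>\<close> because the flow
  exists for all times and depends continuously on the target.
\<close>

section \<open>Smooth maps\<close>

text \<open>The speed of \<open>u\<close> is the inner product of the residual with the
  \<open>u\<close>-derivative of the map. Its radial part is positive as soon as the radius exceeds
  the box size, so targets that still share one \<open>v\<close>, and cannot yet be told apart, all
  advance. Meanwhile \<open>v\<close> is pushed to the side given by the sign of the target's
  component relative to the cut. This sign is unreliable near the cut, hence the slabs of half-width
  \<open>\<omega> k\<close> and the bound \<open>2 * h k \<le> \<omega> k\<close>. The approach
  direction is orthogonal to the cut direction so that the two effects do not mix; dimension one has
  no such direction and is done by a linear map. The constants are not circular. The slabs fix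
  \<open>\<omega>\<close>, the box sizes fix \<open>\<kappa>\<close> and \<open>\<tau>\<close>, and
  one \<open>R\<close> serves every stage because radius and box size shrink by the same factor.
  Then \<open>h\<close> is taken small against the radius, and last the slowness
  \<open>\<sigma> k\<close> small against \<open>h k * \<omega> k\<close>. Slowing is confined to a
  place where the gate is constant, so the weakened drift has no switching force to beat.\<close>

lemma Ck_Suc_imp: "Ck (Suc k) f \<Longrightarrow> Ck k f"
proof (induction k arbitrary: f)
  case 0
  then obtain D where "\<forall>x. (f has_derivative D x) (at x)" by auto
  then show ?case
    by (auto intro!: continuous_at_imp_continuous_on has_derivative_continuous)
next
  case (Suc k)
  then show ?case by (metis Ck.simps(2))
qed

lemma Ck_const: "Ck k (\<lambda>x. c)"
proof (induction k arbitrary: c)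
  case (Suc k)
  then show ?case by (auto intro!: exI[where x = "\<lambda>x v. 0"])
qed auto

lemma Ck_bounded_linear: "bounded_linear f \<Longrightarrow> Ck k f"
proof (cases k)
  case (Suc n)
  assume "bounded_linear f"
  then show ?thesis
    unfolding Suc
    by (auto intro!: exI[where x = "\<lambda>x. f"] bounded_linear_imp_has_derivative Ck_const)
qed (auto simp: linear_continuous_on)

lemma Ck_add: "Ck k f \<Longrightarrow> Ck k g \<Longrightarrow> Ck k (\<lambda>x. f x + g x)"
proof (induction k arbitrary: f g)
  case 0
  then show ?case by (auto intro: continuous_on_add)
next
  case (Suc k)
  from Suc.prems obtain D E where
    "\<forall>x. (f has_derivative D x) (at x)" "\<forall>v. Ck k (\<lambda>x. D x v)"
    "\<forall>x. (g has_derivative E x) (at x)" "\<forall>v. Ck k (\<lambda>x. E x v)" by auto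
  then show ?case
    using Suc.IH
    by (auto intro!: exI[where x = "\<lambda>x v. D x v + E x v"] has_derivative_add)
qed

lemma Ck_sum: "(\<And>i. i \<in> I \<Longrightarrow> Ck k (f i)) \<Longrightarrow> Ck k (\<lambda>x. \<Sum>i\<in>I. f i x)"
  by (induction I rule: infinite_finite_induct) (auto intro: Ck_add Ck_const)

lemma Ck_scaleR: "Ck k f \<Longrightarrow> Ck k g \<Longrightarrow> Ck k (\<lambda>x. f x *\<^sub>R g x)"
proof (induction k arbitrary: f g)
  case 0
  then show ?case by (auto intro: continuous_on_scaleR)
next
  case (Suc k)
  from Suc.prems obtain D E where DE:
    "\<forall>x. (f has_derivative D x) (at x)" "\<forall>v. Ck k (\<lambda>x. D x v)"
    "\<forall>x. (g has_derivative E x) (at x)" "\<forall>v. Ck k (\<lambda>x. E x v)" by auto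
  have "Ck k f" by (rule Ck_Suc_imp[OF Suc.prems(1)])
  moreover have "Ck k g" by (rule Ck_Suc_imp[OF Suc.prems(2)])
  ultimately have "Ck k (\<lambda>x. f x *\<^sub>R E x v + D x v *\<^sub>R g x)" for v
    using DE Suc.IH by (auto intro!: Ck_add)
  with DE show ?case
    by (auto intro!: exI[where x = "\<lambda>x v. f x *\<^sub>R E x v + D x v *\<^sub>R g x"] has_derivative_scaleR)
qed

text \<open>Near each point some neighbourhood carries a derivative. On overlaps these agree by
  uniqueness, so the diagonal choice \<open>D x x\<close> is a global derivative and again locally
  of class \<open>Ck k\<close>. This glues the stages of the routing map.\<close>

lemma Ck_local:
  assumes "\<And>x. \<exists>S g. open S \<and> x \<in> S \<and> Ck k g \<and> (\<forall>y\<in>S. f y = g y)"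
  shows "Ck k f"
  using assms
proof (induction k arbitrary: f)
  case 0
  have "isCont f x" for x
  proof -
    obtain S g where "open S" "x \<in> S" "continuous_on UNIV g" "\<forall>y\<in>S. f y = g y"
      using 0[of x] by auto
    then show ?thesis
      by (metis continuous_on_cong continuous_on_eq_continuous_at continuous_on_subset subset_UNIV)
  qed
  then show ?case by (simp add: continuous_at_imp_continuous_on)
next
  case (Suc k)
  have "\<exists>S D. open S \<and> x \<in> S \<and> (\<forall>y\<in>S. (f has_derivative D y) (at y)) \<and> (\<forall>v. Ck k (\<lambda>x. D x v))" for x
  proof -
    obtain S g where S: "open S" "x \<in> S" "Ck (Suc k) g" "\<forall>y\<in>S. f y = g y"
      using Suc.prems[of x] by auto
    then obtain D where "\<forall>x. (g has_derivative D x) (at x)" "\<forall>v. Ck k (\<lambda>x. D x v)" by auto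
    with S show ?thesis
      by (metis has_derivative_transform_within_open)
  qed
  then obtain S D where SD: "\<And>x. open (S x)" "\<And>x. x \<in> S x"
    "\<And>x y. y \<in> S x \<Longrightarrow> (f has_derivative D x y) (at y)" "\<And>x v. Ck k (\<lambda>y. D x y v)" by metis
  have "Ck k (\<lambda>x. D x x v)" for v
  proof (rule Suc.IH)
    fix x
    have "D y y v = D x y v" if "y \<in> S x" for y
      using SD(2,3) that has_derivative_unique by metis
    then show "\<exists>S g. open S \<and> x \<in> S \<and> Ck k g \<and> (\<forall>y\<in>S. D y y v = g y)"
      using SD by metis
  qed
  moreover have "(f has_derivative D x x) (at x)" for x
    using SD(2,3) by blast
  ultimately show ?case
    unfolding Ck.simps by (intro exI[where x = "\<lambda>x. D x x"] conjI allI)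
qed

text \<open>With a one-variable outer function the chain rule becomes a product: linearity of
  \<open>D (g x)\<close> on the reals turns the derivative into \<open>E x v\<close> times
  \<open>D (g x) 1\<close>, to which the induction hypothesis and \<open>Ck_scaleR\<close>
  apply.\<close>

lemma Ck_compose_real:
  fixes g :: "'a::euclidean_space \<Rightarrow> real" and f :: "real \<Rightarrow> 'b::real_normed_vector"
  shows "Ck k f \<Longrightarrow> Ck k g \<Longrightarrow> Ck k (\<lambda>x. f (g x))"
proof (induction k arbitrary: f g)
  case 0
  then show ?case by (auto intro: continuous_on_compose2)
next
  case (Suc k)
  from Suc.prems obtain D E where DE:
    "\<forall>x. (f has_derivative D x) (at x)" "\<forall>v. Ck k (\<lambda>x. D x v)"
    "\<forall>x. (g has_derivative E x) (at x)" "\<forall>v. Ck k (\<lambda>x. E x v)" by auto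
  have "((\<lambda>x. f (g x)) has_derivative (\<lambda>v. D (g x) (E x v))) (at x)" for x
    using DE by (metis has_derivative_compose)
  moreover have "D (g x) (E x v) = E x v *\<^sub>R D (g x) 1" for x v
  proof -
    have "linear (D (g x))" using DE(1) has_derivative_linear by blast
    from linear_scale[OF this, of "E x v" 1] show ?thesis by simp
  qed
  moreover have "Ck k (\<lambda>x. E x v *\<^sub>R D (g x) 1)" for v
    using DE(2,4) Ck_Suc_imp[OF Suc.prems(2)] by (intro Ck_scaleR Suc.IH[of "\<lambda>y. D y 1"]) blast+
  ultimately show ?case by (auto intro!: exI[where x = "\<lambda>x v. D (g x) (E x v)"])
qed

lemma Ck_Suc_real:
  fixes f f' :: "real \<Rightarrow> real"
  assumes "\<And>x. (f has_real_derivative f' x) (at x)" "Ck k f'"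
  shows "Ck (Suc k) f"
proof -
  have "Ck k (\<lambda>x. f' x *\<^sub>R v)" for v :: real
    using assms by (intro Ck_scaleR Ck_const)
  then show ?thesis
    using assms(1)
    by (auto simp: has_field_derivative_def intro!: exI[where x = "\<lambda>x v. f' x * v"])
qed

lemma Ck_inverse:
  fixes g :: "'a::euclidean_space \<Rightarrow> real"
  assumes "\<And>x. g x \<noteq> 0"
  shows "Ck k g \<Longrightarrow> Ck k (\<lambda>x. inverse (g x))"
proof (induction k)
  case 0
  then show ?case using assms by (auto intro: continuous_on_inverse)
next
  case (Suc k)
  from Suc.prems obtain E where E:
    "\<forall>x. (g has_derivative E x) (at x)" "\<forall>v. Ck k (\<lambda>x. E x v)" by auto
  have "Ck k (\<lambda>x. inverse (g x))" using Suc Ck_Suc_imp by blast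
  then have "Ck k (\<lambda>x. (-1) *\<^sub>R (inverse (g x) *\<^sub>R (E x v *\<^sub>R inverse (g x))))" for v
    using E by (intro Ck_scaleR Ck_const) auto
  then have "Ck k (\<lambda>x. - (inverse (g x) * E x v * inverse (g x)))" for v
    by (simp add: mult.assoc)
  moreover have "((\<lambda>x. inverse (g x)) has_derivative
      (\<lambda>v. - (inverse (g x) * E x v * inverse (g x)))) (at x)" for x
    using E(1) assms by (intro Deriv.has_derivative_inverse) auto
  ultimately show ?case
    by (auto intro!: exI[where x = "\<lambda>x v. - (inverse (g x) * E x v * inverse (g x))"])
qed

lemma smooth_const: "smooth (\<lambda>x. c)"
  by (simp add: smooth_def Ck_const)

lemma smooth_bounded_linear: "bounded_linear f \<Longrightarrow> smooth f"
  by (simp add: smooth_def Ck_bounded_linear)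

lemma smooth_ident: "smooth (\<lambda>x. x)"
  by (intro smooth_bounded_linear bounded_linear_ident)

lemma smooth_vec_nth: "smooth (\<lambda>w::real^'n. w $ i)"
  by (intro smooth_bounded_linear bounded_linear_vec_nth)

lemma smooth_add: "smooth f \<Longrightarrow> smooth g \<Longrightarrow> smooth (\<lambda>x. f x + g x)"
  by (simp add: smooth_def Ck_add)

lemma smooth_scaleR: "smooth f \<Longrightarrow> smooth g \<Longrightarrow> smooth (\<lambda>x. f x *\<^sub>R g x)"
  by (simp add: smooth_def Ck_scaleR)

lemma smooth_mult: "smooth f \<Longrightarrow> smooth g \<Longrightarrow> smooth (\<lambda>x. f x * g x :: real)"
  using smooth_scaleR[of f g] by simp

lemma smooth_minus: "smooth f \<Longrightarrow> smooth (\<lambda>x. - f x)"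
  using smooth_scaleR[OF smooth_const, of f "-1"] by simp

lemma smooth_diff: "smooth f \<Longrightarrow> smooth g \<Longrightarrow> smooth (\<lambda>x. f x - g x)"
  using smooth_add[OF _ smooth_minus, of f g] by simp

lemma smooth_sum: "(\<And>i. i \<in> I \<Longrightarrow> smooth (f i)) \<Longrightarrow> smooth (\<lambda>x. \<Sum>i\<in>I. f i x)"
  by (simp add: smooth_def Ck_sum)

lemma smooth_compose_real:
  fixes g :: "'a::euclidean_space \<Rightarrow> real"
  shows "smooth f \<Longrightarrow> smooth g \<Longrightarrow> smooth (\<lambda>x. f (g x))"
  by (simp add: smooth_def Ck_compose_real)

lemma smooth_inverse:
  fixes g :: "'a::euclidean_space \<Rightarrow> real"
  shows "(\<And>x. g x \<noteq> 0) \<Longrightarrow> smooth g \<Longrightarrow> smooth (\<lambda>x. inverse (g x))"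
  by (simp add: smooth_def Ck_inverse)

lemma smooth_local:
  assumes "\<And>x. \<exists>S g. open S \<and> x \<in> S \<and> smooth g \<and> (\<forall>y\<in>S. f y = g y)"
  shows "smooth f"
  unfolding smooth_def
proof (intro allI Ck_local)
  fix k x
  show "\<exists>S g. open S \<and> x \<in> S \<and> Ck k g \<and> (\<forall>y\<in>S. f y = g y)"
    using assms[of x] unfolding smooth_def by blast
qed

text \<open>The index map \<open>s\<close> names the derivative, so one induction on
  \<open>k\<close> treats all members at once. The families in use are \<open>exp\<close> alone,
  sines with phase shifts, and the functions \<open>flat_poly p\<close>.\<close>

lemma smooth_real_family:
  fixes D :: "'i \<Rightarrow> real \<Rightarrow> real"
  assumes "\<And>i x. (D i has_real_derivative D (s i) x) (at x)"
  shows "smooth (D i)"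
proof -
  have "Ck k (D i)" for k
  proof (induction k arbitrary: i)
    case 0
    then show ?case
      using assms by (auto intro!: continuous_at_imp_continuous_on DERIV_isCont)
  next
    case (Suc k)
    show ?case using Ck_Suc_real[OF assms Suc] .
  qed
  then show ?thesis by (simp add: smooth_def)
qed

lemma smooth_exp: "smooth (exp :: real \<Rightarrow> real)"
  using smooth_real_family[of "\<lambda>_::unit. exp" "\<lambda>i. i"] by (simp add: DERIV_exp)

lemma smooth_sin_cos: "smooth (sin :: real \<Rightarrow> real)" "smooth (cos :: real \<Rightarrow> real)"
proof -
  \<comment> \<open>Differentiating \<open>sin\<close> advances its phase by a quarter
    period.\<close>
  have *: "smooth (\<lambda>x. sin (x + real n * (pi/2)))" for n
  proof (rule smooth_real_family[of "\<lambda>n x. sin (x + real n * (pi/2))" Suc])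
    fix n :: nat and x :: real
    show "((\<lambda>x. sin (x + real n * (pi/2))) has_real_derivative sin (x + real (Suc n) * (pi/2))) (at x)"
      by (auto intro!: derivative_eq_intros simp: algebra_simps sin_add cos_add add_divide_distrib)
  qed
  show "smooth (sin :: real \<Rightarrow> real)" using *[of 0] by simp
  show "smooth (cos :: real \<Rightarrow> real)" using *[of 1] by (simp add: sin_add)
qed

text \<open>\<open>smooth\<close> provides a derivative separately for each \<open>k\<close>;
  uniqueness makes them one function, which is then of every class.\<close>

lemma smooth_has_derivative:
  assumes "smooth f"
  obtains D where "\<And>x. (f has_derivative D x) (at x)" "\<And>v. smooth (\<lambda>x. D x v)"
proof -
  have *: "\<exists>D. (\<forall>x. (f has_derivative D x) (at x)) \<and> (\<forall>v. Ck k (\<lambda>x. D x v))" for k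
    using assms unfolding smooth_def by (metis Ck.simps(2))
  then obtain D where D: "\<And>k x. (f has_derivative D k x) (at x)" "\<And>k v. Ck k (\<lambda>x. D k x v)" by metis
  have "D k = D 0" for k using D(1) has_derivative_unique by blast
  with D show ?thesis by (metis smooth_def that)
qed

lemma smooth_real_has_derivative:
  fixes f :: "real \<Rightarrow> real"
  assumes "smooth f"
  obtains f' where "\<And>x. (f has_real_derivative f' x) (at x)" "smooth f'"
proof -
  obtain D where D: "\<And>x. (f has_derivative D x) (at x)" "\<And>v. smooth (\<lambda>x. D x v)"
    using smooth_has_derivative[OF assms] by blast
  have "D x = (*) (D x 1)" for x
  proof
    fix v
    show "D x v = D x 1 * v"
      using linear_scale[OF has_derivative_linear[OF D(1)], of x v 1] by (simp add: mult.commute)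
  qed
  then have "(f has_real_derivative D x 1) (at x)" for x
    using D(1)[of x] unfolding has_field_derivative_def by metis
  then show ?thesis by (rule that) (rule D(2))
qed

lemma smooth_continuous_on: "smooth f \<Longrightarrow> continuous_on S f"
  unfolding smooth_def by (metis Ck.simps(1) continuous_on_subset subset_UNIV)

section \<open>Flat functions and smooth steps\<close>

definition flat_poly :: "real poly \<Rightarrow> real \<Rightarrow> real" where
  "flat_poly p x = (if x > 0 then poly p (1/x) * exp (-(1/x)) else 0)"

lemma flat_poly_tendsto: "(flat_poly p \<longlongrightarrow> 0) (at_right 0)"
proof -
  have "((\<lambda>y. poly p y / exp y) \<longlongrightarrow> 0) at_top"
  proof -
    have "((\<lambda>y. \<Sum>i\<le>degree p. coeff p i * (y ^ i / exp y)) \<longlongrightarrow> (\<Sum>i\<le>degree p. coeff p i * 0)) at_top"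
      by (intro tendsto_sum tendsto_mult tendsto_const tendsto_power_div_exp_0)
    then show ?thesis by (simp add: poly_altdef sum_divide_distrib)
  qed
  then have "((\<lambda>x. poly p (inverse x) / exp (inverse x)) \<longlongrightarrow> 0) (at_right (0::real))"
    by (rule filterlim_compose[OF _ filterlim_inverse_at_top_right])
  then show ?thesis
    by (rule Lim_transform_eventually)
       (auto simp: flat_poly_def eventually_at_right_less eventually_at_filter exp_minus divide_simps)
qed

text \<open>By the chain rule the derivative of \<open>p(1/x) exp(-1/x)\<close> is
  \<open>(p - p')(1/x) / x^2\<close> times the same exponential, and the two \<open>pCons 0\<close>
  supply the factor \<open>1/x^2\<close>. At \<open>0\<close> the difference quotient is again such
  a function, with one more factor \<open>1/x\<close>, and tends to \<open>0\<close>.\<close>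

lemma flat_poly_deriv:
  "(flat_poly p has_real_derivative flat_poly (pCons 0 (pCons 0 (p - pderiv p))) x) (at x)"
proof -
  consider "x > 0" | "x < 0" | "x = 0" by linarith
  then show ?thesis
  proof cases
    case 1
    have "((\<lambda>x. poly p (1/x) * exp (-(1/x))) has_real_derivative
       flat_poly (pCons 0 (pCons 0 (p - pderiv p))) x) (at x)"
      using 1 by (auto intro!: derivative_eq_intros simp: flat_poly_def field_simps power2_eq_square)
    moreover have "\<forall>\<^sub>F y in nhds x. flat_poly p y = poly p (1/y) * exp (-(1/y))"
      using eventually_nhds_in_open[of "{0<..}" x] 1 by (auto elim!: eventually_mono simp: flat_poly_def)
    ultimately show ?thesis by (subst DERIV_cong_ev[OF refl _ refl])
  next
    case 2
    have "((\<lambda>x. 0) has_real_derivative flat_poly (pCons 0 (pCons 0 (p - pderiv p))) x) (at x)"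
      using 2 by (simp add: flat_poly_def)
    moreover have "\<forall>\<^sub>F y in nhds x. flat_poly p y = 0"
      using eventually_nhds_in_open[of "{..<0}" x] 2 by (auto elim!: eventually_mono simp: flat_poly_def)
    ultimately show ?thesis by (subst DERIV_cong_ev[OF refl _ refl])
  next
    case 3
    have r: "((\<lambda>y. flat_poly p y / y) \<longlongrightarrow> 0) (at_right 0)"
      by (rule Lim_transform_eventually[OF flat_poly_tendsto[of "pCons 0 p"]])
         (auto simp: flat_poly_def eventually_at_filter)
    have l: "((\<lambda>y. flat_poly p y / y) \<longlongrightarrow> 0) (at_left 0)"
      by (rule Lim_transform_eventually[OF tendsto_const])
         (auto simp: flat_poly_def eventually_at_filter)
    have "((\<lambda>y. flat_poly p y / y) \<longlongrightarrow> 0) (at 0)"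
      using filterlim_split_at[OF l r] .
    then show ?thesis
      using 3 by (simp add: DERIV_def flat_poly_def)
  qed
qed

text \<open>The slope \<open>S'\<close> and its bound \<open>B\<close> are parameters because the
  size conditions of the routing map are stated in terms of \<open>B\<close>.\<close>

locale smooth_step =
  fixes S S' :: "real \<Rightarrow> real" and B :: real
  assumes S_smooth: "smooth S"
    and S_0: "x \<le> 0 \<Longrightarrow> S x = 0" and S_1: "1 \<le> x \<Longrightarrow> S x = 1"
    and S_nonneg: "0 \<le> S x" and S_le_1: "S x \<le> 1"
    and S_deriv: "(S has_real_derivative S' x) (at x)"
    and S'_nonneg: "0 \<le> S' x" and S'_le: "S' x \<le> B"
    and S'_0: "x \<le> 0 \<or> 1 \<le> x \<Longrightarrow> S' x = 0"

lemma smooth_step_exists: "\<exists>S S' B. smooth_step S S' B"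
proof -
  define E where "E = flat_poly 1"
  \<comment> \<open>The denominator is positive, since \<open>x\<close> and \<open>1 - x\<close> are
    never both nonpositive.\<close>
  define S where "S x = E x * inverse (E x + E (1 - x))" for x
  have E: "smooth E"
    unfolding E_def by (rule smooth_real_family[of flat_poly, OF flat_poly_deriv])
  have E0: "E x = 0" if "x \<le> 0" for x using that by (simp add: E_def flat_poly_def)
  have Epos: "E x > 0" if "x > 0" for x using that by (simp add: E_def flat_poly_def)
  have Enn: "E x \<ge> 0" for x using E0 Epos by (metis linorder_not_le order.strict_implies_order order_refl)
  have den: "E x + E (1 - x) > 0" for x
    using Epos[of x] Epos[of "1-x"] Enn[of x] Enn[of "1-x"] by (cases "x > 0") linarith+
  have Emono: "E x \<le> E y" if "x \<le> y" for x y
    using that Enn by (cases "x > 0") (auto simp: E0 E_def flat_poly_def divide_simps)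
  have smS: "smooth S"
  proof -
    have "smooth (\<lambda>x. E (1 - x))"
      by (rule smooth_compose_real[OF E smooth_diff[OF smooth_const smooth_ident]])
    moreover have "E x + E (1 - x) \<noteq> 0" for x using den[of x] by simp
    ultimately show ?thesis
      unfolding S_def[abs_def] using E by (intro smooth_mult smooth_inverse smooth_add)
  qed
  then obtain S' where S': "\<And>x. (S has_real_derivative S' x) (at x)" "smooth S'"
    using smooth_real_has_derivative by blast
  have S0: "S x = 0" if "x \<le> 0" for x using that by (simp add: S_def E0)
  have S1: "S x = 1" if "x \<ge> 1" for x
  proof -
    have "E x \<noteq> 0" using Epos[of x] that by linarith
    then show ?thesis using that by (simp add: S_def E0)
  qed
  have "mono S"
  proof
    fix x y :: real assume "x \<le> y"
    then have "E x * E (1 - y) \<le> E y * E (1 - x)"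
      using Emono Enn by (intro mult_mono) auto
    then show "S x \<le> S y"
      using den by (simp add: S_def divide_simps distrib_left distrib_right mult.commute)
  qed
  then have S'0: "S' x \<ge> 0" for x
    using mono_on_imp_deriv_nonneg[of UNIV S "S' x" x] S' by simp
  have S'z: "S' x = 0" if "x \<le> 0 \<or> x \<ge> 1" for x
  proof -
    have "S' x = 0" if "x < 0 \<or> x > 1" for x
    proof (rule DERIV_unique[OF S'(1)])
      have "\<forall>\<^sub>F y in nhds x. S y = (if x < 0 then 0 else 1)"
        using that eventually_nhds_in_open[of "{..<0}" x] eventually_nhds_in_open[of "{1<..}" x]
        by (auto elim!: eventually_mono simp: S0 S1)
      then show "(S has_real_derivative 0) (at x)"
        by (subst DERIV_cong_ev[OF refl _ refl]) auto
    qed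
    \<comment> \<open>So far \<open>S'\<close> vanishes on the open half-lines; its continuity
      carries the zero to the end points \<open>0\<close> and \<open>1\<close>.\<close>
    moreover have "closed {x. S' x = 0}"
      using smooth_continuous_on[OF S'(2)] by (intro closed_Collect_eq) auto
    ultimately have "closure ({..<0} \<union> {1<..}) \<subseteq> {x. S' x = 0}"
      by (intro closure_minimal) auto
    then show ?thesis using that by (auto simp: closure_Un)
  qed
  have "compact (S' ` {0..1})"
    using smooth_continuous_on[OF S'(2)] by (intro compact_continuous_image) auto
  then obtain B where B: "\<And>x. x \<in> {0..1} \<Longrightarrow> \<bar>S' x\<bar> \<le> B"
    by (metis compact_imp_bounded bounded_real imageI)
  have "S' x \<le> B" for x
    using B[of x] S'z[of x] B[of 0] by (cases "x \<in> {0..1}") force+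
  moreover have "0 \<le> S x" "S x \<le> 1" for x
    using Enn den by (auto simp: S_def divide_simps)
  ultimately have "smooth_step S S' B"
    using smS S0 S1 S'(1) S'0 S'z by (intro smooth_step.intro) auto
  then show ?thesis by blast
qed

section \<open>Ordinary differential equations and gradient flow\<close>

text \<open>Gronwall's inequality: \<open>g t * exp (- K * t)\<close> has nonpositive
  derivative.\<close>

lemma exp_growth_bound:
  fixes g :: "real \<Rightarrow> real"
  assumes "0 \<le> T" "\<And>t. t \<in> {0..T} \<Longrightarrow> (g has_real_derivative g' t) (at t within {0..T})"
    and "\<And>t. t \<in> {0..T} \<Longrightarrow> g' t \<le> K * g t"
  shows "g T \<le> g 0 * exp (K * T)"
proof -
  have d: "((\<lambda>t. g t * exp (- K * t)) has_real_derivative (g' t - K * g t) * exp (- K * t))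
      (at t within {0..T})" if "t \<in> {0..T}" for t
    by (auto intro!: derivative_eq_intros assms(2) that simp: algebra_simps)
  have "g T * exp (- K * T) \<le> g 0 * exp (- K * 0)"
  proof (rule DERIV_nonpos_imp_decreasing_open[OF assms(1)])
    show "continuous_on {0..T} (\<lambda>t. g t * exp (- K * t))"
      by (rule DERIV_continuous_on[OF d])
    fix t assume t: "0 < t" "t < T"
    then have "((\<lambda>t. g t * exp (- K * t)) has_real_derivative (g' t - K * g t) * exp (- K * t)) (at t)"
      using d[of t] by (simp add: at_within_Icc_at)
    moreover have "(g' t - K * g t) * exp (- K * t) \<le> 0"
      using assms(3)[of t] t by (intro mult_nonpos_nonneg) auto
    ultimately show "\<exists>y. ((\<lambda>t. g t * exp (- K * t)) has_real_derivative y) (at t) \<and> y \<le> 0" by blast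
  qed
  then have "g T * exp (- K * T) * exp (K * T) \<le> g 0 * exp (K * T)"
    by (simp add: mult_right_mono)
  then show ?thesis by (simp add: mult.assoc flip: exp_add)
qed

lemma has_real_derivative_norm_square:
  fixes w :: "real \<Rightarrow> 'a::real_inner"
  assumes "(w has_vector_derivative w') (at t within S)"
  shows "((\<lambda>t. (norm (w t))\<^sup>2) has_real_derivative 2 * (w t \<bullet> w')) (at t within S)"
  using assms unfolding has_vector_derivative_def has_field_derivative_def power2_norm_eq_inner
  by (auto intro!: derivative_eq_intros simp: fun_eq_iff inner_commute)

text \<open>Gronwall is applied to the squared distance, which is differentiable even where the
  distance vanishes, plus \<open>\<eta>\<^sup>2\<close>. This constant absorbs the cross term
  through \<open>2 * n * \<eta> \<le> n\<^sup>2 + \<eta>\<^sup>2\<close>.\<close>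

lemma ode_stability:
  fixes w1 w2 :: "real \<Rightarrow> 'a::euclidean_space"
  assumes T: "0 \<le> T" and "0 \<le> \<eta>" and "w1 0 = w2 0"
    and d1: "\<And>t. t \<in> {0..T} \<Longrightarrow> (w1 has_vector_derivative v1 t) (at t within {0..T})"
    and d2: "\<And>t. t \<in> {0..T} \<Longrightarrow> (w2 has_vector_derivative v2 t) (at t within {0..T})"
    and le: "\<And>t. t \<in> {0..T} \<Longrightarrow> norm (v1 t - v2 t) \<le> L * norm (w1 t - w2 t) + \<eta>"
    and L: "0 \<le> L"
  shows "(norm (w1 T - w2 T))\<^sup>2 \<le> \<eta>\<^sup>2 * exp ((2 * L + 1) * T)"
proof -
  let ?E = "\<lambda>t. (norm (w1 t - w2 t))\<^sup>2"
  have "?E T + \<eta>\<^sup>2 \<le> (?E 0 + \<eta>\<^sup>2) * exp ((2 * L + 1) * T)"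
  proof (rule exp_growth_bound[OF T])
    fix t assume t: "t \<in> {0..T}"
    show "((\<lambda>t. ?E t + \<eta>\<^sup>2) has_real_derivative 2 * ((w1 t - w2 t) \<bullet> (v1 t - v2 t)) + 0) (at t within {0..T})"
      using t by (intro DERIV_add has_real_derivative_norm_square has_vector_derivative_diff d1 d2 DERIV_const)
    define n where "n = norm (w1 t - w2 t)"
    have "(w1 t - w2 t) \<bullet> (v1 t - v2 t) \<le> n * norm (v1 t - v2 t)"
      unfolding n_def by (rule norm_cauchy_schwarz)
    also have "\<dots> \<le> n * (L * n + \<eta>)"
      using le[OF t] by (auto intro!: mult_left_mono simp: n_def)
    finally have "2 * ((w1 t - w2 t) \<bullet> (v1 t - v2 t)) \<le> 2 * L * n\<^sup>2 + 2 * n * \<eta>"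
      by (simp add: algebra_simps power2_eq_square)
    also have "\<dots> \<le> 2 * L * n\<^sup>2 + (n\<^sup>2 + \<eta>\<^sup>2)"
      using sum_squares_bound[of n \<eta>] by simp
    also have "\<dots> \<le> (2 * L + 1) * (n\<^sup>2 + \<eta>\<^sup>2)"
      using L by (simp add: algebra_simps)
    finally show "2 * ((w1 t - w2 t) \<bullet> (v1 t - v2 t)) + 0 \<le> (2 * L + 1) * (?E t + \<eta>\<^sup>2)"
      by (simp add: n_def)
  qed
  then have "?E T + \<eta>\<^sup>2 \<le> \<eta>\<^sup>2 * exp ((2 * L + 1) * T)" using \<open>w1 0 = w2 0\<close> by simp
  moreover have "0 \<le> \<eta>\<^sup>2" by simp
  ultimately show ?thesis by linarith
qed

text \<open>Picard iteration measured with the weight \<open>exp (2 * L * t)\<close>: integrating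
  \<open>L\<close> times the weight gives at most half of it, so successive differences shrink by
  the factor \<open>1/2\<close> on the whole interval, however long it is.\<close>

lemma picard_lindeloef:
  fixes F :: "'a::euclidean_space \<Rightarrow> 'a"
  assumes T: "0 \<le> T" and L: "0 < L" and lip: "\<And>x y. norm (F x - F y) \<le> L * norm (x - y)"
  obtains w where "w 0 = x0"
    "\<And>t. t \<in> {0..T} \<Longrightarrow> (w has_vector_derivative F (w t)) (at t within {0..T})"
proof -
  define W where "W n = ((\<lambda>w t. x0 + integral {0..t} (\<lambda>s. F (w s))) ^^ n) (\<lambda>_::real. x0)" for n
  have W0: "W 0 t = x0" for t by (simp add: W_def)
  have WS: "W (Suc n) t = x0 + integral {0..t} (\<lambda>s. F (W n s))" for n t by (simp add: W_def)
  have F: "continuous_on S F" for S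
  proof -
    have "L-lipschitz_on S F" using L lip by (auto intro!: lipschitz_onI simp: dist_norm)
    then show ?thesis by (rule lipschitz_on_continuous_on)
  qed
  have cont: "continuous_on {0..T} (W n)" for n
  proof (induction n)
    case (Suc n)
    then have "continuous_on {0..T} (\<lambda>s. F (W n s))"
      by (intro continuous_on_compose2[OF F[of UNIV]]) auto
    from integral_has_vector_derivative[OF this] show ?case
      unfolding WS[abs_def]
      by (intro continuous_intros continuous_on_vector_derivative) auto
  qed (simp add: W_def)
  have contF: "continuous_on {0..T} (\<lambda>s. F (W n s))" for n
    using cont by (intro continuous_on_compose2[OF F[of UNIV]]) auto
  \<comment> \<open>Chosen so that the first difference \<open>t * norm (F x0)\<close> is at most
    \<open>A\<close> times the weight, by \<open>2 * L * t \<le> exp (2 * L * t)\<close>.\<close>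
  define A where "A = norm (F x0) / (2 * L)"
  have int: "(\<lambda>s. F (W n s)) integrable_on {0..t}" if "t \<in> {0..T}" for n t
    using that by (intro integrable_continuous_real continuous_on_subset[OF contF]) auto
  have bd: "norm (W (Suc n) t - W n t) \<le> A * (1/2)^n * exp (2 * L * t)" if "t \<in> {0..T}" for n t
    using that
  proof (induction n arbitrary: t)
    case 0
    have "2 * L * t \<le> exp (2 * L * t)" using exp_ge_add_one_self[of "2 * L * t"] by linarith
    then have "t \<le> exp (2 * L * t) / (2 * L)" using L by (simp add: field_simps)
    then have "t * norm (F x0) \<le> exp (2 * L * t) / (2 * L) * norm (F x0)"
      by (rule mult_right_mono) simp
    then show ?case using 0 by (simp add: WS W0 A_def mult.commute)
  next
    case (Suc n)
    have e: "((\<lambda>s. L * (A * (1/2)^n * exp (2 * L * s))) has_integral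
        (A * (1/2)^Suc n * exp (2 * L * t) - A * (1/2)^Suc n * exp (2 * L * 0))) {0..t}"
      using Suc.prems L
      by (intro fundamental_theorem_of_calculus)
         (auto intro!: derivative_eq_intros simp: has_real_derivative_iff_has_vector_derivative[symmetric])
    have "W (Suc (Suc n)) t - W (Suc n) t = integral {0..t} (\<lambda>s. F (W (Suc n) s) - F (W n s))"
      using int[OF Suc.prems] by (simp add: WS[of _ t] integral_diff)
    also have "norm \<dots> \<le> integral {0..t} (\<lambda>s. L * (A * (1/2)^n * exp (2 * L * s)))"
    proof (rule integral_norm_bound_integral)
      show "(\<lambda>s. F (W (Suc n) s) - F (W n s)) integrable_on {0..t}"
        using int[OF Suc.prems] by (intro integrable_diff)
      show "(\<lambda>s. L * (A * (1/2)^n * exp (2 * L * s))) integrable_on {0..t}"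
        using e by blast
      fix s assume "s \<in> {0..t}"
      then have "norm (W (Suc n) s - W n s) \<le> A * (1/2)^n * exp (2 * L * s)"
        using Suc by auto
      then show "norm (F (W (Suc n) s) - F (W n s)) \<le> L * (A * (1/2)^n * exp (2 * L * s))"
        using L by (intro order_trans[OF lip] mult_left_mono) auto
    qed
    also have "\<dots> \<le> A * (1/2)^Suc n * exp (2 * L * t)"
      unfolding integral_unique[OF e] using L by (simp add: A_def)
    finally show ?case .
  qed
  define w where "w t = x0 + (\<Sum>n. W (Suc n) t - W n t)" for t
  have "uniform_limit {0..T} (\<lambda>n t. \<Sum>i<n. W (Suc i) t - W i t) (\<lambda>t. \<Sum>n. W (Suc n) t - W n t) sequentially"
  proof (rule Weierstrass_m_test)
    fix n t assume t: "t \<in> {0..T}"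
    have "A \<ge> 0" using L by (simp add: A_def)
    then show "norm (W (Suc n) t - W n t) \<le> A * (1/2)^n * exp (2 * L * T)"
      using t L by (intro order_trans[OF bd[OF t]] mult_left_mono) auto
  next
    show "summable (\<lambda>n. A * (1/2)^n * exp (2 * L * T))"
      by (intro summable_mult summable_mult2 summable_geometric) auto
  qed
  then have "uniform_limit {0..T} (\<lambda>n t. x0 + (\<Sum>i<n. W (Suc i) t - W i t)) w sequentially"
    unfolding w_def[abs_def] by (intro uniform_limit_intros)
  moreover have "x0 + (\<Sum>i<n. W (Suc i) t - W i t) = W n t" for n t
    using sum_lessThan_telescope[of "\<lambda>i. W i t" n] by (simp add: W0)
  ultimately have ul: "uniform_limit {0..T} W w sequentially" by simp
  have cw: "continuous_on {0..T} w"
    using uniform_limit_theorem[OF _ ul] cont by auto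
  have ulF: "uniform_limit {0..T} (\<lambda>n s. F (W n s)) (\<lambda>s. F (w s)) sequentially"
  proof (rule uniform_limitI)
    fix e :: real assume "e > 0"
    with L have "\<forall>\<^sub>F n in sequentially. \<forall>x\<in>{0..T}. dist (W n x) (w x) < e / L"
      using uniform_limitD[OF ul, of "e / L"] by simp
    then show "\<forall>\<^sub>F n in sequentially. \<forall>x\<in>{0..T}. dist (F (W n x)) (F (w x)) < e"
    proof (rule eventually_mono, intro ballI)
      fix n x assume "\<forall>x\<in>{0..T}. dist (W n x) (w x) < e / L" "x \<in> {0..T}"
      then have "L * dist (W n x) (w x) < e" using L by (auto simp: field_simps)
      then show "dist (F (W n x)) (F (w x)) < e" using lip[of "W n x" "w x"] by (simp add: dist_norm)
    qed
  qed
  have weq: "w t = x0 + integral {0..t} (\<lambda>s. F (w s))" if t: "t \<in> {0..T}" for t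
  proof -
    have ult: "uniform_limit {0..t} (\<lambda>n s. F (W n s)) (\<lambda>s. F (w s)) sequentially"
      using t by (intro uniform_limit_on_subset[OF ulF]) auto
    have ct: "continuous_on {0..t} (\<lambda>s. F (W n s))" for n
      using t by (intro continuous_on_subset[OF contF]) auto
    obtain I J where IJ: "\<And>n. ((\<lambda>s. F (W n s)) has_integral I n) {0..t}"
        "((\<lambda>s. F (w s)) has_integral J) {0..t}" "I \<longlonglongrightarrow> J"
      using uniform_limit_integral[OF ult ct sequentially_bot] by blast
    have "(\<lambda>n. W (Suc n) t) \<longlonglongrightarrow> x0 + J"
      unfolding WS integral_unique[OF IJ(1)] by (intro tendsto_intros IJ)
    moreover have "(\<lambda>n. W (Suc n) t) \<longlonglongrightarrow> w t"
      using tendsto_uniform_limitI[OF ul t] by (rule LIMSEQ_Suc)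
    ultimately show ?thesis
      unfolding integral_unique[OF IJ(2)] using LIMSEQ_unique by blast
  qed
  have cFw: "continuous_on {0..T} (\<lambda>s. F (w s))"
    using cw by (intro continuous_on_compose2[OF F[of UNIV]]) auto
  show ?thesis
  proof (rule that)
    show "w 0 = x0" using weq[of 0] T by simp
    fix t assume t: "t \<in> {0..T}"
    have "((\<lambda>t. x0 + integral {0..t} (\<lambda>s. F (w s))) has_vector_derivative 0 + F (w t)) (at t within {0..T})"
      by (intro has_vector_derivative_add has_vector_derivative_const integral_has_vector_derivative[OF cFw t])
    then show "(w has_vector_derivative F (w t)) (at t within {0..T})"
      using weq t by (auto intro: has_vector_derivative_transform)
  qed
qed

text \<open>The partial derivatives are continuous, hence bounded on the compact ball; the sum of
  their norms bounds the operator norm, and the ball is convex, so the mean value inequality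
  applies.\<close>

lemma smooth_lipschitz_on_cball:
  fixes f :: "'a::euclidean_space \<Rightarrow> 'b::real_normed_vector"
  assumes "smooth f"
  obtains L where "0 \<le> L" "\<And>x. norm x \<le> R \<Longrightarrow> norm (f x) \<le> L"
    "\<And>x y. norm x \<le> R \<Longrightarrow> norm y \<le> R \<Longrightarrow> norm (f x - f y) \<le> L * norm (x - y)"
proof -
  obtain D where D: "\<And>x. (f has_derivative D x) (at x)" "\<And>v. smooth (\<lambda>x. D x v)"
    using smooth_has_derivative[OF assms] by blast
  have "compact ((\<lambda>x. \<Sum>b\<in>Basis. norm (D x b)) ` cball 0 R)"
    by (intro compact_continuous_image continuous_intros smooth_continuous_on D(2)) auto
  then obtain L1 where "\<forall>y\<in>(\<lambda>x. \<Sum>b\<in>Basis. norm (D x b)) ` cball 0 R. \<bar>y\<bar> \<le> L1"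
    using compact_imp_bounded bounded_real by metis
  then have L1: "(\<Sum>b\<in>Basis. norm (D x b)) \<le> L1" if "norm x \<le> R" for x
    using that by force
  have "compact (f ` cball 0 R)"
    by (intro compact_continuous_image smooth_continuous_on assms) auto
  then obtain L2 where "\<forall>y\<in>f ` cball 0 R. norm y \<le> L2"
    using compact_imp_bounded bounded_iff by metis
  then have L2: "norm (f x) \<le> L2" if "norm x \<le> R" for x
    using that by force
  have on: "onorm (D x) \<le> (\<Sum>b\<in>Basis. norm (D x b))" for x
  proof (rule onorm_le)
    fix v
    have "D x v = D x (\<Sum>b\<in>Basis. (v \<bullet> b) *\<^sub>R b)" by (simp add: euclidean_representation)
    also have "\<dots> = (\<Sum>b\<in>Basis. (v \<bullet> b) *\<^sub>R D x b)"
      using has_derivative_linear[OF D(1)] by (simp add: linear_sum linear_scale)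
    also have "norm \<dots> \<le> (\<Sum>b\<in>Basis. norm v * norm (D x b))"
      by (intro sum_norm_le) (auto intro!: mult_right_mono Basis_le_norm)
    finally show "norm (D x v) \<le> (\<Sum>b\<in>Basis. norm (D x b)) * norm v"
      by (simp add: sum_distrib_left mult.commute)
  qed
  define L where "L = \<bar>L1\<bar> + \<bar>L2\<bar>"
  show ?thesis
  proof
    show "0 \<le> L" by (simp add: L_def)
    show "norm (f x) \<le> L" if "norm x \<le> R" for x using L2[OF that] by (simp add: L_def)
    show "norm (f x - f y) \<le> L * norm (x - y)" if "norm x \<le> R" "norm y \<le> R" for x y
    proof (rule differentiable_bound[of "cball 0 R" f D])
      show "onorm (D x) \<le> L" if "x \<in> cball 0 R" for x
        using on[of x] L1[of x] that by (simp add: L_def)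
    qed (use that D in \<open>auto intro: has_derivative_at_withinI\<close>)
  qed
qed

section \<open>The gradient flow: global existence and stability\<close>

definition flow_field :: "(real^2 \<Rightarrow> real^'d) \<Rightarrow> real^'d \<Rightarrow> real^2 \<Rightarrow> real^2" where
  "flow_field \<Phi> f w = - grad (loss \<Phi> f) w"

lemma has_derivative_loss:
  assumes "(\<Phi> has_derivative D) (at w within S)"
  shows "(loss \<Phi> f has_derivative (\<lambda>h. - ((f - \<Phi> w) \<bullet> D h))) (at w within S)"
  unfolding loss_def[abs_def] power2_norm_eq_inner
  by (auto intro!: derivative_eq_intros assms simp: fun_eq_iff inner_commute inner_diff_left inner_diff_right algebra_simps)

text \<open>\<open>grad\<close> is a Hilbert choice. The derivative of the loss has a Riesz
  representative, so the choice is a genuine gradient, and uniqueness of derivatives identifies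
  it.\<close>

lemma flow_field_inner:
  assumes "(\<Phi> has_derivative D) (at w)"
  shows "flow_field \<Phi> f w \<bullet> h = (f - \<Phi> w) \<bullet> D h"
proof -
  let ?L = "\<lambda>h. - ((f - \<Phi> w) \<bullet> D h)"
  have d: "(loss \<Phi> f has_derivative ?L) (at w)" by (rule has_derivative_loss[OF assms])
  have "?L h = (\<Sum>b\<in>Basis. ?L b *\<^sub>R b) \<bullet> h" for h
  proof -
    have l: "linear D" using assms by (rule has_derivative_linear)
    have "D h = D (\<Sum>b\<in>Basis. (h \<bullet> b) *\<^sub>R b)" by (simp add: euclidean_representation)
    also have "\<dots> = (\<Sum>b\<in>Basis. (h \<bullet> b) *\<^sub>R D b)" by (simp add: linear_sum[OF l] linear_scale[OF l])
    finally show ?thesis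
      by (simp add: inner_sum_right inner_sum_left sum_negf inner_commute mult.commute)
  qed
  then have "?L = (\<lambda>h. (\<Sum>b\<in>Basis. ?L b *\<^sub>R b) \<bullet> h)" by (rule ext)
  with d have "(loss \<Phi> f has_derivative (\<lambda>h. (\<Sum>b\<in>Basis. ?L b *\<^sub>R b) \<bullet> h)) (at w)" by (rule back_subst)
  then have "\<exists>g. (loss \<Phi> f has_derivative (\<lambda>h. g \<bullet> h)) (at w)" by (rule exI)
  then have "(loss \<Phi> f has_derivative (\<lambda>h. grad (loss \<Phi> f) w \<bullet> h)) (at w)"
    unfolding grad_def by (rule someI_ex)
  then have "(\<lambda>h. grad (loss \<Phi> f) w \<bullet> h) = ?L" using d by (rule has_derivative_unique)
  then have "grad (loss \<Phi> f) w \<bullet> h = ?L h" by (rule fun_cong)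
  then show ?thesis by (simp add: flow_field_def)
qed

text \<open>A finite-time version of \<open>GF_solution\<close>: existence and stability are proved
  on bounded intervals, and the solutions are glued afterwards.\<close>

definition flow_on :: "(real^2 \<Rightarrow> real^'d) \<Rightarrow> real^'d \<Rightarrow> real \<Rightarrow> (real \<Rightarrow> real^2) \<Rightarrow> bool" where
  "flow_on \<Phi> f T w \<longleftrightarrow> w 0 = 0 \<and>
     (\<forall>t\<in>{0..T}. (w has_vector_derivative flow_field \<Phi> f (w t)) (at t within {0..T}))"

lemma GF_solution_flow_on:
  assumes "GF_solution \<Phi> f w"
  shows "flow_on \<Phi> f T w"
  unfolding flow_on_def
proof (intro conjI ballI)
  show "w 0 = 0" using assms by (simp add: GF_solution_def)
  fix t assume "t \<in> {0..T}"
  then have "(w has_vector_derivative flow_field \<Phi> f (w t)) (at t within {0..})"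
    using assms by (simp add: GF_solution_def flow_field_def)
  then show "(w has_vector_derivative flow_field \<Phi> f (w t)) (at t within {0..T})"
    by (rule has_vector_derivative_within_subset) auto
qed

lemma flow_on_mono:
  assumes "flow_on \<Phi> f T w" "S \<le> T"
  shows "flow_on \<Phi> f S w"
  unfolding flow_on_def
proof (intro conjI ballI)
  show "w 0 = 0" using assms by (simp add: flow_on_def)
  fix t assume "t \<in> {0..S}"
  then have "(w has_vector_derivative flow_field \<Phi> f (w t)) (at t within {0..T})"
    using assms by (simp add: flow_on_def)
  then show "(w has_vector_derivative flow_field \<Phi> f (w t)) (at t within {0..S})"
    by (rule has_vector_derivative_within_subset) (use assms in auto)
qed

lemma has_real_derivative_loss_flow:
  assumes "smooth \<Phi>" "(w has_vector_derivative flow_field \<Phi> f (w t)) (at t within S)"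
  shows "((\<lambda>t. loss \<Phi> f (w t)) has_real_derivative - (norm (flow_field \<Phi> f (w t)))\<^sup>2) (at t within S)"
proof -
  obtain D where D: "\<And>x. (\<Phi> has_derivative D x) (at x)" "\<And>v. smooth (\<lambda>x. D x v)"
    using smooth_has_derivative[OF assms(1)] by blast
  have "((\<lambda>t. loss \<Phi> f (w t)) has_derivative
      (\<lambda>s. - ((f - \<Phi> (w t)) \<bullet> D (w t) (s *\<^sub>R flow_field \<Phi> f (w t))))) (at t within S)"
    using has_derivative_compose[OF assms(2)[unfolded has_vector_derivative_def] has_derivative_loss[OF D(1)]] .
  moreover have "(\<lambda>s. - ((f - \<Phi> (w t)) \<bullet> D (w t) (s *\<^sub>R flow_field \<Phi> f (w t)))) =
      (*) (- (norm (flow_field \<Phi> f (w t)))\<^sup>2)"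
    by (rule ext) (simp add: flow_field_inner[OF D(1), symmetric] power2_norm_eq_inner)
  ultimately show ?thesis
    unfolding has_field_derivative_def by (rule back_subst)
qed

text \<open>The flow cannot blow up: the loss decreases at rate \<open>|g|^2\<close>, where
  \<open>g\<close> is the velocity, and this pays for the last term of
  \<open>2 * (w \<bullet> g) \<le> |w|^2 + |g|^2\<close>. So \<open>|w|^2\<close> plus the loss
  grows at most like \<open>exp t\<close>.\<close>

lemma flow_on_bound:
  assumes "smooth \<Phi>" "flow_on \<Phi> f T w" "0 \<le> t" "t \<le> T"
  shows "(norm (w t))\<^sup>2 \<le> loss \<Phi> f 0 * exp t"
proof -
  have w: "w 0 = 0" "\<And>s. s \<in> {0..t} \<Longrightarrow> (w has_vector_derivative flow_field \<Phi> f (w s)) (at s within {0..t})"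
    using flow_on_mono[OF assms(2,4)] by (auto simp: flow_on_def)
  have "(norm (w t))\<^sup>2 + loss \<Phi> f (w t) \<le> ((norm (w 0))\<^sup>2 + loss \<Phi> f (w 0)) * exp (1 * t)"
  proof (rule exp_growth_bound[OF \<open>0 \<le> t\<close>])
    fix s assume s: "s \<in> {0..t}"
    let ?g = "flow_field \<Phi> f (w s)"
    show "((\<lambda>s. (norm (w s))\<^sup>2 + loss \<Phi> f (w s)) has_real_derivative 2 * (w s \<bullet> ?g) + - (norm ?g)\<^sup>2) (at s within {0..t})"
      by (intro DERIV_add has_real_derivative_norm_square has_real_derivative_loss_flow w s assms)
    have "2 * (w s \<bullet> ?g) \<le> 2 * norm (w s) * norm ?g"
      using norm_cauchy_schwarz[of "w s" ?g] by simp
    also have "\<dots> \<le> (norm (w s))\<^sup>2 + (norm ?g)\<^sup>2" by (rule sum_squares_bound)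
    moreover have "0 \<le> loss \<Phi> f (w s)" by (simp add: loss_def)
    ultimately show "2 * (w s \<bullet> ?g) + - (norm ?g)\<^sup>2 \<le> 1 * ((norm (w s))\<^sup>2 + loss \<Phi> f (w s))" by simp
  qed
  moreover have "0 \<le> loss \<Phi> f (w t)" by (simp add: loss_def)
  ultimately show ?thesis using w(1) by simp
qed

lemma flow_field_lipschitz:
  fixes \<Phi> :: "real^2 \<Rightarrow> real^'d"
  assumes "smooth \<Phi>"
  obtains L where "0 < L"
    "\<And>f f' w w'. norm f \<le> r \<Longrightarrow> norm f' \<le> r \<Longrightarrow> norm w \<le> R \<Longrightarrow> norm w' \<le> R \<Longrightarrow>
       norm (flow_field \<Phi> f w - flow_field \<Phi> f' w') \<le> L * norm (w - w') + L * norm (f - f')"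
proof -
  obtain D where D: "\<And>x. (\<Phi> has_derivative D x) (at x)" "\<And>v. smooth (\<lambda>x. D x v)"
    using smooth_has_derivative[OF assms] by blast
  obtain M where M: "0 \<le> M" "\<And>x. norm x \<le> R \<Longrightarrow> norm (\<Phi> x) \<le> M"
    "\<And>x y. norm x \<le> R \<Longrightarrow> norm y \<le> R \<Longrightarrow> norm (\<Phi> x - \<Phi> y) \<le> M * norm (x - y)"
    using smooth_lipschitz_on_cball[OF assms] by metis
  have "\<exists>N\<ge>0. (\<forall>x. norm x \<le> R \<longrightarrow> norm (D x v) \<le> N) \<and>
    (\<forall>x y. norm x \<le> R \<longrightarrow> norm y \<le> R \<longrightarrow> norm (D x v - D y v) \<le> N * norm (x - y))" for v
    using smooth_lipschitz_on_cball[OF D(2)[of v]] by metis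
  then obtain N where N: "\<And>v. 0 \<le> N v" "\<And>x v. norm x \<le> R \<Longrightarrow> norm (D x v) \<le> N v"
    "\<And>x y v. norm x \<le> R \<Longrightarrow> norm y \<le> R \<Longrightarrow> norm (D x v - D y v) \<le> N v * norm (x - y)" by metis
  define K where "K i = M * N (axis i 1) + (\<bar>r\<bar> + M) * N (axis i 1) + N (axis i 1)" for i :: 2
  have K0: "0 \<le> K i" for i using M N by (auto simp: K_def intro!: add_nonneg_nonneg)
  define L where "L = 1 + (\<Sum>i\<in>UNIV. K i)"
  have L: "1 \<le> L" using K0 by (auto simp: L_def intro: sum_nonneg)
  have "norm (flow_field \<Phi> f w - flow_field \<Phi> f' w') \<le> L * norm (w - w') + L * norm (f - f')"
    if "norm f \<le> r" "norm f' \<le> r" "norm w \<le> R" "norm w' \<le> R" for f f' w w'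
  proof -
    have comp: "\<bar>(flow_field \<Phi> f w - flow_field \<Phi> f' w') $ i\<bar> \<le> K i * (norm (w - w') + norm (f - f'))" for i
    proof -
      let ?a = "D w (axis i 1)" and ?a' = "D w' (axis i 1)" and ?n = "N (axis i 1)"
      have "(flow_field \<Phi> f w - flow_field \<Phi> f' w') $ i
          = flow_field \<Phi> f w \<bullet> axis i 1 - flow_field \<Phi> f' w' \<bullet> axis i 1"
        by (simp add: inner_axis)
      \<comment> \<open>Bilinear splitting: the target, the value of the map and its partial
        derivative are changed one at a time.\<close>
      also have "\<dots> = (f - f') \<bullet> ?a - (\<Phi> w - \<Phi> w') \<bullet> ?a + (f' - \<Phi> w') \<bullet> (?a - ?a')"
        by (simp add: flow_field_inner[OF D(1)] algebra_simps)
      also have "\<bar>\<dots>\<bar> \<le> \<bar>(f - f') \<bullet> ?a\<bar> + \<bar>(\<Phi> w - \<Phi> w') \<bullet> ?a\<bar> + \<bar>(f' - \<Phi> w') \<bullet> (?a - ?a')\<bar>" by linarith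
      also have "\<bar>(f - f') \<bullet> ?a\<bar> \<le> norm (f - f') * ?n"
        using N that by (intro order_trans[OF Cauchy_Schwarz_ineq2] mult_left_mono) auto
      also have "\<bar>(\<Phi> w - \<Phi> w') \<bullet> ?a\<bar> \<le> (M * norm (w - w')) * ?n"
        using N M that by (intro order_trans[OF Cauchy_Schwarz_ineq2] mult_mono) auto
      also have "\<bar>(f' - \<Phi> w') \<bullet> (?a - ?a')\<bar> \<le> (\<bar>r\<bar> + M) * (?n * norm (w - w'))"
      proof (intro order_trans[OF Cauchy_Schwarz_ineq2] mult_mono)
        show "norm (f' - \<Phi> w') \<le> \<bar>r\<bar> + M"
          using norm_triangle_ineq4[of f' "\<Phi> w'"] M(2)[of w'] that by linarith
      qed (use N M that in auto)
      finally have "\<bar>(flow_field \<Phi> f w - flow_field \<Phi> f' w') $ i\<bar>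
        \<le> norm (f - f') * ?n + M * norm (w - w') * ?n + (\<bar>r\<bar> + M) * (?n * norm (w - w'))" by simp
      also have "\<dots> \<le> K i * (norm (w - w') + norm (f - f'))"
      proof -
        have "0 \<le> (M * ?n + (\<bar>r\<bar> + M) * ?n) * norm (f - f') + ?n * norm (w - w')"
          using M(1) N(1) by (intro add_nonneg_nonneg mult_nonneg_nonneg) auto
        then show ?thesis unfolding K_def by (simp add: algebra_simps)
      qed
      finally show ?thesis .
    qed
    have "norm (flow_field \<Phi> f w - flow_field \<Phi> f' w') \<le> (\<Sum>i\<in>UNIV. K i * (norm (w - w') + norm (f - f')))"
      by (intro order_trans[OF norm_le_l1_cart] sum_mono comp)
    also have "\<dots> \<le> L * (norm (w - w') + norm (f - f'))"
      unfolding L_def sum_distrib_right[symmetric] by (intro mult_right_mono) auto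
    finally show ?thesis by (simp add: distrib_left)
  qed
  with L show ?thesis by (intro that[of L]) auto
qed

lemma loss_at_0_bounded:
  obtains C where "0 \<le> C" "\<And>f. norm f \<le> r \<Longrightarrow> loss \<Phi> f 0 \<le> C"
proof
  show "0 \<le> (1/2) * (\<bar>r\<bar> + norm (\<Phi> 0))\<^sup>2" by simp
  show "loss \<Phi> f 0 \<le> (1/2) * (\<bar>r\<bar> + norm (\<Phi> 0))\<^sup>2" if "norm f \<le> r" for f
    unfolding loss_def using norm_triangle_ineq4[of f "\<Phi> 0"] that
    by (intro mult_left_mono power_mono) auto
qed

text \<open>The a priori bound confines all solutions with \<open>norm f \<le> r\<close> to one
  ball, on which the field is Lipschitz in point and target jointly. The case \<open>f = f'\<close>
  is uniqueness.\<close>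

lemma flow_on_stability:
  fixes \<Phi> :: "real^2 \<Rightarrow> real^'d"
  assumes "smooth \<Phi>" "0 \<le> T"
  obtains K where "0 \<le> K"
    "\<And>f f' w w'. norm f \<le> r \<Longrightarrow> norm f' \<le> r \<Longrightarrow> flow_on \<Phi> f T w \<Longrightarrow> flow_on \<Phi> f' T w' \<Longrightarrow>
       norm (w T - w' T) \<le> K * norm (f - f')"
proof -
  obtain C where C: "0 \<le> C" "\<And>f. norm f \<le> r \<Longrightarrow> loss \<Phi> f 0 \<le> C"
    using loss_at_0_bounded[of r \<Phi>] by blast
  define R where "R = sqrt (C * exp T)"
  have R: "norm (w t) \<le> R" if "norm f \<le> r" "flow_on \<Phi> f T w" "t \<in> {0..T}" for f w t
  proof -
    have "(norm (w t))\<^sup>2 \<le> loss \<Phi> f 0 * exp t" using flow_on_bound assms that by auto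
    also have "\<dots> \<le> C * exp T" using C that by (intro mult_mono) auto
    finally show ?thesis unfolding R_def by (rule real_le_rsqrt)
  qed
  obtain L where L: "0 < L"
    "\<And>f f' w w'. norm f \<le> r \<Longrightarrow> norm f' \<le> r \<Longrightarrow> norm w \<le> R \<Longrightarrow> norm w' \<le> R \<Longrightarrow>
       norm (flow_field \<Phi> f w - flow_field \<Phi> f' w') \<le> L * norm (w - w') + L * norm (f - f')"
    using flow_field_lipschitz[OF assms(1), of r R] by blast
  show ?thesis
  proof
    show "0 \<le> L * sqrt (exp ((2 * L + 1) * T))" using L by simp
    fix f f' w w' assume *: "norm f \<le> r" "norm f' \<le> r" "flow_on \<Phi> f T w" "flow_on \<Phi> f' T w'"
    have "(norm (w T - w' T))\<^sup>2 \<le> (L * norm (f - f'))\<^sup>2 * exp ((2 * L + 1) * T)"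
    proof (rule ode_stability)
      show "norm (flow_field \<Phi> f (w t) - flow_field \<Phi> f' (w' t)) \<le> L * norm (w t - w' t) + L * norm (f - f')"
        if "t \<in> {0..T}" for t
        using that * by (intro L(2) R) auto
    qed (use * L assms in \<open>auto simp: flow_on_def\<close>)
    then have "norm (w T - w' T) \<le> sqrt ((L * norm (f - f'))\<^sup>2 * exp ((2 * L + 1) * T))"
      by (rule real_le_rsqrt)
    then show "norm (w T - w' T) \<le> L * sqrt (exp ((2 * L + 1) * T)) * norm (f - f')"
      using L by (simp add: real_sqrt_mult mult_ac)
  qed
qed

text \<open>The field is truncated by the nearest-point projection onto a ball. The projection is
  nonexpansive, so Picard-Lindeloef applies. Up to its first arrival at the sphere the truncated
  solution is a true flow and obeys the a priori bound, so it never arrives.\<close>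

lemma flow_on_exists:
  fixes \<Phi> :: "real^2 \<Rightarrow> real^'d"
  assumes "smooth \<Phi>" "0 \<le> T"
  shows "\<exists>w. flow_on \<Phi> f T w"
proof -
  \<comment> \<open>One more than the a priori bound, so that the bound contradicts an arrival at
    radius \<open>R\<close>.\<close>
  define R where "R = sqrt (loss \<Phi> f 0 * exp T) + 1"
  have l0: "0 \<le> loss \<Phi> f w" for w by (simp add: loss_def)
  have R: "0 < R" unfolding R_def using l0[of 0] by (intro add_nonneg_pos) auto
  obtain L where L0: "0 < L"
    "\<And>f1 f2 w w'. norm f1 \<le> norm f \<Longrightarrow> norm f2 \<le> norm f \<Longrightarrow> norm w \<le> R \<Longrightarrow> norm w' \<le> R \<Longrightarrow>
       norm (flow_field \<Phi> f1 w - flow_field \<Phi> f2 w') \<le> L * norm (w - w') + L * norm (f1 - f2)"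
    using flow_field_lipschitz[OF assms(1), of "norm f" R] by blast
  have L: "0 < L" "norm (flow_field \<Phi> f w - flow_field \<Phi> f w') \<le> L * norm (w - w')"
    if "norm w \<le> R" "norm w' \<le> R" for w w'
    using L0(1) L0(2)[of f f w w'] that by auto
  define P where "P = closest_point (cball (0::real^2) R)"
  have P: "norm (P x) \<le> R" for x
    using closest_point_in_set[of "cball (0::real^2) R" x] R by (auto simp: P_def)
  have lip: "norm (flow_field \<Phi> f (P x) - flow_field \<Phi> f (P y)) \<le> L * norm (x - y)" for x y
  proof -
    have "norm (P x - P y) \<le> norm (x - y)"
      using closest_point_lipschitz[of "cball (0::real^2) R" x y] R by (auto simp: P_def dist_norm)
    then have "L * norm (P x - P y) \<le> L * norm (x - y)" using L0(1) by (intro mult_left_mono) auto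
    with L(2)[OF P[of x] P[of y]] show ?thesis by linarith
  qed
  obtain w where w: "w 0 = 0"
    "\<And>t. t \<in> {0..T} \<Longrightarrow> (w has_vector_derivative flow_field \<Phi> f (P (w t))) (at t within {0..T})"
    using picard_lindeloef[where F = "\<lambda>x. flow_field \<Phi> f (P x)" and ?x0.0 = 0, OF assms(2) L0(1) lip] by blast
  have cw: "continuous_on {0..T} w"
    by (rule continuous_on_vector_derivative[OF w(2)])
  have inside: "norm (w t) < R" if t: "t \<in> {0..T}" for t
  proof (rule ccontr)
    assume "\<not> norm (w t) < R"
    define A where "A = {s \<in> {0..T}. R \<le> norm (w s)}"
    have A: "t \<in> A" using t \<open>\<not> _\<close> by (simp add: A_def)
    have "A = {0..T} \<inter> (\<lambda>s. norm (w s)) -` {R..}" by (auto simp: A_def)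
    then have "closed A"
      using cw by (simp only:) (intro continuous_closed_preimage continuous_intros closed_atLeastAtMost closed_atLeast)
    moreover have bb: "bdd_below A" by (rule bdd_belowI[of _ 0]) (auto simp: A_def)
    ultimately have InfA: "Inf A \<in> A" using A closed_contains_Inf by blast
    define s where "s = Inf A"
    have s: "s \<in> {0..T}" "R \<le> norm (w s)" using InfA by (auto simp: A_def s_def)
    have below: "norm (w u) < R" if "u \<in> {0..<s}" for u
    proof (rule ccontr)
      assume "\<not> norm (w u) < R"
      then have "u \<in> A" using that s by (simp add: A_def)
      then show False using cInf_lower[OF _ bb, of u] that by (simp add: s_def)
    qed
    have b2: "norm (w u) \<le> sqrt (loss \<Phi> f 0 * exp T)" if u: "u \<in> {0..<s}" for u
    proof -
      have "flow_on \<Phi> f u w"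
        unfolding flow_on_def
      proof (intro conjI ballI w(1))
        fix v assume v: "v \<in> {0..u}"
        then have "P (w v) = w v"
          using below[of v] u by (auto simp: P_def intro!: closest_point_self)
        then show "(w has_vector_derivative flow_field \<Phi> f (w v)) (at v within {0..u})"
          using w(2)[of v] v u s by (auto intro: has_vector_derivative_within_subset[where S = "{0..T}"])
      qed
      then have "(norm (w u))\<^sup>2 \<le> loss \<Phi> f 0 * exp u"
        by (rule flow_on_bound[OF assms(1)]) (use u in auto)
      also have "\<dots> \<le> loss \<Phi> f 0 * exp T" using l0 u s by (intro mult_left_mono) auto
      finally show ?thesis by (rule real_le_rsqrt)
    qed
    have "0 < s" using s R w(1) by (cases "s = 0") auto
    have "norm (w s) \<le> sqrt (loss \<Phi> f 0 * exp T)"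
    proof (rule tendsto_upperbound)
      \<comment> \<open>\<open>min T u\<close> continues \<open>w\<close> by a constant beyond
        \<open>T\<close>, which makes continuity at \<open>s\<close> two-sided also when
        \<open>s = T\<close>.\<close>
      have "isCont (\<lambda>u. norm (w (min T u))) s"
      proof -
        have "continuous_on {0..} (\<lambda>u. norm (w (min T u)))"
          using assms(2) by (intro continuous_on_norm continuous_on_compose2[OF cw] continuous_intros) auto
        then show ?thesis using \<open>0 < s\<close> by (auto simp: continuous_on_interior)
      qed
      then have "((\<lambda>u. norm (w (min T u))) \<longlongrightarrow> norm (w (min T s))) (at_left s)"
        by (simp add: isCont_def filterlim_at_split)
      then show "((\<lambda>u. norm (w (min T u))) \<longlongrightarrow> norm (w s)) (at_left s)" using s by simp
      show "\<forall>\<^sub>F u in at_left s. norm (w (min T u)) \<le> sqrt (loss \<Phi> f 0 * exp T)"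
        using eventually_at_left[OF \<open>0 < s\<close>] b2 s \<open>0 < s\<close> by (auto intro!: exI[of _ 0])
    qed simp
    then show False using s by (simp add: R_def)
  qed
  have "P (w t) = w t" if "t \<in> {0..T}" for t
    using inside[OF that] by (auto simp: P_def intro!: closest_point_self)
  then show ?thesis using w by (auto simp: flow_on_def intro!: exI[of _ w])
qed

text \<open>Solutions on intervals of integer length agree on overlaps, by stability with equal
  targets, and \<open>nat \<lceil>t\<rceil>\<close> selects one that reaches
  \<open>t\<close>.\<close>

lemma GF_solution_exists:
  fixes \<Phi> :: "real^2 \<Rightarrow> real^'d"
  assumes "smooth \<Phi>"
  shows "\<exists>w. GF_solution \<Phi> f w"
proof -
  have "\<forall>n. \<exists>w. flow_on \<Phi> f (real n) w" using flow_on_exists[OF assms] by simp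
  then obtain W where W: "\<And>n. flow_on \<Phi> f (real n) (W n)" by metis
  have eq: "W n t = W m t" if t: "0 \<le> t" "t \<le> real n" "t \<le> real m" for n m t
  proof -
    obtain K where "0 \<le> K" and K: "\<And>f1 f2 w w'. norm f1 \<le> norm f \<Longrightarrow> norm f2 \<le> norm f \<Longrightarrow> flow_on \<Phi> f1 t w \<Longrightarrow>
        flow_on \<Phi> f2 t w' \<Longrightarrow> norm (w t - w' t) \<le> K * norm (f1 - f2)"
      using flow_on_stability[OF assms t(1), of "norm f"] by blast
    from K[OF order_refl order_refl flow_on_mono[OF W t(2)] flow_on_mono[OF W t(3)]]
    show ?thesis by simp
  qed
  define w where "w t = W (nat \<lceil>t\<rceil>) t" for t
  have w: "w t = W n t" if "0 \<le> t" "t \<le> real n" for n t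
    unfolding w_def using that by (intro eq) (auto intro: le_of_int_ceiling order_trans)
  have "(w has_vector_derivative flow_field \<Phi> f (w t)) (at t within {0..})" if t: "0 \<le> t" for t
  proof -
    define n where "n = nat \<lceil>t\<rceil> + 1"
    have n: "t < real n" unfolding n_def using t by linarith
    have "(W n has_vector_derivative flow_field \<Phi> f (W n t)) (at t within {0..real n})"
      using W[of n] n t by (auto simp: flow_on_def)
    then have "(W n has_vector_derivative flow_field \<Phi> f (W n t)) (at t within {0..})"
    proof -
      have "at t within {0..real n} = at t within {0..}"
      proof (rule at_within_nhd)
        show "t \<in> {..<real n}" using n by simp
      qed auto
      with \<open>(W n has_vector_derivative _) _\<close> show ?thesis by simp
    qed
    then show ?thesis
      using n t w[of _ n]
      by (auto intro!: has_vector_derivative_transform_within[where d = "real n - t" and f = "W n"] simp: dist_real_def)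
  qed
  then have "GF_solution \<Phi> f w"
    using W[of 0] w[of 0 0] by (auto simp: GF_solution_def flow_field_def flow_on_def)
  then show ?thesis by blast
qed

section \<open>Measurability of the learnable set\<close>

lemma INF_eq_0_iff:
  fixes g :: "real \<Rightarrow> real"
  assumes "\<And>t. 0 \<le> g t"
  shows "(INF t\<in>{0..}. g t) = 0 \<longleftrightarrow> (\<forall>n. \<exists>t\<ge>0. g t < 1 / real (Suc n))"
proof
  assume "(INF t\<in>{0..}. g t) = 0"
  then have "(INF t\<in>{0..}. g t) < 1 / real (Suc n)" for n by simp
  then show "\<forall>n. \<exists>t\<ge>0. g t < 1 / real (Suc n)"
    using assms by (subst (asm) cINF_less_iff) (auto intro!: bdd_belowI[of _ 0])
next
  assume *: "\<forall>n. \<exists>t\<ge>0. g t < 1 / real (Suc n)"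
  have bb: "bdd_below (g ` {0..})" using assms by (auto intro!: bdd_belowI[of _ 0])
  have "(INF t\<in>{0..}. g t) \<le> 0"
  proof (rule field_le_epsilon)
    fix e :: real assume "0 < e"
    then obtain n where "1 / real (Suc n) < e" using nat_approx_posE by blast
    with * obtain t where "t \<ge> 0" "g t < e" by (metis less_trans)
    then show "(INF t\<in>{0..}. g t) \<le> 0 + e" using cINF_lower[OF bb, of t] by simp
  qed
  moreover have "0 \<le> (INF t\<in>{0..}. g t)" using assms by (intro cINF_greatest) auto
  ultimately show "(INF t\<in>{0..}. g t) = 0" by simp
qed

lemma GF_learnable_borel:
  fixes \<Phi> :: "real^2 \<Rightarrow> real^'d"
  assumes "smooth \<Phi>"
  shows "GF_learnable \<Phi> \<in> sets borel"
proof -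
  obtain W where W: "\<And>f. GF_solution \<Phi> f (W f)"
    using GF_solution_exists[OF assms] by metis
  have stab: "\<exists>K\<ge>0. \<forall>f f' w w'. norm f \<le> r \<longrightarrow> norm f' \<le> r \<longrightarrow> GF_solution \<Phi> f w \<longrightarrow> GF_solution \<Phi> f' w' \<longrightarrow>
      norm (w t - w' t) \<le> K * norm (f - f')" if t: "0 \<le> t" for r t
  proof -
    obtain K where K: "0 \<le> K" "\<And>f f' w w'. norm f \<le> r \<Longrightarrow> norm f' \<le> r \<Longrightarrow> flow_on \<Phi> f t w \<Longrightarrow>
        flow_on \<Phi> f' t w' \<Longrightarrow> norm (w t - w' t) \<le> K * norm (f - f')"
      using flow_on_stability[OF assms t, of r] by blast
    show ?thesis
      by (intro exI[of _ K] conjI K(1) allI impI K(2) GF_solution_flow_on)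
  qed
  \<comment> \<open>Uniqueness lets the chosen solution \<open>W f\<close> replace the existential
    quantifier in \<open>GF_learnable\<close>.\<close>
  have uniq: "w t = W f t" if w: "GF_solution \<Phi> f w" and t: "0 \<le> t" for f w t
  proof -
    obtain K where "norm (w t - W f t) \<le> K * norm (f - f)"
      using stab[OF t, of "norm f"] w W by blast
    then show ?thesis by simp
  qed
  have cont: "continuous_on UNIV (\<lambda>f. W f t)" if t: "0 \<le> t" for t
  proof -
    have "isCont (\<lambda>f. W f t) f" for f
    proof -
      obtain K where K: "0 \<le> K" "\<And>g. norm g \<le> norm f + 1 \<Longrightarrow> norm (W g t - W f t) \<le> K * norm (g - f)"
        using stab[OF t, of "norm f + 1"] W by force
      have "((\<lambda>g. K * norm (g - f)) \<longlongrightarrow> K * norm (f - f)) (at f)" by (intro tendsto_intros)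
      then have z: "((\<lambda>g. K * norm (g - f)) \<longlongrightarrow> 0) (at f)" by simp
      have "((\<lambda>g. W g t - W f t) \<longlongrightarrow> 0) (at f)"
      proof (rule Lim_null_comparison[OF _ z])
        have "norm g \<le> norm f + 1" if "dist g f < 1" for g
          using that norm_triangle_sub[of g f] by (simp add: dist_norm)
        then show "\<forall>\<^sub>F g in at f. norm (W g t - W f t) \<le> K * norm (g - f)"
          using K by (auto simp: eventually_at intro!: exI[of _ 1])
      qed
      then show ?thesis unfolding isCont_def by (simp add: LIM_zero_iff)
    qed
    then show ?thesis by (simp add: continuous_at_imp_continuous_on)
  qed
  have nn: "0 \<le> loss \<Phi> f w" for f w by (simp add: loss_def)
  have "f \<in> GF_learnable \<Phi> \<longleftrightarrow> (\<forall>n. \<exists>t\<ge>0. loss \<Phi> f (W f t) < 1 / real (Suc n))" for f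
  proof -
    have "(INF t\<in>{0..}. loss \<Phi> f (w t)) = (INF t\<in>{0..}. loss \<Phi> f (W f t))" if "GF_solution \<Phi> f w" for w
      using uniq[OF that] by (intro INF_cong) auto
    then have "f \<in> GF_learnable \<Phi> \<longleftrightarrow> (INF t\<in>{0..}. loss \<Phi> f (W f t)) = 0"
      using W[of f] unfolding GF_learnable_def mem_Collect_eq by metis
    also have "\<dots> \<longleftrightarrow> (\<forall>n. \<exists>t\<ge>0. loss \<Phi> f (W f t) < 1 / real (Suc n))"
      by (rule INF_eq_0_iff) (rule nn)
    finally show ?thesis .
  qed
  \<comment> \<open>The union over \<open>t\<close> is uncountable but consists of open sets; only
    the intersection has to be countable, which is why the infimum is tested against
    \<open>1 / real (Suc n)\<close>.\<close>
  then have "GF_learnable \<Phi> = (\<Inter>n. \<Union>t\<in>{0..}. {f. loss \<Phi> f (W f t) < 1 / real (Suc n)})"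
    by (simp add: set_eq_iff Bex_def)
  moreover have "open {f. loss \<Phi> f (W f t) < 1 / real (Suc n)}" if "t \<in> {0..}" for t n
    unfolding loss_def using that
    by (intro open_Collect_less continuous_intros continuous_on_compose2[OF smooth_continuous_on[OF assms, of UNIV] cont]) auto
  then have "(\<Union>t\<in>{0..}. {f. loss \<Phi> f (W f t) < 1 / real (Suc n)}) \<in> sets borel" for n
    by (intro borel_open open_UN ballI)
  ultimately show ?thesis by (simp only:) (intro sets.countable_INT', auto)
qed

text \<open>A component of the velocity involves only the partial derivative of the map along that
  axis, so it can be read off from the map on a line, without its full derivative.\<close>

lemma GF_solution_component:
  fixes \<Phi> :: "real^2 \<Rightarrow> real^'d"
  assumes "smooth \<Phi>" "GF_solution \<Phi> f w" "0 \<le> t"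
    and "((\<lambda>s. \<Phi> (w t + s *\<^sub>R axis i 1)) has_vector_derivative p) (at 0)"
  shows "((\<lambda>t. w t $ i) has_real_derivative (f - \<Phi> (w t)) \<bullet> p) (at t within {0..})"
proof -
  obtain D where D: "\<And>x. (\<Phi> has_derivative D x) (at x)" "\<And>v. smooth (\<lambda>x. D x v)"
    using smooth_has_derivative[OF assms(1)] by blast
  have "((\<lambda>s. w t + s *\<^sub>R axis i 1) has_derivative (\<lambda>s. s *\<^sub>R axis i 1)) (at 0)"
    by (auto intro!: derivative_eq_intros)
  from has_derivative_compose[OF this, of \<Phi> "D (w t)"] D(1)
  have "((\<lambda>s. \<Phi> (w t + s *\<^sub>R axis i 1)) has_derivative (\<lambda>s. D (w t) (s *\<^sub>R axis i 1))) (at 0)" by simp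
  moreover have "D (w t) (s *\<^sub>R axis i 1) = s *\<^sub>R D (w t) (axis i 1)" for s
    using has_derivative_linear[OF D(1)] by (rule linear_scale)
  ultimately have "((\<lambda>s. \<Phi> (w t + s *\<^sub>R axis i 1)) has_vector_derivative D (w t) (axis i 1)) (at 0)"
    by (simp add: has_vector_derivative_def)
  then have p: "p = D (w t) (axis i 1)"
    by (rule vector_derivative_unique_at[OF assms(4)])
  have "(w has_vector_derivative flow_field \<Phi> f (w t)) (at t within {0..})"
    using assms by (auto simp: GF_solution_def flow_field_def)
  then have "((\<lambda>t. w t $ i) has_vector_derivative flow_field \<Phi> f (w t) $ i) (at t within {0..})"
    by (rule bounded_linear.has_vector_derivative[OF bounded_linear_vec_nth])
  moreover have "flow_field \<Phi> f (w t) $ i = (f - \<Phi> (w t)) \<bullet> p"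
    unfolding p flow_field_inner[OF D(1), symmetric] by (simp add: inner_axis)
  ultimately show ?thesis by (simp add: has_real_derivative_iff_has_vector_derivative)
qed

section \<open>Pushing a coordinate across a stage\<close>

lemma DERIV_ge_imp_growth:
  fixes f :: "real \<Rightarrow> real"
  assumes "a \<le> b" "continuous_on {a..b} f"
    and "\<And>x. a < x \<Longrightarrow> x < b \<Longrightarrow> \<exists>y. (f has_real_derivative y) (at x) \<and> m \<le> y"
  shows "m * (b - a) \<le> f b - f a"
proof -
  have "f a - m * a \<le> f b - m * b"
  proof (rule DERIV_nonneg_imp_increasing_open[OF assms(1)])
    show "\<exists>y. ((\<lambda>x. f x - m * x) has_real_derivative y) (at x) \<and> 0 \<le> y" if x: "a < x" "x < b" for x
    proof -
      obtain y where y: "(f has_real_derivative y) (at x)" "m \<le> y" using assms(3)[OF x] by blast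
      then have "((\<lambda>x. f x - m * x) has_real_derivative y - m) (at x)"
        by (auto intro!: derivative_eq_intros)
      with y show ?thesis by (intro exI[of _ "y - m"]) auto
    qed
  qed (intro continuous_intros assms)
  then show ?thesis by (simp add: algebra_simps)
qed

lemma DERIV_le_imp_growth:
  fixes f :: "real \<Rightarrow> real"
  assumes "a \<le> b" "continuous_on {a..b} f"
    and "\<And>x. a < x \<Longrightarrow> x < b \<Longrightarrow> \<exists>y. (f has_real_derivative y) (at x) \<and> y \<le> m"
  shows "f b - f a \<le> m * (b - a)"
proof -
  have "(- m) * (b - a) \<le> (- f b) - (- f a)"
  proof (rule DERIV_ge_imp_growth[OF assms(1)])
    show "\<exists>y. ((\<lambda>x. - f x) has_real_derivative y) (at x) \<and> - m \<le> y" if x: "a < x" "x < b" for x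
    proof -
      obtain y where y: "(f has_real_derivative y) (at x)" "y \<le> m" using assms(3)[OF x] by blast
      then show ?thesis by (intro exI[of _ "- y"]) (auto intro: DERIV_minus)
    qed
  qed (intro continuous_intros assms)
  then show ?thesis by (simp add: algebra_simps)
qed

text \<open>After its last time at or below \<open>a\<close> the function would stay above
  \<open>a\<close>, where it cannot increase; so a sign condition beyond the barrier is
  enough.\<close>

lemma barrier_above:
  fixes z :: "real \<Rightarrow> real"
  assumes z: "continuous_on {t0..t1} z" "z t0 \<le> a" and t: "t \<in> {t0..t1}"
    and d: "\<And>t. t0 < t \<Longrightarrow> t < t1 \<Longrightarrow> a < z t \<Longrightarrow> \<exists>y. (z has_real_derivative y) (at t) \<and> y \<le> 0"
  shows "z t \<le> a"
proof (rule ccontr)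
  assume *: "\<not> z t \<le> a"
  define A where "A = {s \<in> {t0..t}. z s \<le> a}"
  have c: "continuous_on {t0..t} z" using t by (intro continuous_on_subset[OF z(1)]) auto
  have "A = {t0..t} \<inter> z -` {..a}" by (auto simp: A_def)
  then have "closed A"
    using c by (simp only:) (intro continuous_closed_preimage closed_atLeastAtMost closed_atMost)
  moreover have bb: "bdd_above A" by (rule bdd_aboveI[of _ t]) (auto simp: A_def)
  moreover have "t0 \<in> A" using z t by (auto simp: A_def)
  ultimately have "Sup A \<in> A" using closed_contains_Sup by blast
  then have s: "Sup A \<in> {t0..t}" "z (Sup A) \<le> a" by (auto simp: A_def)
  have above: "a < z u" if "Sup A < u" "u \<le> t" for u
  proof (rule ccontr)
    assume "\<not> a < z u"
    then have "u \<in> A" using that s by (auto simp: A_def)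
    then show False using cSup_upper[OF _ bb] that by fastforce
  qed
  have "z t - z (Sup A) \<le> 0 * (t - Sup A)"
    by (rule DERIV_le_imp_growth) (use s t above d in \<open>auto intro: continuous_on_subset[OF c]\<close>)
  then show False using * s by simp
qed

lemma barrier_below:
  fixes z :: "real \<Rightarrow> real"
  assumes z: "continuous_on {t0..t1} z" "a \<le> z t0" and t: "t \<in> {t0..t1}"
    and d: "\<And>t. t0 < t \<Longrightarrow> t < t1 \<Longrightarrow> z t < a \<Longrightarrow> \<exists>y. (z has_real_derivative y) (at t) \<and> 0 \<le> y"
  shows "a \<le> z t"
proof -
  have "- z t \<le> - a"
  proof (rule barrier_above[of t0 t1 "\<lambda>t. - z t" "- a" t])
    show "\<exists>y. ((\<lambda>t. - z t) has_real_derivative y) (at s) \<and> y \<le> 0"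
      if s: "t0 < s" "s < t1" "- a < - z s" for s
    proof -
      obtain y where "(z has_real_derivative y) (at s)" "0 \<le> y" using d[OF s(1,2)] s(3) by auto
      then show ?thesis by (intro exI[of _ "- y"]) (auto intro: DERIV_minus)
    qed
  qed (use z t in \<open>auto intro: continuous_intros\<close>)
  then show ?thesis by simp
qed

lemma first_exit:
  fixes x :: "real \<Rightarrow> 'a::topological_space"
  assumes x: "continuous_on {t0..} x" and "open U" "x t0 \<in> U" and ex: "\<exists>t\<ge>t0. x t \<notin> U"
  shows "\<exists>t1>t0. x t1 \<notin> U \<and> (\<forall>t. t0 \<le> t \<longrightarrow> t < t1 \<longrightarrow> x t \<in> U)"
proof -
  define A where "A = {t0..} \<inter> x -` (- U)"
  have "closed A" unfolding A_def using assms by (intro continuous_closed_preimage) auto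
  moreover have bb: "bdd_below A" by (rule bdd_belowI[of _ t0]) (auto simp: A_def)
  moreover have "A \<noteq> {}" using ex by (auto simp: A_def)
  ultimately have "Inf A \<in> A" using closed_contains_Inf by blast
  then have s: "t0 \<le> Inf A" "x (Inf A) \<notin> U" by (auto simp: A_def)
  show ?thesis
  proof (intro exI conjI allI impI)
    show "t0 < Inf A" using s assms(3) by (cases "t0 = Inf A") auto
    show "x u \<in> U" if u: "t0 \<le> u" "u < Inf A" for u
    proof (rule ccontr)
      assume "x u \<notin> U"
      then have "u \<in> A" using u by (simp add: A_def)
      then show False using cInf_lower[OF _ bb] u by fastforce
    qed
  qed (rule s)
qed

lemma cos_3pi8_pos: "0 < cos (3 * pi / 8)"
  by (rule cos_gt_zero_pi) (use pi_gt_zero in linarith)+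

text \<open>The variable \<open>u\<close> moves forward while \<open>z\<close> is pushed towards \<open>1/4\<close>. The bound on \<open>M\<close> says
  that \<open>u\<close> lingers so long in the middle tenth of its range that \<open>z\<close> must get close to \<open>1/4\<close>.\<close>

lemma split_stage:
  fixes u z :: "real \<Rightarrow> real"
  assumes cont: "continuous_on {t0..} u" "continuous_on {t0..} z"
    and start: "u t0 = a" "\<bar>z t0\<bar> \<le> 1/8"
    and m: "0 < m" and M: "0 < M" "10 * M < \<gamma> * cos (3 * pi / 8)"
    and du: "\<And>t. t0 < t \<Longrightarrow> a - 1/8 < u t \<Longrightarrow> u t < a + 1 \<Longrightarrow> -1/4 < z t \<Longrightarrow> z t < 3/10 \<Longrightarrow>
      (u has_real_derivative u' t) (at t) \<and> m \<le> u' t"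
    and dz: "\<And>t. t0 < t \<Longrightarrow> a - 1/8 < u t \<Longrightarrow> u t < a + 1 \<Longrightarrow> -1/4 < z t \<Longrightarrow> z t < 3/10 \<Longrightarrow>
      (z has_real_derivative G t * cos (2 * pi * z t)) (at t) \<and> 0 \<le> G t"
    and slow: "\<And>t. t0 < t \<Longrightarrow> a + 9/20 \<le> u t \<Longrightarrow> u t \<le> a + 11/20 \<Longrightarrow> -1/4 < z t \<Longrightarrow> z t < 3/10 \<Longrightarrow>
      u' t \<le> M \<and> \<gamma> \<le> G t"
  obtains t1 where "t0 < t1" "u t1 = a + 1" "3/16 \<le> z t1" "z t1 \<le> 1/4"
proof -
  \<comment> \<open>The box is larger than the region that the trajectory visits: \<open>u\<close>
    starts inside by the margin \<open>1/8\<close>, and the walls \<open>-1/4\<close> and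
    \<open>3/10\<close> lie beyond the levels \<open>-1/8\<close> and \<open>1/4\<close>, which
    \<open>z\<close> is shown not to cross. The only exit left is \<open>u = a + 1\<close>.\<close>
  define U where "U = {a - 1/8<..<a + 1} \<times> {-1/4<..<3/10::real}"
  have ex: "\<exists>t\<ge>t0. (u t, z t) \<notin> U"
  proof (rule ccontr)
    assume "\<not> (\<exists>t\<ge>t0. (u t, z t) \<notin> U)"
    then have in_U: "(u t, z t) \<in> U" if "t0 \<le> t" for t using that by blast
    define t where "t = t0 + 2 / m"
    have t: "t0 \<le> t" using m by (simp add: t_def)
    have "m * (t - t0) \<le> u t - u t0"
    proof (rule DERIV_ge_imp_growth[OF t])
      show "\<exists>y. (u has_real_derivative y) (at x) \<and> m \<le> y" if "t0 < x" "x < t" for x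
        using du[of x] in_U[of x] that by (auto simp: U_def)
    qed (auto intro: continuous_on_subset[OF cont(1)])
    then show False using in_U[OF t] start m by (simp add: U_def t_def)
  qed
  have "continuous_on {t0..} (\<lambda>t. (u t, z t))" by (intro continuous_on_Pair cont)
  moreover have "open U" unfolding U_def by (intro open_Times open_greaterThanLessThan)
  moreover have "(u t0, z t0) \<in> U" using start by (auto simp: U_def)
  ultimately obtain t1 where t1: "t0 < t1" "(u t1, z t1) \<notin> U"
    "\<And>t. t0 \<le> t \<Longrightarrow> t < t1 \<Longrightarrow> (u t, z t) \<in> U"
    using first_exit[OF _ _ _ ex] by auto
  have cu: "continuous_on {s..t} u" and cz: "continuous_on {s..t} z" if "t0 \<le> s" for s t
    using that by (auto intro: continuous_on_subset[OF cont(1)] continuous_on_subset[OF cont(2)])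
  have du': "(u has_real_derivative u' t) (at t)" "m \<le> u' t"
    and dz': "(z has_real_derivative G t * cos (2 * pi * z t)) (at t)" "0 \<le> G t"
    and z_in: "-1/4 < z t" "z t < 3/10"
    if "t0 < t" "t < t1" for t
    using du[of t] dz[of t] t1(3)[of t] that by (auto simp: U_def)
  have cos_nonneg: "0 \<le> cos (2 * pi * z t)" if "-1/4 \<le> z t" "z t \<le> 1/4" for t
  proof (rule cos_ge_zero)
    have "2 * pi * (-1/4) \<le> 2 * pi * z t" "2 * pi * z t \<le> 2 * pi * (1/4)"
      using that by (intro mult_left_mono; simp)+
    then show "- (pi/2) \<le> 2 * pi * z t" "2 * pi * z t \<le> pi/2" by auto
  qed
  have cos_nonpos: "cos (2 * pi * z t) \<le> 0" if "1/4 \<le> z t" "z t \<le> 3/4" for t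
  proof -
    have "2 * pi * (1/4) \<le> 2 * pi * z t" "2 * pi * z t \<le> 2 * pi * (3/4)"
      using that by (intro mult_left_mono; simp)+
    then have "0 \<le> cos (2 * pi * z t - pi)" by (intro cos_ge_zero) linarith+
    then show ?thesis by (simp add: cos_diff)
  qed
  have u_mono: "u s \<le> u t" if "t0 \<le> s" "s \<le> t" "t \<le> t1" for s t
  proof -
    have "0 * (t - s) \<le> u t - u s"
    proof (rule DERIV_ge_imp_growth[OF that(2) cu[OF that(1)]])
      show "\<exists>y. (u has_real_derivative y) (at x) \<and> 0 \<le> y" if "s < x" "x < t" for x
        using du'[of x] m that \<open>t0 \<le> s\<close> \<open>t \<le> t1\<close> by (intro exI[of _ "u' x"]) auto
    qed
    then show ?thesis by simp
  qed
  have z_le: "z t \<le> 1/4" if t: "t \<in> {t0..t1}" for t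
  proof (rule barrier_above[OF cz[OF order_refl] _ t])
    show "\<exists>y. (z has_real_derivative y) (at t) \<and> y \<le> 0" if "t0 < t" "t < t1" "1/4 < z t" for t
      using dz'[of t] z_in[of t] cos_nonpos[of t] that
      by (intro exI[of _ "G t * cos (2 * pi * z t)"]) (auto intro: mult_nonneg_nonpos)
  qed (use start in auto)
  have z_ge: "-1/8 \<le> z t" if t: "t \<in> {t0..t1}" for t
  proof (rule barrier_below[OF cz[OF order_refl] _ t])
    show "\<exists>y. (z has_real_derivative y) (at t) \<and> 0 \<le> y" if "t0 < t" "t < t1" "z t < -1/8" for t
      using dz'[of t] z_in[of t] cos_nonneg[of t] that
      by (intro exI[of _ "G t * cos (2 * pi * z t)"]) (auto intro: mult_nonneg_nonneg)
  qed (use start in auto)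
  have z_mono: "z s \<le> z t" if "t0 \<le> s" "s \<le> t" "t \<le> t1" for s t
  proof -
    have "0 * (t - s) \<le> z t - z s"
    proof (rule DERIV_ge_imp_growth[OF that(2) cz[OF that(1)]])
      show "\<exists>y. (z has_real_derivative y) (at x) \<and> 0 \<le> y" if "s < x" "x < t" for x
        using dz'[of x] z_le[of x] z_ge[of x] cos_nonneg[of x] that \<open>t0 \<le> s\<close> \<open>t \<le> t1\<close>
        by (intro exI[of _ "G x * cos (2 * pi * z x)"]) auto
    qed
    then show ?thesis by simp
  qed
  have "a + 1 \<le> u t1"
    using t1(1,2) z_le[of t1] z_ge[of t1] u_mono[of t0 t1] start by (auto simp: U_def)
  have ivt: "\<exists>t. t0 \<le> t \<and> t \<le> t1 \<and> u t = y" if "a \<le> y" "y \<le> a + 1" for y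
    using IVT'[of u t0 y t1] that start \<open>a + 1 \<le> u t1\<close> t1(1) cu[OF order_refl] by auto
  obtain t where t: "t0 \<le> t" "t \<le> t1" "u t = a + 1" using ivt[of "a + 1"] by auto
  have "t = t1" using t1(3)[of t] t by (force simp: U_def)
  with t have ut1: "u t1 = a + 1" by simp
  \<comment> \<open>If \<open>z\<close> ended below \<open>3/16\<close>, then on the slow tenth
    \<open>2 * pi * z\<close> would be at most \<open>3 * pi / 8\<close> in absolute value, so its
    cosine would be bounded below. The crossing takes time at least \<open>1 / (10 * M)\<close>, in
    which \<open>z\<close> would rise by more than \<open>1\<close>. The value \<open>3/16\<close>
    is chosen because the child offset \<open>2 * z - 1/2\<close> then lies between
    \<open>-1/8\<close> and \<open>0\<close>, as the next split requires at its start.\<close>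
  have "3/16 \<le> z t1"
  proof (rule ccontr)
    assume "\<not> 3/16 \<le> z t1"
    obtain s1 where s1: "t0 \<le> s1" "s1 \<le> t1" "u s1 = a + 9/20" using ivt[of "a + 9/20"] by auto
    obtain s2 where s2: "t0 \<le> s2" "s2 \<le> t1" "u s2 = a + 11/20" using ivt[of "a + 11/20"] by auto
    have s12: "s1 < s2" using u_mono[of s2 s1] s1 s2 by (cases "s1 < s2") auto
    have mid: "t0 < x" "x < t1" "u' x \<le> M" "\<gamma> \<le> G x" if x: "s1 < x" "x < s2" for x
    proof -
      show *: "t0 < x" "x < t1" using x s1 s2 by auto
      show "u' x \<le> M" "\<gamma> \<le> G x"
        using slow[of x] z_in[OF *] u_mono[of s1 x] u_mono[of x s2] x s1 s2 * by auto
    qed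
    have "u s2 - u s1 \<le> M * (s2 - s1)"
    proof (rule DERIV_le_imp_growth)
      show "\<exists>y. (u has_real_derivative y) (at x) \<and> y \<le> M" if x: "s1 < x" "x < s2" for x
        using du'(1)[OF mid(1,2)[OF x]] mid(3)[OF x] by blast
    qed (use s12 s1 cu in auto)
    then have d: "1 \<le> 10 * M * (s2 - s1)" using s1 s2 by simp
    have "(\<gamma> * cos (3 * pi / 8)) * (s2 - s1) \<le> z s2 - z s1"
    proof (rule DERIV_ge_imp_growth)
      show "\<exists>y. (z has_real_derivative y) (at x) \<and> \<gamma> * cos (3 * pi / 8) \<le> y" if x: "s1 < x" "x < s2" for x
      proof -
        have "z x \<le> z t1" using mid[OF x] by (intro z_mono) auto
        then have "\<bar>z x\<bar> \<le> 3/16" using z_ge[of x] mid(1,2)[OF x] \<open>\<not> 3/16 \<le> z t1\<close> by auto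
        then have "2 * pi * \<bar>z x\<bar> \<le> 2 * pi * (3/16)" by (intro mult_left_mono) auto
        then have "\<bar>2 * pi * z x\<bar> \<le> 3 * pi / 8" by (simp add: abs_mult)
        then have "cos (3 * pi / 8) \<le> cos \<bar>2 * pi * z x\<bar>"
          by (intro cos_monotone_0_pi_le) auto
        then have "\<gamma> * cos (3 * pi / 8) \<le> G x * cos (2 * pi * z x)"
          using mid[OF x] dz'(2)[OF mid(1,2)[OF x]] cos_3pi8_pos by (intro mult_mono) auto
        then show ?thesis using dz'(1)[OF mid(1,2)[OF x]] by blast
      qed
    qed (use s12 s1 cz in auto)
    moreover have "10 * M * (s2 - s1) < (\<gamma> * cos (3 * pi / 8)) * (s2 - s1)"
      using M(2) s12 by (intro mult_strict_right_mono) auto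
    moreover have "z s2 \<le> z t1" "-1/8 \<le> z s1" using z_mono[of s2 t1] z_ge[of s1] s1 s2 by auto
    ultimately show False using d \<open>\<not> 3/16 \<le> z t1\<close> by linarith
  qed
  with that t1(1) ut1 z_le[of t1] show ?thesis by auto
qed

text \<open>Here \<open>z\<close> is at rest inside the strip, so the trajectory cannot leave
  through the sides; the positive speed of \<open>u\<close> forces the exit at
  \<open>u = a + 1\<close>.\<close>

lemma transit_stage:
  fixes u z :: "real \<Rightarrow> real"
  assumes cont: "continuous_on {t0..} u" "continuous_on {t0..} z"
    and start: "u t0 = a" "\<bar>z t0\<bar> < r" and m: "0 < m"
    and du: "\<And>t. t0 < t \<Longrightarrow> a - 1/8 < u t \<Longrightarrow> u t < a + 1 \<Longrightarrow> \<bar>z t\<bar> < r \<Longrightarrow>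
      (\<exists>y. (u has_real_derivative y) (at t) \<and> m \<le> y) \<and> (z has_real_derivative 0) (at t)"
  obtains t1 where "t0 < t1" "u t1 = a + 1" "z t1 = z t0"
proof -
  define U where "U = {a - 1/8<..<a + 1} \<times> {-r<..<r}"
  have ex: "\<exists>t\<ge>t0. (u t, z t) \<notin> U"
  proof (rule ccontr)
    assume "\<not> (\<exists>t\<ge>t0. (u t, z t) \<notin> U)"
    then have in_U: "(u t, z t) \<in> U" if "t0 \<le> t" for t using that by blast
    define t where "t = t0 + 2 / m"
    have t: "t0 \<le> t" using m by (simp add: t_def)
    have "m * (t - t0) \<le> u t - u t0"
    proof (rule DERIV_ge_imp_growth[OF t])
      show "\<exists>y. (u has_real_derivative y) (at x) \<and> m \<le> y" if "t0 < x" "x < t" for x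
        using du[of x] in_U[of x] that by (auto simp: U_def)
    qed (auto intro: continuous_on_subset[OF cont(1)])
    then show False using in_U[OF t] start m by (simp add: U_def t_def)
  qed
  have "continuous_on {t0..} (\<lambda>t. (u t, z t))" by (intro continuous_on_Pair cont)
  moreover have "open U" unfolding U_def by (intro open_Times open_greaterThanLessThan)
  moreover have "(u t0, z t0) \<in> U" using start by (auto simp: U_def)
  ultimately obtain t1 where t1: "t0 < t1" "(u t1, z t1) \<notin> U"
    "\<And>t. t0 \<le> t \<Longrightarrow> t < t1 \<Longrightarrow> (u t, z t) \<in> U"
    using first_exit[OF _ _ _ ex] by auto
  have in_U: "a - 1/8 < u t" "u t < a + 1" "\<bar>z t\<bar> < r" if "t0 \<le> t" "t < t1" for t
    using t1(3)[of t] that by (auto simp: U_def)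
  have cu: "continuous_on {t0..t1} u" and cz: "continuous_on {t0..t1} z"
    by (auto intro: continuous_on_subset[OF cont(1)] continuous_on_subset[OF cont(2)])
  have "0 * (t1 - t0) \<le> u t1 - u t0"
  proof (rule DERIV_ge_imp_growth[OF _ cu])
    show "\<exists>y. (u has_real_derivative y) (at x) \<and> 0 \<le> y" if "t0 < x" "x < t1" for x
      using du[of x] in_U[of x] that m by fastforce
  qed (use t1 in auto)
  moreover have "0 * (t1 - t0) \<le> z t1 - z t0"
    by (rule DERIV_ge_imp_growth[OF _ cz]) (use t1 du in_U in \<open>auto intro!: exI[of _ 0]\<close>)
  moreover have "z t1 - z t0 \<le> 0 * (t1 - t0)"
    by (rule DERIV_le_imp_growth[OF _ cz]) (use t1 du in_U in \<open>auto intro!: exI[of _ 0]\<close>)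
  ultimately have zt1: "z t1 = z t0" and ut1: "a \<le> u t1" using start by auto
  then have "a + 1 \<le> u t1" using t1(2) start by (auto simp: U_def)
  then obtain t where t: "t0 \<le> t" "t \<le> t1" "u t = a + 1"
    using IVT'[of u t0 "a + 1" t1] start t1(1) cu by auto
  have "t = t1" using in_U[of t] t by force
  with t show ?thesis using that t1(1) zt1 by auto
qed

section \<open>The routing map\<close>

context smooth_step
begin

lemma B_nonneg: "0 \<le> B"
  using S'_nonneg S'_le by (rule order_trans)

lemma smooth_S: "smooth f \<Longrightarrow> smooth (\<lambda>x. S (f x))"
  by (rule smooth_compose_real[OF S_smooth])

lemma S_deriv_affine:
  "((\<lambda>x. S (p * x - q)) has_real_derivative p * S' (p * x - q)) (at x)"
proof -
  have "((\<lambda>x. p * x - q) has_real_derivative p) (at x)" by (auto intro!: derivative_eq_intros)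
  from DERIV_chain2[OF S_deriv this] show ?thesis by (simp add: mult.commute)
qed

text \<open>Profiles in the stage coordinate \<open>x = u - 2k \<in> [0, 2]\<close>: \<open>transit\<close> switches from the data of
  stage \<open>k\<close> to those of stage \<open>k + 1\<close>, \<open>gate\<close> turns the splitting force on and off, and
  subtracting \<open>bump\<close> makes the drift almost stop on \<open>[9/20, 11/20]\<close> without changing the
  total decay over the stage.\<close>

definition transit :: "real \<Rightarrow> real" where "transit x = S (2 * x - 5/2)"
definition gate :: "real \<Rightarrow> real" where "gate x = S (5 * x - 1) - S (5 * x - 3)"
definition gate' :: "real \<Rightarrow> real" where "gate' x = 5 * S' (5 * x - 1) - 5 * S' (5 * x - 3)"
definition bump :: "real \<Rightarrow> real" where "bump x = (x - 1/2) * (S (20 * x - 8) - S (20 * x - 11))"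
definition bump' :: "real \<Rightarrow> real" where
  "bump' x = (S (20 * x - 8) - S (20 * x - 11)) + (x - 1/2) * (20 * S' (20 * x - 8) - 20 * S' (20 * x - 11))"
text \<open>The plateau gives every node of the \<open>v\<close>-axis a middle part that sees a
  single base point; vanishing at both ends keeps neighbouring cells apart.\<close>

definition window :: "real \<Rightarrow> real" where "window y = S (10 * y) - S (10 * y - 9)"

lemma transit_deriv: "(transit has_real_derivative 2 * S' (2 * x - 5/2)) (at x)"
  unfolding transit_def[abs_def] by (rule S_deriv_affine)

lemma gate_deriv: "(gate has_real_derivative gate' x) (at x)"
  unfolding gate_def[abs_def] gate'_def by (intro DERIV_diff S_deriv_affine)

lemma bump_deriv: "(bump has_real_derivative bump' x) (at x)"
proof -
  have "((\<lambda>x. x - 1/2) has_real_derivative 1) (at x)" by (auto intro!: derivative_eq_intros)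
  from DERIV_mult[OF this DERIV_diff[OF S_deriv_affine S_deriv_affine], of 20 8 20 11]
  show ?thesis unfolding bump_def[abs_def] bump'_def by (simp add: mult.commute)
qed

lemma transit_0: "x \<le> 5/4 \<Longrightarrow> transit x = 0" and transit_1: "7/4 \<le> x \<Longrightarrow> transit x = 1"
  by (auto simp: transit_def S_0 S_1)

lemma gate_0: "x \<le> 1/5 \<or> 4/5 \<le> x \<Longrightarrow> gate x = 0" and gate_1: "2/5 \<le> x \<Longrightarrow> x \<le> 3/5 \<Longrightarrow> gate x = 1"
  by (auto simp: gate_def S_0 S_1)

lemma gate_bounds: "0 \<le> gate x" "gate x \<le> 1"
proof -
  show "0 \<le> gate x"
    using S_nonneg[of "5 * x - 1"] S_le_1[of "5 * x - 3"] S_0[of "5 * x - 3"] S_1[of "5 * x - 1"]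
    by (cases "x \<le> 3/5") (auto simp: gate_def)
  show "gate x \<le> 1"
    using S_le_1[of "5 * x - 1"] S_nonneg[of "5 * x - 3"] by (simp add: gate_def)
qed

lemma abs_gate'_le: "\<bar>gate' x\<bar> \<le> 5 * B"
  using S'_nonneg[of "5 * x - 1"] S'_nonneg[of "5 * x - 3"] S'_le[of "5 * x - 1"] S'_le[of "5 * x - 3"]
  unfolding gate'_def abs_le_iff by linarith

lemma gate'_0: "2/5 \<le> x \<Longrightarrow> x \<le> 3/5 \<Longrightarrow> gate' x = 0"
  by (simp add: gate'_def S'_0)

lemma bump_0: "x \<le> 2/5 \<or> 3/5 \<le> x \<Longrightarrow> bump x = 0"
  by (auto simp: bump_def S_0 S_1)

lemma bump'_0: "x \<le> 2/5 \<or> 3/5 \<le> x \<Longrightarrow> bump' x = 0"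
  by (auto simp: bump'_def S_0 S_1 S'_0)

lemma bump'_1: "9/20 \<le> x \<Longrightarrow> x \<le> 11/20 \<Longrightarrow> bump' x = 1"
  by (auto simp: bump'_def S_0 S_1 S'_0)

lemma plateau_le_1: "\<bar>S (20 * x - 8) - S (20 * x - 11)\<bar> \<le> 1"
  using S_nonneg[of "20 * x - 8"] S_nonneg[of "20 * x - 11"] S_le_1[of "20 * x - 8"] S_le_1[of "20 * x - 11"]
  by linarith

lemma abs_bump_le: "\<bar>bump x\<bar> \<le> 1/10"
proof (cases "2/5 \<le> x \<and> x \<le> 3/5")
  case True
  then have "\<bar>x - 1/2\<bar> \<le> 1/10" by linarith
  then have "\<bar>x - 1/2\<bar> * \<bar>S (20 * x - 8) - S (20 * x - 11)\<bar> \<le> 1/10 * 1"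
    using plateau_le_1 by (intro mult_mono) auto
  then show ?thesis by (simp add: bump_def abs_mult)
qed (auto simp: bump_0)

text \<open>The plateau factor rises to the left of \<open>1/2\<close> and falls to the right, so
  the product of its slope with \<open>x - 1/2\<close> is never positive. The bound \<open>1\<close>
  keeps the speed factor \<open>1 - (1 - \<sigma> k) * bump' x\<close> at least
  \<open>\<sigma> k\<close>.\<close>

lemma bump'_le: "bump' x \<le> 1"
proof -
  have "(x - 1/2) * (20 * S' (20 * x - 8) - 20 * S' (20 * x - 11)) \<le> 0"
  proof (cases "x \<le> 1/2")
    case True
    then show ?thesis using S'_nonneg[of "20 * x - 8"] by (auto simp: S'_0 intro!: mult_nonpos_nonneg)
  next
    case False
    then show ?thesis using S'_nonneg[of "20 * x - 11"] by (auto simp: S'_0 intro!: mult_nonneg_nonpos)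
  qed
  then show ?thesis using plateau_le_1[of x] by (simp add: bump'_def)
qed

lemma window_0: "y \<le> 0 \<or> 1 \<le> y \<Longrightarrow> window y = 0" and window_1: "1/10 \<le> y \<Longrightarrow> y \<le> 9/10 \<Longrightarrow> window y = 1"
  by (auto simp: window_def S_0 S_1)

end

text \<open>The \<open>v\<close>-axis is divided dyadically: at level \<open>k\<close> the node \<open>j < 2\<^sup>k\<close> owns the \<open>v\<close> with
  \<open>\<bar>offset k j v\<bar> \<le> 1/2\<close>.\<close>

definition offset :: "nat \<Rightarrow> nat \<Rightarrow> real \<Rightarrow> real" where
  "offset k j v = 2 ^ k * (v + 1/2) - real j - 1/2"

text \<open>The children are centred at the parent offsets \<open>-1/4\<close> and
  \<open>1/4\<close>, the values towards which a split drives the offset.\<close>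

lemma offset_child:
  "offset (Suc k) (2 * j) v = 2 * offset k j v + 1/2"
  "offset (Suc k) (2 * j + 1) v = 2 * offset k j v - 1/2"
  by (simp_all add: offset_def algebra_simps)

text \<open>\<open>\<kappa> k\<close> bounds the distance of the targets of a level-\<open>k\<close> node to its base point \<open>c k j\<close>, and
  \<open>\<omega> k\<close> is the half-width of the gap between those of its two children. \<open>\<kappa>_le\<close> makes the radial drift
  dominate while the base point and the direction of approach change, \<open>h_small\<close> makes it dominate the
  switching of the splitting force, and \<open>\<sigma>_small\<close> gives the splitting enough time.\<close>

locale router = smooth_step S S' B for S S' :: "real \<Rightarrow> real" and B :: real +
  fixes c :: "nat \<Rightarrow> nat \<Rightarrow> real^'d" and dir :: "nat \<Rightarrow> 'd" and h \<sigma> \<kappa> \<omega> :: "nat \<Rightarrow> real" and R \<tau> :: real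
  assumes R_pos: "0 < R" and \<tau>_pos: "0 < \<tau>"
    and dir_neq: "dir (Suc k) \<noteq> dir k"
    and h_pos: "0 < h k" and h_le: "2 * h k \<le> \<omega> k"
    and \<sigma>_pos: "0 < \<sigma> k" and \<sigma>_le_1: "\<sigma> k \<le> 1"
    and \<kappa>_nonneg: "0 \<le> \<kappa> k"
    and \<kappa>_le: "\<kappa> k * (20 * B + 2 * \<tau>) \<le> \<tau> * (R * exp (- \<tau> * (2 * real k + 3))) / 2"
    and h_small: "5 * B * h k * (\<kappa> k + h k) \<le> \<tau> * (R * exp (- \<tau> * (2 * real k + 3)))\<^sup>2 / 4"
    and \<sigma>_small: "20 * \<tau> * (R * exp \<tau>)\<^sup>2 * \<sigma> k < pi * 4 ^ k * h k * \<omega> k * cos (3 * pi / 8)"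
begin

definition center :: "nat \<Rightarrow> real \<Rightarrow> real^'d" where
  "center k v = (\<Sum>j<2^k. window (2 ^ k * (v + 1/2) - real j) *\<^sub>R c k j)"

text \<open>Exponential decay in \<open>u\<close> with a local change of clock: the clock
  \<open>u - (1 - \<sigma> k) * bump (u - 2 * real k)\<close> has slope \<open>\<sigma> k\<close> on
  the middle tenth. Off the support of \<open>bump\<close> the formula is
  \<open>R * exp (- \<tau> * u)\<close> for every \<open>k\<close>, so that consecutive stages
  match.\<close>

definition radius :: "nat \<Rightarrow> real \<Rightarrow> real" where
  "radius k u = R * exp (- \<tau> * (u - (1 - \<sigma> k) * bump (u - 2 * real k)))"

text \<open>On stage \<open>k\<close> the map approaches the base point along \<open>dir (Suc k)\<close>, which is orthogonal to the
  direction \<open>dir k\<close> being split; then the direction of approach turns to \<open>dir (Suc (Suc k))\<close>. Turning on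
  the unit circle costs no radius. The splitting term peaks in \<open>v\<close> at the centres of the child nodes.\<close>

definition stage :: "nat \<Rightarrow> real^2 \<Rightarrow> real^'d" where
  "stage k w = center k (w $ 2) + transit (w $ 1 - 2 * real k) *\<^sub>R (center (Suc k) (w $ 2) - center k (w $ 2))
     - radius k (w $ 1) *\<^sub>R
       (cos (pi/2 * transit (w $ 1 - 2 * real k)) *\<^sub>R axis (dir (Suc k)) 1
        + sin (pi/2 * transit (w $ 1 - 2 * real k)) *\<^sub>R axis (dir (Suc (Suc k))) 1)
     - (gate (w $ 1 - 2 * real k) * h k * sin (2 * pi * (2 ^ k * (w $ 2 + 1/2)))) *\<^sub>R axis (dir k) 1"

text \<open>\<open>nat\<close> clamps negative indices, so stage \<open>0\<close> also covers all
  negative \<open>u\<close>.\<close>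

definition \<Phi> :: "real^2 \<Rightarrow> real^'d" where
  "\<Phi> w = stage (nat \<lfloor>w $ 1 / 2\<rfloor>) w"

lemma smooth_stage: "smooth (stage k)"
proof -
  note * = smooth_S smooth_compose_real[OF smooth_sin_cos(1)] smooth_compose_real[OF smooth_sin_cos(2)]
    smooth_compose_real[OF smooth_exp]
  show ?thesis
    unfolding stage_def[abs_def] center_def radius_def transit_def gate_def bump_def window_def
    by (intro * smooth_add smooth_diff smooth_scaleR smooth_mult smooth_sum smooth_vec_nth smooth_const)
qed

text \<open>On this strip the transit of stage \<open>k\<close> is complete, that of the next stage
  has not begun, and the gates and bumps of both vanish. The overlap makes the gluing by
  \<open>\<lfloor>w $ 1 / 2\<rfloor>\<close> smooth. The end \<open>11/5\<close> is where the next
  gate begins to open.\<close>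

lemma stage_Suc:
  assumes "2 * real k + 7/4 \<le> w $ 1" "w $ 1 \<le> 2 * real k + 11/5"
  shows "stage (Suc k) w = stage k w"
proof -
  have "transit (w $ 1 - 2 * real k) = 1" "gate (w $ 1 - 2 * real k) = 0" "bump (w $ 1 - 2 * real k) = 0"
    "transit (w $ 1 - 2 * real (Suc k)) = 0" "gate (w $ 1 - 2 * real (Suc k)) = 0" "bump (w $ 1 - 2 * real (Suc k)) = 0"
    using assms by (auto intro!: transit_0 transit_1 gate_0 bump_0)
  then show ?thesis by (simp add: stage_def radius_def)
qed

lemma \<Phi>_eq_stage:
  assumes "2 * real k - 1/4 \<le> w $ 1 \<or> k = 0" "w $ 1 \<le> 2 * real k + 11/5"
  shows "\<Phi> w = stage k w"
proof -
  define n where "n = nat \<lfloor>w $ 1 / 2\<rfloor>"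
  have lo: "w $ 1 < 2 * real n + 2" unfolding n_def by linarith
  have hi: "2 * real n \<le> w $ 1 \<or> n = 0" unfolding n_def by linarith
  have "real n < real (k + 2)" using hi assms(2) by (auto simp: field_simps)
  moreover have "real k < real (n + 2)" using lo assms(1) by (auto simp: field_simps)
  ultimately have "n < k + 2" "k < n + 2" by (simp_all only: of_nat_less_iff)
  then consider "n = k" | "n = Suc k" | "k = Suc n" by linarith
  then have "stage n w = stage k w"
  proof cases
    case 2
    then show ?thesis using hi assms(2) stage_Suc[of k w] by simp
  next
    case 3
    then show ?thesis using lo assms(1) stage_Suc[of n w] by simp
  qed simp
  then show ?thesis by (simp add: \<Phi>_def n_def)
qed

lemma smooth_\<Phi>: "smooth \<Phi>"
proof (rule smooth_local)
  fix w :: "real^2"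
  define k where "k = nat \<lfloor>w $ 1 / 2\<rfloor>"
  let ?U = "{y :: real^2. (2 * real k - 1/4 < y $ 1 \<or> k = 0) \<and> y $ 1 < 2 * real k + 11/5}"
  have "open ?U"
    by (intro open_Collect_conj open_Collect_disj open_Collect_less open_Collect_const continuous_intros)
  moreover have "w \<in> ?U" unfolding k_def by simp linarith
  moreover have "\<Phi> y = stage k y" if "y \<in> ?U" for y
    using that by (intro \<Phi>_eq_stage) auto
  ultimately show "\<exists>U g. open U \<and> w \<in> U \<and> smooth g \<and> (\<forall>y\<in>U. \<Phi> y = g y)"
    using smooth_stage by blast
qed

lemma center_eq:
  assumes "j < 2 ^ k" "\<bar>offset k j v\<bar> \<le> 2/5"
  shows "center k v = c k j"
proof -
  let ?y = "\<lambda>i. 2 ^ k * (v + 1/2) - real i"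
  have y: "1/10 \<le> ?y j" "?y j \<le> 9/10" using assms(2) unfolding offset_def by linarith+
  have "window (?y i) = 0" if "i \<noteq> j" for i
  proof (rule window_0)
    have "i + 1 \<le> j \<or> j + 1 \<le> i" using that by linarith
    then have "real i + 1 \<le> real j \<or> real j + 1 \<le> real i" by linarith
    then show "?y i \<le> 0 \<or> 1 \<le> ?y i" using y by linarith
  qed
  then have "center k v = (\<Sum>i<2^k. if i = j then c k j else 0)"
    unfolding center_def using y by (intro sum.cong) (auto simp: window_1)
  then show ?thesis using assms(1) by simp
qed

text \<open>One sine without a node index serves all nodes of a level: passing to the offset of node
  \<open>j\<close> shifts the phase by \<open>j\<close> full periods and a half one, whence the
  sign.\<close>

lemma sin_offset:
  "sin (2 * pi * (2 ^ k * (v + 1/2))) = - sin (2 * pi * offset k j v)"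
proof -
  have "2 * pi * (2 ^ k * (v + 1/2)) = (2 * pi * offset k j v + pi) + 2 * real j * pi"
    by (simp add: offset_def algebra_simps)
  moreover have "sin (x + 2 * real j * pi) = sin x" for x
    using sin_2npi[of j] cos_2npi[of j] by (simp add: sin_add)
  ultimately show ?thesis by simp
qed

lemma stage_split:
  assumes "2 * real k - 1/4 \<le> w $ 1" "w $ 1 \<le> 2 * real k + 5/4" "j < 2 ^ k" "\<bar>offset k j (w $ 2)\<bar> \<le> 2/5"
  shows "\<Phi> w = c k j - radius k (w $ 1) *\<^sub>R axis (dir (Suc k)) 1
    + (gate (w $ 1 - 2 * real k) * h k * sin (2 * pi * offset k j (w $ 2))) *\<^sub>R axis (dir k) 1"
proof -
  have "\<Phi> w = stage k w" using assms by (intro \<Phi>_eq_stage) auto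
  moreover have "transit (w $ 1 - 2 * real k) = 0" using assms by (intro transit_0) simp
  ultimately show ?thesis
    by (simp add: stage_def center_eq[OF assms(3,4)] sin_offset[of k _ j])
qed

lemma stage_transit:
  assumes "2 * real k + 4/5 \<le> w $ 1" "w $ 1 \<le> 2 * real k + 11/5"
    and "j < 2 ^ k" "\<bar>offset k j (w $ 2)\<bar> \<le> 2/5" "j' < 2 ^ Suc k" "\<bar>offset (Suc k) j' (w $ 2)\<bar> \<le> 2/5"
  shows "\<Phi> w = c k j + transit (w $ 1 - 2 * real k) *\<^sub>R (c (Suc k) j' - c k j)
    - (R * exp (- \<tau> * w $ 1)) *\<^sub>R
       (cos (pi/2 * transit (w $ 1 - 2 * real k)) *\<^sub>R axis (dir (Suc k)) 1
        + sin (pi/2 * transit (w $ 1 - 2 * real k)) *\<^sub>R axis (dir (Suc (Suc k))) 1)"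
proof -
  have "\<Phi> w = stage k w" using assms by (intro \<Phi>_eq_stage) auto
  moreover have "gate (w $ 1 - 2 * real k) = 0" "bump (w $ 1 - 2 * real k) = 0"
    using assms by (auto intro!: gate_0 bump_0)
  ultimately show ?thesis
    by (simp add: stage_def radius_def center_eq[OF assms(3,4)] center_eq[OF assms(5,6)])
qed

lemma radius_deriv:
  "(radius k has_real_derivative - (\<tau> * (1 - (1 - \<sigma> k) * bump' (u - 2 * real k)) * radius k u)) (at u)"
proof -
  have "((\<lambda>u. u - 2 * real k) has_real_derivative 1) (at u)" by (auto intro!: derivative_eq_intros)
  from DERIV_chain2[OF bump_deriv this]
  have "((\<lambda>u. bump (u - 2 * real k)) has_real_derivative bump' (u - 2 * real k)) (at u)" by simp
  then show ?thesis
    unfolding radius_def[abs_def] by (auto intro!: derivative_eq_intros)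
qed

text \<open>The bump moves the clock by at most \<open>1/10\<close>, so it stays between
  \<open>-1\<close> and \<open>2 * real k + 3\<close> with room to spare. This is the origin of the
  exponents in the size conditions of \<open>router\<close>.\<close>

lemma radius_bounds:
  assumes "2 * real k - 1/4 \<le> u" "u \<le> 2 * real k + 9/4"
  shows "R * exp (- \<tau> * (2 * real k + 3)) \<le> radius k u" "radius k u \<le> R * exp \<tau>"
proof -
  have "\<bar>(1 - \<sigma> k) * bump (u - 2 * real k)\<bar> \<le> 1 * (1/10)"
    unfolding abs_mult using \<sigma>_pos[of k] \<sigma>_le_1[of k] abs_bump_le by (intro mult_mono) auto
  then have "u - (1 - \<sigma> k) * bump (u - 2 * real k) \<le> 2 * real k + 3"
    "-1 \<le> u - (1 - \<sigma> k) * bump (u - 2 * real k)"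
    using assms by linarith+
  then have "\<tau> * (u - (1 - \<sigma> k) * bump (u - 2 * real k)) \<le> \<tau> * (2 * real k + 3)"
    "\<tau> * (-1) \<le> \<tau> * (u - (1 - \<sigma> k) * bump (u - 2 * real k))"
    using \<tau>_pos by (intro mult_left_mono; simp)+
  then show "R * exp (- \<tau> * (2 * real k + 3)) \<le> radius k u" "radius k u \<le> R * exp \<tau>"
    using R_pos by (auto simp: radius_def)
qed

end

lemma has_vector_derivative_scaleR_const:
  assumes "(a has_real_derivative a') (at x)"
  shows "((\<lambda>s. a s *\<^sub>R e) has_vector_derivative a' *\<^sub>R e) (at x)"
  using bounded_linear.has_vector_derivative[OF bounded_linear_scaleR_left[of e],
      OF assms[unfolded has_real_derivative_iff_has_vector_derivative]] .

lemma DERIV_at_0_shift: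
  fixes a :: "real \<Rightarrow> real"
  shows "(a has_real_derivative a') (at x) \<Longrightarrow> ((\<lambda>s. a (x + s)) has_real_derivative a') (at 0)"
  using DERIV_shift[of a a' 0 x] by (simp add: add.commute)

text \<open>The stage formulas hold only on parts of the plane, so the map is replaced by a formula
  valid on a short segment through the current point.\<close>

lemma flow_partial:
  fixes \<Phi> :: "real^2 \<Rightarrow> real^'d"
  assumes "smooth \<Phi>" "GF_solution \<Phi> f w" "0 < t"
    and P: "(P has_vector_derivative p) (at 0)"
    and "open U" "0 \<in> U" "\<And>s. s \<in> U \<Longrightarrow> P s = \<Phi> (w t + s *\<^sub>R axis i 1)"
  shows "((\<lambda>t. w t $ i) has_real_derivative (f - \<Phi> (w t)) \<bullet> p) (at t)"
proof -
  have "((\<lambda>s. \<Phi> (w t + s *\<^sub>R axis i 1)) has_vector_derivative p) (at 0)"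
    using has_vector_derivative_transform_within_open[OF P assms(5,6,7)] .
  then have "((\<lambda>t. w t $ i) has_real_derivative (f - \<Phi> (w t)) \<bullet> p) (at t within {0..})"
    using assms by (intro GF_solution_component) auto
  moreover have "at t within {0..} = at t"
    using \<open>0 < t\<close> by (intro at_within_interior) simp
  ultimately show ?thesis by simp
qed

lemma GF_solution_continuous:
  assumes "GF_solution \<Phi> f w"
  shows "continuous_on {0..} w"
  using assms unfolding GF_solution_def by (intro continuous_on_vector_derivative) auto

lemma offset_deriv: "(offset k j has_real_derivative 2 ^ k) (at v)"
  unfolding offset_def[abs_def] by (auto intro!: derivative_eq_intros)

section \<open>The flow while a box is split\<close>

context router
begin

text \<open>The axes \<open>dir k\<close> and \<open>dir (Suc k)\<close> are orthogonal, so the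
  velocity of \<open>u\<close> separates into the radial drift and the switching force of the gate,
  while \<open>v\<close> feels the target only through its component in the cut direction.\<close>

lemma split_flow:
  assumes sol: "GF_solution \<Phi> f w" "0 < t" and j: "j < 2 ^ k"
    and u: "2 * real k - 1/4 < w t $ 1" "w t $ 1 < 2 * real k + 5/4" and v: "\<bar>offset k j (w t $ 2)\<bar> < 2/5"
  defines "x \<equiv> w t $ 1 - 2 * real k" and "s \<equiv> sin (2 * pi * offset k j (w t $ 2))"
  shows "((\<lambda>t. w t $ 1) has_real_derivative
      \<tau> * (1 - (1 - \<sigma> k) * bump' x) * radius k (w t $ 1) * ((f - c k j) $ dir (Suc k) + radius k (w t $ 1))
      + gate' x * h k * s * ((f - c k j) $ dir k - gate x * h k * s)) (at t)"
    and "((\<lambda>t. w t $ 2) has_real_derivative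
      gate x * h k * (2 * pi * 2 ^ k * cos (2 * pi * offset k j (w t $ 2)))
       * ((f - c k j) $ dir k - gate x * h k * s)) (at t)"
proof -
  let ?u = "w t $ 1" and ?v = "w t $ 2" and ?e = "axis (dir k) 1 :: real^'d" and ?e' = "axis (dir (Suc k)) 1 :: real^'d"
  have \<Phi>w: "\<Phi> (w t) = c k j - radius k ?u *\<^sub>R ?e' + (gate x * h k * s) *\<^sub>R ?e"
    unfolding x_def s_def using u v j by (intro stage_split) auto
  have orth: "?e \<bullet> ?e' = 0" "?e' \<bullet> ?e = 0" using dir_neq[of k] by (auto simp: inner_axis_axis)
  have unit: "?e \<bullet> ?e = 1" "?e' \<bullet> ?e' = 1" by (simp_all add: inner_axis)
  have fe: "(f - c k j) \<bullet> ?e = (f - c k j) $ dir k" "(f - c k j) \<bullet> ?e' = (f - c k j) $ dir (Suc k)"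
    by (simp_all add: inner_axis)
  let ?P = "\<lambda>r. c k j - radius k (?u + r) *\<^sub>R ?e' + (gate (x + r) * h k * s) *\<^sub>R ?e"
  let ?r' = "- (\<tau> * (1 - (1 - \<sigma> k) * bump' x) * radius k ?u)"
  have "((\<lambda>r. gate (x + r) * h k * s) has_real_derivative gate' x * h k * s) (at 0)"
    using DERIV_cmult_right[OF DERIV_cmult_right[OF DERIV_at_0_shift[OF gate_deriv]]] .
  moreover have "((\<lambda>r. radius k (?u + r)) has_real_derivative ?r') (at 0)"
    unfolding x_def by (rule DERIV_at_0_shift[OF radius_deriv])
  ultimately have "(?P has_vector_derivative 0 - ?r' *\<^sub>R ?e' + (gate' x * h k * s) *\<^sub>R ?e) (at 0)"
    by (intro has_vector_derivative_add has_vector_derivative_diff has_vector_derivative_const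
        has_vector_derivative_scaleR_const)
  then have "((\<lambda>t. w t $ 1) has_real_derivative
      (f - \<Phi> (w t)) \<bullet> (0 - ?r' *\<^sub>R ?e' + (gate' x * h k * s) *\<^sub>R ?e)) (at t)"
  proof (rule flow_partial[OF smooth_\<Phi> sol])
    show "open {2 * real k - 1/4 - ?u <..< 2 * real k + 5/4 - ?u}" by simp
    show "0 \<in> {2 * real k - 1/4 - ?u <..< 2 * real k + 5/4 - ?u}" using u by simp
    fix r assume r: "r \<in> {2 * real k - 1/4 - ?u <..< 2 * real k + 5/4 - ?u}"
    show "?P r = \<Phi> (w t + r *\<^sub>R axis 1 1)"
      using stage_split[of k "w t + r *\<^sub>R axis 1 1" j] r v j
      by (simp add: axis_def x_def s_def algebra_simps)
  qed
  moreover have "(f - \<Phi> (w t)) \<bullet> (0 - ?r' *\<^sub>R ?e' + (gate' x * h k * s) *\<^sub>R ?e)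
      = - ?r' * ((f - c k j) $ dir (Suc k) + radius k ?u)
        + gate' x * h k * s * ((f - c k j) $ dir k - gate x * h k * s)"
    unfolding \<Phi>w fe[symmetric]
    by (simp add: inner_diff_left inner_add_left inner_add_right inner_diff_right orth unit algebra_simps)
  ultimately show "((\<lambda>t. w t $ 1) has_real_derivative
      \<tau> * (1 - (1 - \<sigma> k) * bump' x) * radius k ?u * ((f - c k j) $ dir (Suc k) + radius k ?u)
      + gate' x * h k * s * ((f - c k j) $ dir k - gate x * h k * s)) (at t)" by simp
  let ?Q = "\<lambda>r. c k j - radius k ?u *\<^sub>R ?e' + (gate x * h k * sin (2 * pi * offset k j (?v + r))) *\<^sub>R ?e"
  let ?d = "gate x * h k * (2 * pi * 2 ^ k * cos (2 * pi * offset k j ?v))"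
  have "((\<lambda>r. gate x * h k * sin (2 * pi * offset k j (?v + r))) has_real_derivative ?d) (at 0)"
    unfolding offset_def by (auto intro!: derivative_eq_intros)
  then have "(?Q has_vector_derivative 0 - 0 + ?d *\<^sub>R ?e) (at 0)"
    by (intro has_vector_derivative_add has_vector_derivative_diff has_vector_derivative_const
        has_vector_derivative_scaleR_const)
  then have "((\<lambda>t. w t $ 2) has_real_derivative (f - \<Phi> (w t)) \<bullet> (0 - 0 + ?d *\<^sub>R ?e)) (at t)"
  proof (rule flow_partial[OF smooth_\<Phi> sol])
    show "open {r. \<bar>offset k j (?v + r)\<bar> < 2/5}"
      unfolding offset_def by (intro open_Collect_less continuous_intros)
    show "0 \<in> {r. \<bar>offset k j (?v + r)\<bar> < 2/5}" using v by simp
    fix r assume "r \<in> {r. \<bar>offset k j (?v + r)\<bar> < 2/5}"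
    then show "?Q r = \<Phi> (w t + r *\<^sub>R axis 2 1)"
      using stage_split[of k "w t + r *\<^sub>R axis 2 1" j] u j
      by (simp add: axis_def x_def)
  qed
  moreover have "(f - \<Phi> (w t)) \<bullet> (0 - 0 + ?d *\<^sub>R ?e) = ?d * ((f - c k j) $ dir k - gate x * h k * s)"
    unfolding \<Phi>w fe[symmetric]
    by (simp add: inner_diff_left inner_add_left orth unit algebra_simps)
  ultimately show "((\<lambda>t. w t $ 2) has_real_derivative
      gate x * h k * (2 * pi * 2 ^ k * cos (2 * pi * offset k j ?v))
       * ((f - c k j) $ dir k - gate x * h k * s)) (at t)" by (simp only:)
qed

abbreviation (input) min_radius :: "nat \<Rightarrow> real" where
  "min_radius k \<equiv> R * exp (- \<tau> * (2 * real k + 3))"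

text \<open>This keeps the residual's component along the approach direction at least half the
  minimal radius.\<close>

lemma \<kappa>_le_half: "\<kappa> k \<le> min_radius k / 2"
proof -
  have "\<kappa> k * \<tau> \<le> \<kappa> k * (20 * B + 2 * \<tau>)"
    using \<kappa>_nonneg[of k] B_nonneg \<tau>_pos by (intro mult_left_mono) auto
  also have "\<dots> \<le> \<tau> * min_radius k / 2" by (rule \<kappa>_le)
  finally show ?thesis using \<tau>_pos by (simp add: field_simps)
qed

text \<open>Slowing and switching never coincide. On \<open>[2/5, 3/5]\<close> the gate is constant
  and the reduced drift, with factor at least \<open>\<sigma> k\<close>, stands alone. Elsewhere the
  drift has full strength, at least \<open>\<tau> * r0^2 / 2\<close> for the minimal radius
  \<open>r0\<close>, and \<open>h_small\<close> bounds the switching force by half of that.\<close>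

lemma drift_lower_bound:
  assumes u: "2 * real k - 1/4 \<le> u" "u \<le> 2 * real k + 9/4" and q: "\<bar>q\<bar> \<le> \<kappa> k" and y: "\<bar>y\<bar> \<le> \<kappa> k" and s: "\<bar>s\<bar> \<le> 1"
  defines "x \<equiv> u - 2 * real k"
  shows "\<tau> * \<sigma> k * (min_radius k)\<^sup>2 / 4 \<le>
    \<tau> * (1 - (1 - \<sigma> k) * bump' x) * radius k u * (q + radius k u) + gate' x * h k * s * (y - gate x * h k * s)"
proof -
  define r0 where "r0 = min_radius k"
  let ?\<rho> = "radius k u" and ?\<theta> = "1 - (1 - \<sigma> k) * bump' x"
  have r: "0 < r0" using R_pos by (simp add: r0_def)
  have \<rho>: "r0 \<le> ?\<rho>" using radius_bounds(1)[OF u] by (simp add: r0_def)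
  have "r0 / 2 \<le> q + ?\<rho>" using \<kappa>_le_half[of k, folded r0_def] q \<rho> by linarith
  then have *: "r0 * (r0 / 2) \<le> ?\<rho> * (q + ?\<rho>)" using r \<rho> by (intro mult_mono) auto
  have "(1 - \<sigma> k) * bump' x \<le> (1 - \<sigma> k) * 1"
    using \<sigma>_le_1[of k] bump'_le by (intro mult_left_mono) auto
  then have \<theta>: "\<sigma> k \<le> ?\<theta>" by simp
  have main: "\<tau> * \<theta> * (r0 * (r0 / 2)) \<le> \<tau> * \<theta> * ?\<rho> * (q + ?\<rho>)" if "0 \<le> \<theta>" for \<theta>
  proof -
    have "\<tau> * \<theta> * (r0 * (r0 / 2)) \<le> \<tau> * \<theta> * (?\<rho> * (q + ?\<rho>))"
      using * \<tau>_pos that by (intro mult_left_mono) auto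
    then show ?thesis by (simp add: mult.assoc)
  qed
  have sq: "\<tau> * \<sigma> k * r0\<^sup>2 \<le> \<tau> * r0\<^sup>2"
    using \<sigma>_le_1[of k] \<tau>_pos by (intro mult_right_mono) auto
  have "\<tau> * \<sigma> k * r0\<^sup>2 / 4 \<le>
    \<tau> * ?\<theta> * ?\<rho> * (q + ?\<rho>) + gate' x * h k * s * (y - gate x * h k * s)"
  proof (cases "2/5 \<le> x \<and> x \<le> 3/5")
    case True
    have "\<tau> * \<sigma> k * r0\<^sup>2 / 4 \<le> \<tau> * \<sigma> k * (r0 * (r0 / 2))"
      using \<tau>_pos \<sigma>_pos[of k] r by (simp add: power2_eq_square)
    also have "\<dots> \<le> \<tau> * ?\<theta> * (r0 * (r0 / 2))"
      using \<theta> \<tau>_pos r by (intro mult_right_mono mult_left_mono) auto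
    also have "\<dots> \<le> \<tau> * ?\<theta> * ?\<rho> * (q + ?\<rho>)" using \<theta> \<sigma>_pos[of k] by (intro main) auto
    finally show ?thesis using True by (simp add: gate'_0)
  next
    case False
    then have b: "bump' x = 0" by (intro bump'_0) auto
    have "\<bar>gate x * h k * s\<bar> \<le> 1 * h k * 1"
      unfolding abs_mult using gate_bounds[of x] h_pos[of k] s by (intro mult_mono) auto
    then have "\<bar>y - gate x * h k * s\<bar> \<le> \<kappa> k + h k" using y by linarith
    moreover have "\<bar>gate' x * h k * s\<bar> \<le> 5 * B * h k * 1"
      unfolding abs_mult using abs_gate'_le[of x] h_pos[of k] B_nonneg s by (intro mult_mono) auto
    ultimately have "\<bar>gate' x * h k * s * (y - gate x * h k * s)\<bar> \<le> 5 * B * h k * 1 * (\<kappa> k + h k)"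
      unfolding abs_mult[of _ "y - gate x * h k * s"] using h_pos[of k] B_nonneg by (intro mult_mono) auto
    also have "\<dots> \<le> \<tau> * r0\<^sup>2 / 4" using h_small[of k, folded r0_def] by simp
    finally have "- (\<tau> * r0\<^sup>2 / 4) \<le> gate' x * h k * s * (y - gate x * h k * s)" by linarith
    moreover have "\<tau> * r0\<^sup>2 / 2 \<le> \<tau> * 1 * ?\<rho> * (q + ?\<rho>)"
      using main[of 1] by (simp add: power2_eq_square)
    ultimately show ?thesis using sq b by simp
  qed
  then show ?thesis by (simp only: r0_def)
qed

lemma split_traverse:
  assumes sol: "GF_solution \<Phi> f w" "0 \<le> t0" and j: "j < 2 ^ k"
    and start: "w t0 $ 1 = 2 * real k" "\<bar>offset k j (w t0 $ 2)\<bar> \<le> 1/8"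
    and near: "norm (f - c k j) \<le> \<kappa> k" and p: "\<bar>p\<bar> = 1" "\<omega> k \<le> p * (f - c k j) $ dir k"
  shows "\<exists>t1>t0. w t1 $ 1 = 2 * real k + 1 \<and> 3/16 \<le> p * offset k j (w t1 $ 2) \<and> p * offset k j (w t1 $ 2) \<le> 1/4"
proof -
  \<comment> \<open>The sign \<open>p\<close> reflects the offset, so that both sides of the cut
    become the case of a target on the positive side.\<close>
  define z where "z t = p * offset k j (w t $ 2)" for t
  define x where "x t = w t $ 1 - 2 * real k" for t
  define y where "y = (f - c k j) $ dir k"
  define q where "q = (f - c k j) $ dir (Suc k)"
  have yq: "\<bar>y\<bar> \<le> \<kappa> k" "\<bar>q\<bar> \<le> \<kappa> k"
    using component_le_norm_cart[of "f - c k j"] near unfolding y_def q_def by (meson order_trans)+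
  have p_cases: "p = 1 \<or> p = -1" using p(1) by (auto simp: abs_if split: if_splits)
  have cw: "continuous_on {t0..} w"
    using continuous_on_subset[OF GF_solution_continuous[OF sol(1)]] sol(2) by auto
  let ?s = "\<lambda>t. sin (2 * pi * offset k j (w t $ 2))"
  let ?u' = "\<lambda>t. \<tau> * (1 - (1 - \<sigma> k) * bump' (x t)) * radius k (w t $ 1) * (q + radius k (w t $ 1))
    + gate' (x t) * h k * ?s t * (y - gate (x t) * h k * ?s t)"
  \<comment> \<open>One factor \<open>2 ^ k\<close> is the frequency of the sine in
    \<open>v\<close>, the other converts \<open>v\<close> into the offset.\<close>
  let ?G = "\<lambda>t. (2 * pi * (2 ^ k * 2 ^ k) * (gate (x t) * h k)) * (p * y - gate (x t) * h k * sin (2 * pi * z t))"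
  have G_factor: "\<omega> k / 2 \<le> p * y - gate (x t) * h k * sin (2 * pi * z t)" for t
  proof -
    have "\<bar>gate (x t) * h k * sin (2 * pi * z t)\<bar> \<le> 1 * h k * 1"
      unfolding abs_mult using gate_bounds[of "x t"] h_pos[of k] by (intro mult_mono) auto
    then show ?thesis using p(2) h_le[of k] by (simp add: y_def)
  qed
  have \<omega>: "0 < \<omega> k" using h_pos[of k] h_le[of k] by linarith
  \<comment> \<open>On the middle tenth the speed of \<open>u\<close> is at most
    \<open>\<tau> * \<sigma> k\<close> times
    \<open>(R * exp \<tau>) * (2 * (R * exp \<tau>))\<close>, and \<open>?G\<close> is at least
    \<open>2 * pi * 4 ^ k * h k\<close> times \<open>\<omega> k / 2\<close>; these are the two rates
    compared in \<open>\<sigma>_small\<close>.\<close>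
  obtain t1 where "t0 < t1" "w t1 $ 1 = 2 * real k + 1" "3/16 \<le> z t1" "z t1 \<le> 1/4"
  proof (rule split_stage[of t0 "\<lambda>t. w t $ 1" z "2 * real k" "\<tau> * \<sigma> k * (min_radius k)\<^sup>2 / 4"
        "2 * \<tau> * (R * exp \<tau>)\<^sup>2 * \<sigma> k" "pi * 4 ^ k * h k * \<omega> k" ?u' ?G])
    show "continuous_on {t0..} (\<lambda>t. w t $ 1)" using cw by (intro continuous_intros)
    show "continuous_on {t0..} z" unfolding z_def offset_def using cw by (intro continuous_intros)
    show "\<bar>z t0\<bar> \<le> 1/8" using start(2) p(1) by (simp add: z_def abs_mult)
    show "0 < \<tau> * \<sigma> k * (min_radius k)\<^sup>2 / 4" "0 < 2 * \<tau> * (R * exp \<tau>)\<^sup>2 * \<sigma> k"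
      using \<tau>_pos \<sigma>_pos R_pos by simp_all
    show "10 * (2 * \<tau> * (R * exp \<tau>)\<^sup>2 * \<sigma> k) < pi * 4 ^ k * h k * \<omega> k * cos (3 * pi / 8)"
      using \<sigma>_small[of k] by simp
  next
    fix t assume t: "t0 < t" "2 * real k - 1/8 < w t $ 1" "w t $ 1 < 2 * real k + 1" "-1/4 < z t" "z t < 3/10"
    have off: "\<bar>offset k j (w t $ 2)\<bar> < 2/5" using t p_cases by (auto simp: z_def)
    have "0 < t" using t sol by simp
    note d = split_flow[OF sol(1) this j _ _ off, folded x_def y_def q_def]
    show "((\<lambda>t. w t $ 1) has_real_derivative ?u' t) (at t) \<and> \<tau> * \<sigma> k * (min_radius k)\<^sup>2 / 4 \<le> ?u' t"
      using d(1) t drift_lower_bound[of k "w t $ 1" q y "?s t"] yq by (auto simp: x_def)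
    have "(z has_real_derivative p * (2 ^ k * (gate (x t) * h k * (2 * pi * 2 ^ k * cos (2 * pi * offset k j (w t $ 2)))
       * (y - gate (x t) * h k * ?s t)))) (at t)"
      unfolding z_def using d(2) t by (intro DERIV_cmult DERIV_chain2[OF offset_deriv]) auto
    moreover have "p * (2 ^ k * (gate (x t) * h k * (2 * pi * 2 ^ k * cos (2 * pi * offset k j (w t $ 2)))
       * (y - gate (x t) * h k * ?s t))) = ?G t * cos (2 * pi * z t)"
      using p_cases by (auto simp: z_def algebra_simps)
    moreover have "0 \<le> ?G t"
      using G_factor[of t] \<omega> gate_bounds[of "x t"] h_pos[of k] by (intro mult_nonneg_nonneg) auto
    ultimately show "(z has_real_derivative ?G t * cos (2 * pi * z t)) (at t) \<and> 0 \<le> ?G t" by simp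
  next
    fix t assume t: "t0 < t" "2 * real k + 9/20 \<le> w t $ 1" "w t $ 1 \<le> 2 * real k + 11/20" "-1/4 < z t" "z t < 3/10"
    have x: "9/20 \<le> x t" "x t \<le> 11/20" using t by (auto simp: x_def)
    have g: "gate (x t) = 1" "gate' (x t) = 0" "bump' (x t) = 1"
      using x by (auto intro: gate_1 gate'_0 bump'_1)
    have \<rho>: "min_radius k \<le> radius k (w t $ 1)" "radius k (w t $ 1) \<le> R * exp \<tau>"
      using radius_bounds[of k "w t $ 1"] t by auto
    have "0 < min_radius k" using R_pos by simp
    then have "radius k (w t $ 1) * (q + radius k (w t $ 1)) \<le> (R * exp \<tau>) * (2 * (R * exp \<tau>))"
      using \<rho> yq \<kappa>_le_half[of k] by (intro mult_mono) auto
    then have "\<tau> * \<sigma> k * (radius k (w t $ 1) * (q + radius k (w t $ 1))) \<le> \<tau> * \<sigma> k * ((R * exp \<tau>) * (2 * (R * exp \<tau>)))"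
      using \<tau>_pos \<sigma>_pos[of k] by (intro mult_left_mono) auto
    moreover have "pi * 4 ^ k * h k * \<omega> k \<le> ?G t"
    proof -
      have "(2 * pi * (2 ^ k * 2 ^ k) * h k) * (\<omega> k / 2) \<le> ?G t"
        using G_factor[of t] h_pos[of k] \<omega> unfolding g by (intro mult_mono) auto
      moreover have "(2::real) ^ k * 2 ^ k = 4 ^ k" by (simp flip: power_mult_distrib)
      ultimately show ?thesis by (simp add: mult_ac)
    qed
    ultimately show "?u' t \<le> 2 * \<tau> * (R * exp \<tau>)\<^sup>2 * \<sigma> k \<and> pi * 4 ^ k * h k * \<omega> k \<le> ?G t"
      by (simp add: g power2_eq_square mult_ac)
  qed (use start in auto)
  then show ?thesis unfolding z_def by blast
qed

end

section \<open>The flow between two splits, and tracking through all stages\<close>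

context router
begin

text \<open>Turning is orthogonal to the radial direction, so the terms with
  \<open>pi/2 * b'\<close> cancel in \<open>main\<close> and the drift
  \<open>\<tau> * \<rho>^2\<close> survives. The five error terms are at most
  \<open>\<rho> * \<kappa> k\<close> times \<open>4 * B\<close>, \<open>\<tau> + 4 * B\<close>,
  \<open>\<tau> + 4 * B\<close>, \<open>4 * B\<close> and \<open>4 * B\<close>; their sum is the
  origin of \<open>20 * B + 2 * \<tau>\<close> in \<open>\<kappa>_le\<close>.\<close>

lemma transit_drift:
  fixes D d :: "real^'d" and A e e' :: "real^'d"
  assumes u: "u \<le> 2 * real k + 11/5" and D: "norm D \<le> \<kappa> k" and d: "norm d \<le> 2 * \<kappa> k"
    and b: "0 \<le> b'" "b' \<le> 2 * B" and e: "norm e = 1" "norm e' = 1" "e \<bullet> e' = 0"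
  defines "\<rho> \<equiv> R * exp (- \<tau> * u)"
  shows "\<tau> * (min_radius k)\<^sup>2 / 2 \<le> (D + (\<rho> * cos \<theta>) *\<^sub>R e + (\<rho> * sin \<theta>) *\<^sub>R e') \<bullet>
    (b' *\<^sub>R d - (\<rho> * (- \<tau> * cos \<theta> - pi/2 * b' * sin \<theta>)) *\<^sub>R e
      - (\<rho> * (- \<tau> * sin \<theta> + pi/2 * b' * cos \<theta>)) *\<^sub>R e')"
proof -
  define r where "r = min_radius k"
  have r: "0 < r" using R_pos by (simp add: r_def)
  have "\<tau> * u \<le> \<tau> * (2 * real k + 3)" using u \<tau>_pos by (intro mult_left_mono) auto
  then have \<rho>: "r \<le> \<rho>" using R_pos by (simp add: r_def \<rho>_def)
  have \<rho>0: "0 < \<rho>" using r \<rho> by simp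
  have \<kappa>: "\<kappa> k \<le> \<rho>" using \<kappa>_le_half[of k, folded r_def] r \<rho> by linarith
  define a where "a = \<rho> * (- \<tau> * cos \<theta> - pi/2 * b' * sin \<theta>)"
  define a' where "a' = \<rho> * (- \<tau> * sin \<theta> + pi/2 * b' * cos \<theta>)"
  have coeff: "\<bar>\<rho> * (p * \<tau> + q * (pi/2 * b'))\<bar> \<le> \<rho> * (\<tau> + 4 * B)" if "\<bar>p\<bar> \<le> 1" "\<bar>q\<bar> \<le> 1" for p q
  proof -
    have "\<bar>p * \<tau>\<bar> \<le> 1 * \<tau>" unfolding abs_mult using that \<tau>_pos by (intro mult_mono) auto
    moreover have "\<bar>q * (pi/2 * b')\<bar> \<le> 1 * (2 * (2 * B))"
      unfolding abs_mult using that b pi_less_4 B_nonneg by (intro mult_mono) auto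
    ultimately have "\<bar>p * \<tau> + q * (pi/2 * b')\<bar> \<le> \<tau> + 4 * B" by linarith
    then have "\<rho> * \<bar>p * \<tau> + q * (pi/2 * b')\<bar> \<le> \<rho> * (\<tau> + 4 * B)" using \<rho>0 by (intro mult_left_mono) auto
    then show ?thesis using \<rho>0 by (simp add: abs_mult)
  qed
  have a: "\<bar>a\<bar> \<le> \<rho> * (\<tau> + 4 * B)" "\<bar>a'\<bar> \<le> \<rho> * (\<tau> + 4 * B)"
    using coeff[of "- cos \<theta>" "- sin \<theta>"] coeff[of "- sin \<theta>" "cos \<theta>"]
    by (simp_all add: a_def a'_def mult_ac)
  have main: "\<rho> * cos \<theta> * a + \<rho> * sin \<theta> * a' = - (\<tau> * \<rho>\<^sup>2)"
  proof -
    have "\<rho> * C * (\<rho> * (- \<tau> * C - q * s)) + \<rho> * s * (\<rho> * (- \<tau> * s + q * C)) = - (\<tau> * \<rho>\<^sup>2) * (s\<^sup>2 + C\<^sup>2)"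
      for C s q :: real by (simp add: algebra_simps power2_eq_square)
    from this[of "cos \<theta>" "pi/2 * b'" "sin \<theta>"] show ?thesis by (simp add: a_def a'_def)
  qed
  have eq: "(D + (\<rho> * cos \<theta>) *\<^sub>R e + (\<rho> * sin \<theta>) *\<^sub>R e') \<bullet> (b' *\<^sub>R d - a *\<^sub>R e - a' *\<^sub>R e')
    = \<tau> * \<rho>\<^sup>2 + b' * (D \<bullet> d) - a * (D \<bullet> e) - a' * (D \<bullet> e')
      + \<rho> * cos \<theta> * (b' * (e \<bullet> d)) + \<rho> * sin \<theta> * (b' * (e' \<bullet> d))"
  proof -
    have "e \<bullet> e = 1" "e' \<bullet> e' = 1" using e by (simp_all add: norm_eq_1)
    then show ?thesis
      using main e(3) by (simp add: inner_add_left inner_diff_right inner_commute[of e' e] algebra_simps)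
  qed
  have De: "\<bar>D \<bullet> e\<bar> \<le> \<kappa> k" "\<bar>D \<bullet> e'\<bar> \<le> \<kappa> k"
    using Cauchy_Schwarz_ineq2[of D e] Cauchy_Schwarz_ineq2[of D e'] D e by auto
  have ed: "\<bar>e \<bullet> d\<bar> \<le> 2 * \<kappa> k" "\<bar>e' \<bullet> d\<bar> \<le> 2 * \<kappa> k"
    using Cauchy_Schwarz_ineq2[of e d] Cauchy_Schwarz_ineq2[of e' d] d e by auto
  have "\<bar>D \<bullet> d\<bar> \<le> \<rho> * (2 * \<kappa> k)"
    using \<rho>0 \<kappa> \<kappa>_nonneg[of k] D d by (intro order_trans[OF Cauchy_Schwarz_ineq2] mult_mono) auto
  then have t1: "\<bar>b' * (D \<bullet> d)\<bar> \<le> (2 * B) * (\<rho> * (2 * \<kappa> k))"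
    unfolding abs_mult using b B_nonneg by (intro mult_mono) auto
  have t2: "\<bar>a * (D \<bullet> e)\<bar> \<le> \<rho> * (\<tau> + 4 * B) * \<kappa> k" "\<bar>a' * (D \<bullet> e')\<bar> \<le> \<rho> * (\<tau> + 4 * B) * \<kappa> k"
    unfolding abs_mult using a De \<rho>0 \<tau>_pos B_nonneg by (auto intro!: mult_mono)
  have t3: "\<bar>\<rho> * p * (b' * q)\<bar> \<le> \<rho> * 1 * (2 * B * (2 * \<kappa> k))" if "\<bar>p\<bar> \<le> 1" "\<bar>q\<bar> \<le> 2 * \<kappa> k" for p q
    unfolding abs_mult using that \<rho>0 b B_nonneg \<kappa>_nonneg[of k] by (intro mult_mono) auto
  have "\<rho> * (\<kappa> k * (20 * B + 2 * \<tau>)) \<le> \<rho> * (\<tau> * \<rho> / 2)"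
  proof (rule mult_left_mono)
    have "\<tau> * r \<le> \<tau> * \<rho>" using \<rho> \<tau>_pos by (intro mult_left_mono) auto
    then show "\<kappa> k * (20 * B + 2 * \<tau>) \<le> \<tau> * \<rho> / 2" using \<kappa>_le[of k, folded r_def] by linarith
  qed (use \<rho>0 in simp)
  moreover have "\<rho> * (\<kappa> k * (20 * B + 2 * \<tau>)) = (2 * B) * (\<rho> * (2 * \<kappa> k)) + \<rho> * (\<tau> + 4 * B) * \<kappa> k
      + \<rho> * (\<tau> + 4 * B) * \<kappa> k + \<rho> * 1 * (2 * B * (2 * \<kappa> k)) + \<rho> * 1 * (2 * B * (2 * \<kappa> k))"
    by (simp add: algebra_simps)
  moreover have "\<tau> * r\<^sup>2 \<le> \<tau> * \<rho>\<^sup>2"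
    using \<rho> r \<tau>_pos by (intro mult_left_mono power_mono) auto
  moreover have "\<rho> * (\<tau> * \<rho> / 2) = \<tau> * \<rho>\<^sup>2 / 2" by (simp add: power2_eq_square)
  ultimately have "\<tau> * r\<^sup>2 / 2 \<le> \<tau> * \<rho>\<^sup>2 + b' * (D \<bullet> d) - a * (D \<bullet> e) - a' * (D \<bullet> e')
      + \<rho> * cos \<theta> * (b' * (e \<bullet> d)) + \<rho> * sin \<theta> * (b' * (e' \<bullet> d))"
    using abs_le_D2[OF t1] abs_le_D1[OF t2(1)] abs_le_D1[OF t2(2)]
      abs_le_D2[OF t3[OF abs_cos_le_one[of \<theta>] ed(1)]] abs_le_D2[OF t3[OF abs_sin_le_one[of \<theta>] ed(2)]]
    by linarith
  then show ?thesis unfolding a_def a'_def r_def by (simp only: eq[unfolded a_def a'_def])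
qed

text \<open>The base point moves on the segment between two points that both lie within
  \<open>\<kappa> k\<close> of the target, so the difference to it is a convex combination and stays
  within \<open>\<kappa> k\<close>. On the two plateaus the map is locally constant in
  \<open>v\<close>, hence \<open>v\<close> is at rest.\<close>

lemma transit_flow:
  assumes sol: "GF_solution \<Phi> f w" "0 < t" and j: "j < 2 ^ k" "j' < 2 ^ Suc k"
    and u: "2 * real k + 4/5 < w t $ 1" "w t $ 1 < 2 * real k + 11/5"
    and v: "\<bar>offset k j (w t $ 2)\<bar> < 2/5" "\<bar>offset (Suc k) j' (w t $ 2)\<bar> < 2/5"
    and near: "norm (f - c k j) \<le> \<kappa> k" "norm (f - c (Suc k) j') \<le> \<kappa> k"
  shows "\<exists>y. ((\<lambda>t. w t $ 1) has_real_derivative y) (at t) \<and> \<tau> * (min_radius k)\<^sup>2 / 2 \<le> y"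
    and "((\<lambda>t. w t $ 2) has_real_derivative 0) (at t)"
proof -
  let ?u = "w t $ 1" and ?v = "w t $ 2"
    and ?e = "axis (dir (Suc k)) 1 :: real^'d" and ?e' = "axis (dir (Suc (Suc k))) 1 :: real^'d"
  define x where "x = ?u - 2 * real k"
  define d where "d = c (Suc k) j' - c k j"
  define b where "b = transit x"
  define b' where "b' = 2 * S' (2 * x - 5/2)"
  define \<rho> where "\<rho> = R * exp (- \<tau> * ?u)"
  define \<theta> where "\<theta> = pi/2 * b"
  have \<Phi>w: "\<Phi> (w t) = c k j + b *\<^sub>R d - \<rho> *\<^sub>R (cos \<theta> *\<^sub>R ?e + sin \<theta> *\<^sub>R ?e')"
    unfolding x_def b_def d_def \<rho>_def \<theta>_def using u v j by (intro stage_transit) auto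
  let ?P = "\<lambda>r. c k j + transit (x + r) *\<^sub>R d - (R * exp (- \<tau> * (?u + r)) * cos (pi/2 * transit (x + r))) *\<^sub>R ?e
    - (R * exp (- \<tau> * (?u + r)) * sin (pi/2 * transit (x + r))) *\<^sub>R ?e'"
  let ?p = "0 + b' *\<^sub>R d - (\<rho> * (- \<tau> * cos \<theta> - pi/2 * b' * sin \<theta>)) *\<^sub>R ?e
      - (\<rho> * (- \<tau> * sin \<theta> + pi/2 * b' * cos \<theta>)) *\<^sub>R ?e'"
  have tr: "((\<lambda>r. transit (x + r)) has_real_derivative b') (at 0)"
    unfolding b'_def by (rule DERIV_at_0_shift[OF transit_deriv])
  have "((\<lambda>r. R * exp (- \<tau> * (?u + r)) * cos (pi/2 * transit (x + r))) has_real_derivative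
      \<rho> * (- \<tau> * cos \<theta> - pi/2 * b' * sin \<theta>)) (at 0)"
    by (rule derivative_eq_intros tr refl)+ (simp add: \<rho>_def \<theta>_def b_def algebra_simps)
  moreover have "((\<lambda>r. R * exp (- \<tau> * (?u + r)) * sin (pi/2 * transit (x + r))) has_real_derivative
      \<rho> * (- \<tau> * sin \<theta> + pi/2 * b' * cos \<theta>)) (at 0)"
    by (rule derivative_eq_intros tr refl)+ (simp add: \<rho>_def \<theta>_def b_def algebra_simps)
  ultimately have "(?P has_vector_derivative ?p) (at 0)"
    by (intro has_vector_derivative_add has_vector_derivative_diff has_vector_derivative_const
        has_vector_derivative_scaleR_const tr)
  then have "((\<lambda>t. w t $ 1) has_real_derivative (f - \<Phi> (w t)) \<bullet> ?p) (at t)"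
  proof (rule flow_partial[OF smooth_\<Phi> sol])
    show "open {2 * real k + 4/5 - ?u <..< 2 * real k + 11/5 - ?u}" by simp
    show "0 \<in> {2 * real k + 4/5 - ?u <..< 2 * real k + 11/5 - ?u}" using u by simp
    fix r assume r: "r \<in> {2 * real k + 4/5 - ?u <..< 2 * real k + 11/5 - ?u}"
    show "?P r = \<Phi> (w t + r *\<^sub>R axis 1 1)"
      using stage_transit[of k "w t + r *\<^sub>R axis 1 1" j j'] r v j
      by (simp add: axis_def x_def d_def algebra_simps)
  qed
  moreover have "\<tau> * (min_radius k)\<^sup>2 / 2 \<le> (f - \<Phi> (w t)) \<bullet> ?p"
  proof -
    define D where "D = f - c k j - b *\<^sub>R d"
    have b: "0 \<le> b" "b \<le> 1" using S_nonneg S_le_1 by (auto simp: b_def transit_def)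
    have "D = (1 - b) *\<^sub>R (f - c k j) + b *\<^sub>R (f - c (Suc k) j')"
      by (simp add: D_def d_def algebra_simps)
    also have "norm \<dots> \<le> (1 - b) * \<kappa> k + b * \<kappa> k"
      using b near by (intro order_trans[OF norm_triangle_ineq] add_mono) (auto intro!: mult_left_mono)
    finally have "norm D \<le> \<kappa> k" by (simp add: algebra_simps)
    moreover have "norm d \<le> 2 * \<kappa> k"
      using norm_triangle_ineq4[of "f - c k j" "f - c (Suc k) j'"] near by (simp add: d_def)
    moreover have "0 \<le> b'" "b' \<le> 2 * B" using S'_nonneg S'_le by (auto simp: b'_def)
    ultimately have "\<tau> * (min_radius k)\<^sup>2 / 2 \<le> (D + (\<rho> * cos \<theta>) *\<^sub>R ?e + (\<rho> * sin \<theta>) *\<^sub>R ?e') \<bullet>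
      (b' *\<^sub>R d - (\<rho> * (- \<tau> * cos \<theta> - pi/2 * b' * sin \<theta>)) *\<^sub>R ?e
        - (\<rho> * (- \<tau> * sin \<theta> + pi/2 * b' * cos \<theta>)) *\<^sub>R ?e')"
      unfolding \<rho>_def using u dir_neq[of "Suc k"] by (intro transit_drift) (auto simp: inner_axis_axis)
    moreover have "f - \<Phi> (w t) = D + (\<rho> * cos \<theta>) *\<^sub>R ?e + (\<rho> * sin \<theta>) *\<^sub>R ?e'"
      by (simp add: \<Phi>w D_def algebra_simps)
    ultimately show ?thesis by simp
  qed
  ultimately show "\<exists>y. ((\<lambda>t. w t $ 1) has_real_derivative y) (at t) \<and> \<tau> * (min_radius k)\<^sup>2 / 2 \<le> y" by blast
  have "((\<lambda>t. w t $ 2) has_real_derivative (f - \<Phi> (w t)) \<bullet> 0) (at t)"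
  proof (rule flow_partial[OF smooth_\<Phi> sol has_vector_derivative_const])
    let ?V = "{r. \<bar>offset k j (?v + r)\<bar> < 2/5} \<inter> {r. \<bar>offset (Suc k) j' (?v + r)\<bar> < 2/5}"
    show "open ?V" unfolding offset_def by (intro open_Int open_Collect_less continuous_intros)
    show "0 \<in> ?V" using v by simp
    fix r assume "r \<in> ?V"
    then show "\<Phi> (w t) = \<Phi> (w t + r *\<^sub>R axis 2 1)"
      unfolding \<Phi>w using stage_transit[of k "w t + r *\<^sub>R axis 2 1" j j'] u j
      by (simp add: axis_def x_def d_def b_def \<theta>_def \<rho>_def)
  qed
  then show "((\<lambda>t. w t $ 2) has_real_derivative 0) (at t)" by simp
qed

lemma transit_traverse:
  assumes sol: "GF_solution \<Phi> f w" "0 \<le> t0" and j: "j < 2 ^ k" "j' = 2 * j \<or> j' = 2 * j + 1"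
    and start: "w t0 $ 1 = 2 * real k + 1" "\<bar>offset (Suc k) j' (w t0 $ 2)\<bar> \<le> 1/8"
    and near: "norm (f - c k j) \<le> \<kappa> k" "norm (f - c (Suc k) j') \<le> \<kappa> k"
  shows "\<exists>t1>t0. w t1 $ 1 = 2 * real (Suc k) \<and> offset (Suc k) j' (w t1 $ 2) = offset (Suc k) j' (w t0 $ 2)"
proof -
  have j': "j' < 2 ^ Suc k" using j by auto
  have cw: "continuous_on {t0..} w"
    using continuous_on_subset[OF GF_solution_continuous[OF sol(1)]] sol(2) by auto
  obtain t1 where "t0 < t1" "w t1 $ 1 = 2 * real k + 1 + 1"
      "offset (Suc k) j' (w t1 $ 2) = offset (Suc k) j' (w t0 $ 2)"
  proof (rule transit_stage[of t0 "\<lambda>t. w t $ 1" "\<lambda>t. offset (Suc k) j' (w t $ 2)" "2 * real k + 1" "1/4"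
        "\<tau> * (min_radius k)\<^sup>2 / 2"])
    show "continuous_on {t0..} (\<lambda>t. w t $ 1)" using cw by (intro continuous_intros)
    show "continuous_on {t0..} (\<lambda>t. offset (Suc k) j' (w t $ 2))"
      unfolding offset_def using cw by (intro continuous_intros)
    show "0 < \<tau> * (min_radius k)\<^sup>2 / 2" using \<tau>_pos R_pos by simp
  next
    fix t assume t: "t0 < t" "2 * real k + 1 - 1/8 < w t $ 1" "w t $ 1 < 2 * real k + 1 + 1"
      "\<bar>offset (Suc k) j' (w t $ 2)\<bar> < 1/4"
    have "offset (Suc k) j' (w t $ 2) = 2 * offset k j (w t $ 2) + 1/2 \<or>
        offset (Suc k) j' (w t $ 2) = 2 * offset k j (w t $ 2) - 1/2"
      using j(2) offset_child by auto
    \<comment> \<open>Since \<open>(1/4 + 1/2) / 2 = 3/8 < 2/5\<close>, staying near the child's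
      centre keeps \<open>v\<close> on the parent's plateau.\<close>
    then have off: "\<bar>offset k j (w t $ 2)\<bar> < 2/5" using t(4) by linarith
    have "0 < t" "\<bar>offset (Suc k) j' (w t $ 2)\<bar> < 2/5" using t sol by auto
    note fl = transit_flow[OF sol(1) this(1) j(1) j' _ _ off this(2) near]
    have "((\<lambda>t. offset (Suc k) j' (w t $ 2)) has_real_derivative 2 ^ Suc k * 0) (at t)"
      using t by (intro DERIV_chain2[OF offset_deriv] fl(2)) auto
    then show "(\<exists>y. ((\<lambda>t. w t $ 1) has_real_derivative y) (at t) \<and> \<tau> * (min_radius k)\<^sup>2 / 2 \<le> y) \<and>
        ((\<lambda>t. offset (Suc k) j' (w t $ 2)) has_real_derivative 0) (at t)"
      using fl(1) t by simp
  qed (use start in auto)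
  then show ?thesis by auto
qed

lemma stage_traverse:
  assumes sol: "GF_solution \<Phi> f w" "0 \<le> t0" and j: "j < 2 ^ k"
    and start: "w t0 $ 1 = 2 * real k" "\<bar>offset k j (w t0 $ 2)\<bar> \<le> 1/8"
    and near: "norm (f - c k j) \<le> \<kappa> k" "norm (f - c (Suc k) j') \<le> \<kappa> k"
    and side: "j' = 2 * j + 1 \<and> \<omega> k \<le> (f - c k j) $ dir k \<or> j' = 2 * j \<and> (f - c k j) $ dir k \<le> - \<omega> k"
  shows "\<exists>t1>t0. w t1 $ 1 = 2 * real (Suc k) \<and> \<bar>offset (Suc k) j' (w t1 $ 2)\<bar> \<le> 1/8"
proof -
  have "\<exists>t>t0. w t $ 1 = 2 * real k + 1 \<and> \<bar>offset (Suc k) j' (w t $ 2)\<bar> \<le> 1/8"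
    using side
  proof
    assume s: "j' = 2 * j + 1 \<and> \<omega> k \<le> (f - c k j) $ dir k"
    then obtain t where t: "t > t0" "w t $ 1 = 2 * real k + 1" "3/16 \<le> 1 * offset k j (w t $ 2)" "1 * offset k j (w t $ 2) \<le> 1/4"
      using split_traverse[OF sol j start near(1), of 1] by auto
    have "offset (Suc k) j' (w t $ 2) = 2 * offset k j (w t $ 2) - 1/2" using s offset_child by simp
    then have "\<bar>offset (Suc k) j' (w t $ 2)\<bar> \<le> 1/8" using t(3,4) by linarith
    then show ?thesis using t(1,2) by blast
  next
    assume s: "j' = 2 * j \<and> (f - c k j) $ dir k \<le> - \<omega> k"
    then obtain t where t: "t > t0" "w t $ 1 = 2 * real k + 1" "3/16 \<le> - 1 * offset k j (w t $ 2)" "- 1 * offset k j (w t $ 2) \<le> 1/4"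
      using split_traverse[OF sol j start near(1), of "-1"] by auto
    have "offset (Suc k) j' (w t $ 2) = 2 * offset k j (w t $ 2) + 1/2" using s offset_child by simp
    then have "\<bar>offset (Suc k) j' (w t $ 2)\<bar> \<le> 1/8" using t(3,4) by linarith
    then show ?thesis using t(1,2) by blast
  qed
  then obtain t where t: "t > t0" "w t $ 1 = 2 * real k + 1" "\<bar>offset (Suc k) j' (w t $ 2)\<bar> \<le> 1/8" by blast
  have "0 \<le> t" using t sol by simp
  obtain t1 where "t < t1" "w t1 $ 1 = 2 * real (Suc k)"
      "offset (Suc k) j' (w t1 $ 2) = offset (Suc k) j' (w t $ 2)"
    using transit_traverse[OF sol(1) \<open>0 \<le> t\<close> j _ t(2,3) near] side by blast
  then show ?thesis using t by (intro exI[of _ t1]) auto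
qed

text \<open>At the times with \<open>u = 2 * k\<close> the gate, the bump and the transit vanish, so
  the residual is at most \<open>\<kappa> k\<close> plus the radius, hence at most twice the radius,
  which decays geometrically. Such times exist for all \<open>k\<close>, since each stage hands
  \<open>v\<close> over within offset \<open>1/8\<close> of the centre of the next node.\<close>

theorem tracked_target_learnable:
  assumes J0: "J 0 = 0"
    and near: "\<And>k. norm (f - c k (J k)) \<le> \<kappa> k" "\<And>k. norm (f - c (Suc k) (J (Suc k))) \<le> \<kappa> k"
    and side: "\<And>k. J (Suc k) = 2 * J k + 1 \<and> \<omega> k \<le> (f - c k (J k)) $ dir k \<or>
      J (Suc k) = 2 * J k \<and> (f - c k (J k)) $ dir k \<le> - \<omega> k"
  shows "f \<in> GF_learnable \<Phi>"
proof -
  obtain w where sol: "GF_solution \<Phi> f w"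
    using GF_solution_exists[OF smooth_\<Phi>] by blast
  have J: "J k < 2 ^ k" for k
  proof (induction k)
    case (Suc k)
    then show ?case using side[of k] by auto
  qed (simp add: J0)
  have track: "\<exists>t\<ge>0. w t $ 1 = 2 * real k \<and> \<bar>offset k (J k) (w t $ 2)\<bar> \<le> 1/8" for k
  proof (induction k)
    case 0
    have "w 0 = 0" using sol by (simp add: GF_solution_def)
    then show ?case by (intro exI[of _ 0]) (simp add: J0 offset_def)
  next
    case (Suc k)
    then obtain t where "0 \<le> t" "w t $ 1 = 2 * real k" "\<bar>offset k (J k) (w t $ 2)\<bar> \<le> 1/8" by blast
    from stage_traverse[OF sol this(1) J this(2,3) near side] show ?case
      using \<open>0 \<le> t\<close> by (meson less_imp_le order_trans)
  qed
  have "\<exists>t\<ge>0. loss \<Phi> f (w t) < 1 / real (Suc n)" for n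
  proof -
    have "(\<lambda>k. 2 * R\<^sup>2 * exp (- 4 * \<tau>) ^ k) \<longlonglongrightarrow> 2 * R\<^sup>2 * 0"
      using \<tau>_pos by (intro tendsto_mult tendsto_const LIMSEQ_power_zero) simp
    then have "\<forall>\<^sub>F k in sequentially. 2 * R\<^sup>2 * exp (- 4 * \<tau>) ^ k < 1 / real (Suc n)"
      by (intro order_tendstoD(2)) auto
    then obtain k where k: "2 * R\<^sup>2 * exp (- 4 * \<tau>) ^ k < 1 / real (Suc n)"
      by (auto simp: eventually_sequentially)
    obtain t where t: "0 \<le> t" "w t $ 1 = 2 * real k" "\<bar>offset k (J k) (w t $ 2)\<bar> \<le> 1/8"
      using track by blast
    define r where "r = R * exp (- \<tau> * (2 * real k))"
    have r: "radius k (w t $ 1) = r" by (simp add: radius_def t(2) bump_0 r_def)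
    have \<Phi>w: "\<Phi> (w t) = c k (J k) - r *\<^sub>R axis (dir (Suc k)) 1"
      using stage_split[of k "w t" "J k"] J t r by (simp add: gate_0)
    have "norm (f - \<Phi> (w t)) = norm ((f - c k (J k)) + r *\<^sub>R axis (dir (Suc k)) 1)"
      unfolding \<Phi>w by (simp add: algebra_simps)
    also have "\<dots> \<le> \<kappa> k + r"
      using near(1)[of k] R_pos by (intro order_trans[OF norm_triangle_ineq] add_mono) (auto simp: r_def)
    also have "\<dots> \<le> 2 * r"
    proof -
      have "R * exp (- \<tau> * (2 * real k + 3)) \<le> r"
        unfolding r_def using \<tau>_pos R_pos by simp
      moreover have "0 < R * exp (- \<tau> * (2 * real k + 3))" using R_pos by simp
      ultimately show ?thesis using \<kappa>_le_half[of k] by linarith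
    qed
    finally have "(norm (f - \<Phi> (w t)))\<^sup>2 \<le> (2 * r)\<^sup>2" by (intro power_mono) auto
    moreover have "r\<^sup>2 = R\<^sup>2 * exp (- 4 * \<tau>) ^ k"
      by (simp add: r_def power_mult_distrib flip: exp_of_nat_mult)
    ultimately have "loss \<Phi> f (w t) \<le> 2 * R\<^sup>2 * exp (- 4 * \<tau>) ^ k"
      by (simp add: loss_def power_mult_distrib)
    then show ?thesis using k t by (intro exI[of _ t]) auto
  qed
  then have "(INF t\<in>{0..}. loss \<Phi> f (w t)) = 0"
    by (subst INF_eq_0_iff) (auto simp: loss_def)
  then show ?thesis using sol by (auto simp: GF_learnable_def)
qed

end

section \<open>The tree of boxes\<close>

text \<open>Pigeonhole: \<open>n\<close> disjoint slabs of full width \<open>W / (3 * n)\<close> fit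
  into the middle third of the interval, and their masses add up to at most
  \<open>1\<close>.\<close>

lemma light_slab_exists:
  fixes \<mu> :: "(real^'d) measure"
  assumes "prob_space \<mu>" and \<mu>: "sets \<mu> = sets borel" and W: "0 < W" "W \<le> b - a" and n: "0 < (n::nat)"
  shows "\<exists>m. a + (b - a)/3 \<le> m \<and> m \<le> b - (b - a)/3 \<and>
    measure \<mu> {f. \<bar>f $ i - m\<bar> < W / (6 * real n)} \<le> 1 / real n"
proof (rule ccontr)
  interpret prob_space \<mu> by fact
  define w where "w = W / (6 * real n)"
  have w: "0 < w" "2 * real n * w = W / 3" using W n by (auto simp: w_def)
  define m where "m l = a + (b - a)/3 + (2 * real l + 1) * w" for l :: nat
  let ?A = "\<lambda>l. {f :: real^'d. \<bar>f $ i - m l\<bar> < w}"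
  assume no: "\<not> ?thesis"
  have big: "1 / real n < measure \<mu> (?A l)" if "l < n" for l
  proof -
    have "(2 * real l + 1) * w \<le> (2 * real n) * w" using that w by (intro mult_right_mono) auto
    then have "a + (b - a)/3 \<le> m l \<and> m l \<le> b - (b - a)/3" using w W by (auto simp: m_def field_simps)
    then show ?thesis using no by (auto simp: w_def not_le not_less dest!: spec[of _ "m l"])
  qed
  have meas: "?A l \<in> sets \<mu>" for l
  proof -
    have "open (?A l)" by (intro open_Collect_less continuous_intros)
    then show ?thesis unfolding \<mu> by (rule borel_open)
  qed
  have "disjoint_family_on ?A {..<n}"
    unfolding disjoint_family_on_def
  proof (intro ballI impI)
    fix l l' :: nat assume "l \<noteq> l'"
    then have "1 \<le> \<bar>real l - real l'\<bar>" by linarith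
    then have "2 * w \<le> 2 * w * \<bar>real l - real l'\<bar>" using w by simp
    also have "\<dots> = \<bar>m l - m l'\<bar>"
    proof -
      have "m l - m l' = 2 * w * (real l - real l')" by (simp add: m_def algebra_simps)
      then show ?thesis using w by (simp add: abs_mult)
    qed
    finally show "?A l \<inter> ?A l' = {}" by fastforce
  qed
  then have "measure \<mu> (\<Union>l<n. ?A l) = (\<Sum>l<n. measure \<mu> (?A l))"
    using meas by (intro finite_measure_finite_Union) auto
  moreover have "(\<Sum>l<n. 1 / real n) < (\<Sum>l<n. measure \<mu> (?A l))"
    using n big by (intro sum_strict_mono) auto
  moreover have "measure \<mu> (\<Union>l<n. ?A l) \<le> 1" by (rule prob_le_1)
  ultimately show False using n by simp
qed

definition set_nth :: "real^'d \<Rightarrow> 'd \<Rightarrow> real \<Rightarrow> real^'d" where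
  "set_nth x i m = (\<chi> l. if l = i then m else x $ l)"

lemma set_nth_nth [simp]: "set_nth x i m $ l = (if l = i then m else x $ l)"
  by (simp add: set_nth_def)

text \<open>The node index is the binary history of the cuts, in the same addressing as on the
  \<open>v\<close>-axis: the parent is \<open>j div 2\<close>, and an odd index is the upper side.
  The position of the cut is a function of the corners, since a light slab has to be found inside
  each box.\<close>

fun box_corners :: "(nat \<Rightarrow> real^'d \<Rightarrow> real^'d \<Rightarrow> real) \<Rightarrow> (nat \<Rightarrow> 'd) \<Rightarrow> real \<Rightarrow> nat \<Rightarrow> nat \<Rightarrow> (real^'d) \<times> (real^'d)"
  where
    "box_corners pick dir M 0 j = ((\<chi> i. - M), (\<chi> i. M))"
  | "box_corners pick dir M (Suc k) j = (let (lo, hi) = box_corners pick dir M k (j div 2) in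
      if even j then (lo, set_nth hi (dir k) (pick k lo hi)) else (set_nth lo (dir k) (pick k lo hi), hi))"

lemma small_step_exists:
  fixes b k X w :: real
  assumes "0 \<le> b" "0 \<le> k" "0 < X" "0 < w"
  shows "\<exists>h>0. 2 * h \<le> w \<and> 5 * b * h * (k + h) \<le> X"
proof (intro exI conjI)
  \<comment> \<open>The cap \<open>1\<close> reduces the quadratic condition to one that is linear
    in \<open>h\<close>.\<close>
  define h where "h = min (w/2) (min 1 (X / (5 * (b + 1) * (k + 1))))"
  have "0 < X / (5 * (b + 1) * (k + 1))" using assms by (intro divide_pos_pos mult_pos_pos) auto
  then show h0: "0 < h" using assms by (auto simp: h_def)
  show "2 * h \<le> w" by (auto simp: h_def)
  have "h \<le> X / (5 * (b + 1) * (k + 1))" "h \<le> 1" by (auto simp: h_def)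
  then have "5 * (b + 1) * (k + 1) * h \<le> X"
    using assms by (simp add: pos_le_divide_eq mult.commute mult_pos_pos)
  moreover have "5 * b * h * (k + h) \<le> 5 * (b + 1) * h * (k + 1)"
    using assms h0 \<open>h \<le> 1\<close> by (intro mult_mono) auto
  ultimately show "5 * b * h * (k + h) \<le> X" by (simp add: mult_ac)
qed

lemma small_factor_exists:
  fixes P Y :: real
  assumes "0 < P" "0 < Y"
  shows "\<exists>s>0. s \<le> 1 \<and> P * s < Y"
proof (intro exI conjI)
  show "0 < min 1 (Y / (2 * P))" "min 1 (Y / (2 * P)) \<le> 1" using assms by auto
  have "P * min 1 (Y / (2 * P)) \<le> P * (Y / (2 * P))" using assms by (intro mult_left_mono) auto
  also have "\<dots> < Y" using assms by simp
  finally show "P * min 1 (Y / (2 * P)) < Y" .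
qed

lemma large_ball_exists:
  fixes \<mu> :: "(real^'d) measure"
  assumes "prob_space \<mu>" and \<mu>: "sets \<mu> = sets borel" and "0 < e"
  shows "\<exists>M>0. measure \<mu> (UNIV - cball 0 M) < e"
proof -
  interpret prob_space \<mu> by fact
  have sp: "space \<mu> = UNIV" using sets_eq_imp_space_eq[OF \<mu>] by simp
  have "(\<lambda>n. measure \<mu> (cball 0 (real n))) \<longlonglongrightarrow> measure \<mu> (\<Union>n. cball 0 (real n))"
    by (rule finite_Lim_measure_incseq) (auto simp: \<mu> incseq_def)
  moreover have "(\<Union>n. cball (0::real^'d) (real n)) = space \<mu>"
    unfolding sp by (auto intro: real_arch_simple)
  ultimately have "(\<lambda>n. measure \<mu> (cball 0 (real n))) \<longlonglongrightarrow> 1" by (simp add: prob_space)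
  then have "\<forall>\<^sub>F n in sequentially. 1 - e < measure \<mu> (cball 0 (real n))"
    using \<open>0 < e\<close> by (intro order_tendstoD(1)) auto
  then obtain N where "\<forall>n\<ge>N. 1 - e < measure \<mu> (cball 0 (real n))"
    by (auto simp: eventually_sequentially)
  then have "1 - e < measure \<mu> (cball 0 (real (Suc N)))" by (auto dest!: spec[of _ "Suc N"])
  moreover have "measure \<mu> (UNIV - cball 0 (real (Suc N))) = 1 - measure \<mu> (cball 0 (real (Suc N)))"
    using prob_compl[of "cball 0 (real (Suc N))"] by (simp add: \<mu> sp)
  ultimately show ?thesis by (intro exI[of _ "real (Suc N)"]) auto
qed

lemma almost_all_learnable:
  fixes \<mu> :: "(real^'d) measure"
  assumes prob: "prob_space \<mu>" and \<mu>: "sets \<mu> = sets borel" and \<epsilon>: "0 < \<epsilon>" and dim: "2 \<le> CARD('d)"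
  shows "\<exists>\<Phi> :: real^2 \<Rightarrow> real^'d. smooth \<Phi> \<and> measure \<mu> (UNIV - GF_learnable \<Phi>) < \<epsilon>"
proof -
  interpret prob_space \<mu> by fact
  define d where "d = CARD('d)"
  have d: "2 \<le> d" using dim by (simp add: d_def)
  obtain M where M: "0 < M" "measure \<mu> (UNIV - cball 0 M) < \<epsilon> / 2"
    using large_ball_exists[OF prob \<mu>, of "\<epsilon> / 2"] \<epsilon> by auto
  obtain e :: "nat \<Rightarrow> 'd" where e: "bij_betw e {0..<d} UNIV"
    using ex_bij_betw_nat_finite[of "UNIV :: 'd set"] by (auto simp: d_def)
  define dir where "dir k = e (k mod d)" for k
  have dir_neq: "dir (Suc k) \<noteq> dir k" for k
  proof
    assume "dir (Suc k) = dir k"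
    then have "Suc k mod d = k mod d"
      unfolding dir_def using d by (intro inj_onD[OF bij_betw_imp_inj_on[OF e]]) auto
    then show False using d by (auto simp: mod_Suc split: if_splits)
  qed
  have dir_period: "dir (k + d) = dir k" for k by (simp add: dir_def)
  have dir_surj: "\<exists>s<d. i = dir (k + s)" for i k
  proof -
    have "i \<in> e ` {0..<d}" using e by (simp add: bij_betw_def)
    then obtain l where l: "l < d" "i = e l" by auto
    define s where "s = (l + (d - k mod d)) mod d"
    have "(k + s) mod d = (k mod d + (l + (d - k mod d))) mod d" unfolding s_def by (simp add: mod_simps)
    also have "k mod d + (l + (d - k mod d)) = l + d" using mod_less_divisor[of d k] d by linarith
    finally have "dir (k + s) = i" using l by (simp add: dir_def)
    moreover have "s < d" using d by (simp add: s_def)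
    ultimately show ?thesis by blast
  qed
  \<comment> \<open>A slab of mass at most \<open>1 / N k\<close> has mass at most
    \<open>\<epsilon> / 4 ^ (k + 2)\<close>, so the \<open>2 ^ k\<close> slabs of level
    \<open>k\<close> weigh at most \<open>\<epsilon> / 16 * (1/2) ^ k\<close>, and all slabs
    together at most \<open>\<epsilon> / 8\<close>.\<close>
  define N where "N k = nat \<lceil>4 ^ (k + 2) / \<epsilon>\<rceil>" for k :: nat
  have N: "0 < N k" "1 / real (N k) \<le> \<epsilon> / 4 ^ (k + 2)" for k
  proof -
    have p: "0 < 4 ^ (k + 2) / \<epsilon>" using \<epsilon> by simp
    then show N0: "0 < N k" unfolding N_def by simp
    have "4 ^ (k + 2) / \<epsilon> \<le> real (N k)" unfolding N_def by linarith
    then have "1 / real (N k) \<le> 1 / (4 ^ (k + 2) / \<epsilon>)" using p N0 \<epsilon> by (intro divide_left_mono mult_pos_pos) auto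
    then show "1 / real (N k) \<le> \<epsilon> / 4 ^ (k + 2)" by simp
  qed
  \<comment> \<open>Cuts keep at least a third of a side, so \<open>2 * M / 3 ^ k\<close> bounds all
    sides of level \<open>k\<close> from below. Using it instead of the actual side gives one
    \<open>\<omega> k\<close> for the whole level; the divisor \<open>6 * N k\<close> is that of
    \<open>light_slab_exists\<close>.\<close>
  define \<omega> where "\<omega> k = (2 * M / 3 ^ k) / (6 * real (N k))" for k
  have \<omega>: "0 < \<omega> k" for k using M N(1) by (simp add: \<omega>_def)
  define good where "good k lo hi m \<longleftrightarrow> lo $ dir k + (hi $ dir k - lo $ dir k)/3 \<le> m \<and>
      m \<le> hi $ dir k - (hi $ dir k - lo $ dir k)/3 \<and> measure \<mu> {f. \<bar>f $ dir k - m\<bar> < \<omega> k} \<le> 1 / real (N k)"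
    for k and lo hi :: "real^'d" and m
  define pick where "pick k lo hi = (SOME m. good k lo hi m)" for k lo hi
  have pick: "good k lo hi (pick k lo hi)" if "2 * M / 3 ^ k \<le> hi $ dir k - lo $ dir k" for k lo hi
  proof -
    have "\<exists>m. good k lo hi m"
      unfolding good_def \<omega>_def using M(1) by (intro light_slab_exists[OF prob \<mu> _ that N(1)]) simp
    then have "good k lo hi (SOME m. good k lo hi m)" by (rule someI_ex)
    then show ?thesis by (simp only: pick_def)
  qed
  define lo where "lo k j = fst (box_corners pick dir M k j)" for k j
  define hi where "hi k j = snd (box_corners pick dir M k j)" for k j
  define m where "m k j = pick k (lo k j) (hi k j)" for k j
  have box_0: "lo 0 j = (\<chi> i. - M)" "hi 0 j = (\<chi> i. M)" for j by (simp_all add: lo_def hi_def)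
  have box_Suc: "lo (Suc k) j = (if even j then lo k (j div 2) else set_nth (lo k (j div 2)) (dir k) (m k (j div 2)))"
    "hi (Suc k) j = (if even j then set_nth (hi k (j div 2)) (dir k) (m k (j div 2)) else hi k (j div 2))" for k j
    by (auto simp: lo_def hi_def m_def Let_def split: prod.splits)
  define width where "width k j i = hi k j $ i - lo k j $ i" for k j i
  have width_lower: "2 * M / 3 ^ k \<le> width k j i" for k j i
  proof (induction k arbitrary: j i)
    case 0
    then show ?case by (simp add: width_def box_0)
  next
    case (Suc k)
    let ?j = "j div 2"
    have w: "2 * M / 3 ^ k \<le> width k ?j i" by (rule Suc)
    have "good k (lo k ?j) (hi k ?j) (m k ?j)"
      unfolding m_def using Suc[of ?j "dir k"] by (intro pick) (simp add: width_def)
    then have "width k ?j (dir k) / 3 \<le> m k ?j - lo k ?j $ dir k" "width k ?j (dir k) / 3 \<le> hi k ?j $ dir k - m k ?j"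
      unfolding good_def width_def by (elim conjE, linarith)+
    moreover have "2 * M / 3 ^ Suc k = (2 * M / 3 ^ k) / 3" by simp
    moreover have "0 \<le> 2 * M / 3 ^ k" using M(1) by simp
    ultimately show ?case
      using w Suc[of ?j "dir k"] unfolding width_def box_Suc by (cases "i = dir k"; cases "even j"; simp; linarith)
  qed
  have gd: "good k (lo k j) (hi k j) (m k j)" for k j
    unfolding m_def using width_lower[of k j "dir k"] by (intro pick) (simp add: width_def)
  have m_mid: "width k j (dir k) / 3 \<le> m k j - lo k j $ dir k" "width k j (dir k) / 3 \<le> hi k j $ dir k - m k j" for k j
    using gd[of k j] unfolding good_def width_def by (elim conjE, linarith)+
  have width_pos: "0 < width k j i" for k j i
  proof -
    have "0 < 2 * M / 3 ^ k" using M(1) by simp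
    then show ?thesis using width_lower[of k j i] by linarith
  qed
  have width_Suc: "width (Suc k) j i \<le> width k (j div 2) i"
    "width (Suc k) j (dir k) \<le> 2/3 * width k (j div 2) (dir k)" for k j i
    using m_mid[of k "j div 2"] width_pos[of k "j div 2" "dir k"]
    unfolding width_def box_Suc by (cases "i = dir k"; cases "even j"; simp; linarith)+
  text \<open>Each coordinate is cut once in \<open>d\<close> stages, so the boxes shrink by the factor \<open>\<beta>\<close> per stage on
    average; \<open>\<tau>\<close> is chosen below so that the radius decays at the same rate.\<close>
  define \<beta> :: real where "\<beta> = (2/3) powr (1 / real d)"
  have \<beta>d: "\<beta> ^ d = 2/3" using d by (simp add: \<beta>_def powr_power)
  have "\<beta> < (2/3) powr 0"
    unfolding \<beta>_def using d by (intro powr_less_mono') auto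
  then have \<beta>: "0 < \<beta>" "\<beta> < 1" by (simp_all add: \<beta>_def)
  \<comment> \<open>The exponent tells when a coordinate is next cut. An uncut coordinate keeps its
    bound from stage to stage, and the one just cut goes from \<open>s = 0\<close> to
    \<open>s = d - 1\<close>, paid for by the factor \<open>2/3 = \<beta> ^ d\<close>. The constant
    \<open>3 * M\<close> instead of \<open>2 * M\<close> covers the start, where
    \<open>\<beta> ^ s \<ge> 2/3\<close>.\<close>
  have width_le: "width k j (dir (k + s)) \<le> 3 * M * \<beta> ^ (k + s)" if "s < d" for k j s
    using that
  proof (induction k arbitrary: j s)
    case 0
    have "\<beta> ^ d \<le> \<beta> ^ s" using 0 \<beta> by (intro power_decreasing) auto
    then show ?case using M(1) by (simp add: width_def box_0 \<beta>d)
  next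
    case (Suc k)
    show ?case
    proof (cases "Suc s < d")
      case True
      have "width (Suc k) j (dir (k + Suc s)) \<le> width k (j div 2) (dir (k + Suc s))" by (rule width_Suc)
      also have "\<dots> \<le> 3 * M * \<beta> ^ (k + Suc s)" using True by (rule Suc.IH)
      finally show ?thesis by simp
    next
      case False
      then have s: "Suc k + s = k + d" using Suc.prems by simp
      have "width (Suc k) j (dir k) \<le> 2/3 * width k (j div 2) (dir (k + 0))" using width_Suc(2) by simp
      also have "\<dots> \<le> 2/3 * (3 * M * \<beta> ^ (k + 0))" using d by (intro mult_left_mono Suc.IH) auto
      also have "\<dots> = 3 * M * \<beta> ^ (k + d)" by (simp add: power_add \<beta>d)
      finally show ?thesis by (simp only: s dir_period)
    qed
  qed
  have width_le_all: "width k j i \<le> 3 * M * \<beta> ^ k" for k j i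
  proof -
    obtain s where s: "s < d" "i = dir (k + s)" using dir_surj by blast
    have "width k j i \<le> 3 * M * \<beta> ^ (k + s)" using width_le[OF s(1)] s(2) by simp
    also have "\<dots> \<le> 3 * M * \<beta> ^ k" using \<beta> M(1) by (intro mult_left_mono power_decreasing) auto
    finally show ?thesis .
  qed
  \<comment> \<open>The lower corner of the box, moved onto the cut, so that the sign of the
    component of \<open>f - c k j\<close> along \<open>dir k\<close> tells the side.\<close>
  define c where "c k j = set_nth (lo k j) (dir k) (m k j)" for k j
  define \<kappa> where "\<kappa> k = real d * (3 * M * \<beta> ^ k)" for k
  have near: "norm (f - c k j) \<le> \<kappa> k" if f: "\<And>i. lo k j $ i \<le> f $ i \<and> f $ i \<le> hi k j $ i" for f k j
  proof -
    have comp: "\<bar>(f - c k j) $ i\<bar> \<le> 3 * M * \<beta> ^ k" for i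
      using f[of i] m_mid[of k j] width_pos[of k j "dir k"] width_le_all[of k j i]
      by (cases "i = dir k") (auto simp: c_def width_def abs_le_iff)
    have "norm (f - c k j) \<le> (\<Sum>i\<in>(UNIV :: 'd set). 3 * M * \<beta> ^ k)"
      using norm_le_l1_cart sum_mono[OF comp] by (rule order_trans)
    then show ?thesis by (simp add: \<kappa>_def d_def)
  qed
  obtain S S' :: "real \<Rightarrow> real" and B where step: "smooth_step S S' B"
    using smooth_step_exists by blast
  then interpret smooth_step S S' B .
  \<comment> \<open>As \<open>u\<close> advances by \<open>2\<close> in a stage, this makes the
    radius decay by \<open>exp (- 2 * \<tau>) = \<beta>\<close> per stage.\<close>
  define \<tau> where "\<tau> = - ln \<beta> / 2"
  have \<tau>: "0 < \<tau>" using \<beta> by (simp add: \<tau>_def ln_less_zero)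
  have exp_\<tau>: "exp (- \<tau> * (2 * real k + 3)) = \<beta> ^ k * exp (- 3 * \<tau>)" for k
  proof -
    have "- \<tau> * (2 * real k + 3) = real k * ln \<beta> + - 3 * \<tau>" by (simp add: \<tau>_def algebra_simps)
    then show ?thesis using \<beta> by (simp only: exp_add exp_of_nat_mult exp_ln)
  qed
  \<comment> \<open>Solves \<open>\<kappa>_le\<close> with equality; the factor
    \<open>\<beta> ^ k\<close> cancels, so \<open>R\<close> does not depend on the stage.\<close>
  define R where "R = 2 * (real d * (3 * M) * (20 * B + 2 * \<tau>)) * exp (3 * \<tau>) / \<tau>"
  have R: "0 < R"
    unfolding R_def using d M(1) B_nonneg \<tau> by (intro divide_pos_pos mult_pos_pos add_nonneg_pos) auto
  have \<kappa>_nonneg: "0 \<le> \<kappa> k" for k using M(1) \<beta> by (simp add: \<kappa>_def)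
  have \<kappa>_R: "\<kappa> k * (20 * B + 2 * \<tau>) \<le> \<tau> * (R * exp (- \<tau> * (2 * real k + 3))) / 2" for k
  proof -
    have "exp (3 * \<tau>) * exp (- 3 * \<tau>) = 1" by (simp flip: exp_add)
    then have "\<tau> * (R * (\<beta> ^ k * exp (- 3 * \<tau>))) / 2 = \<kappa> k * (20 * B + 2 * \<tau>)"
      unfolding R_def \<kappa>_def using \<tau> by (simp add: field_simps)
    then show ?thesis unfolding exp_\<tau> by (rule eq_refl[OF sym])
  qed
  have "\<exists>h>0. 2 * h \<le> \<omega> k \<and> 5 * B * h * (\<kappa> k + h) \<le> \<tau> * (R * exp (- \<tau> * (2 * real k + 3)))\<^sup>2 / 4" for k
    using B_nonneg \<kappa>_nonneg \<tau> R \<omega> by (intro small_step_exists) auto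
  then obtain h where h: "\<And>k. 0 < h k" "\<And>k. 2 * h k \<le> \<omega> k"
    "\<And>k. 5 * B * h k * (\<kappa> k + h k) \<le> \<tau> * (R * exp (- \<tau> * (2 * real k + 3)))\<^sup>2 / 4" by metis
  have "\<exists>s>0. s \<le> 1 \<and> 20 * \<tau> * (R * exp \<tau>)\<^sup>2 * s < pi * 4 ^ k * h k * \<omega> k * cos (3 * pi / 8)" for k
    using \<tau> R h(1) \<omega> cos_3pi8_pos by (intro small_factor_exists) auto
  then obtain \<sigma> where \<sigma>: "\<And>k. 0 < \<sigma> k" "\<And>k. \<sigma> k \<le> 1"
    "\<And>k. 20 * \<tau> * (R * exp \<tau>)\<^sup>2 * \<sigma> k < pi * 4 ^ k * h k * \<omega> k * cos (3 * pi / 8)" by metis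
  interpret router S S' B c dir h \<sigma> \<kappa> \<omega> R \<tau>
    by unfold_locales (fact R \<tau> dir_neq h \<sigma> \<kappa>_nonneg \<kappa>_R)+
  define slab where "slab k j = {f :: real^'d. \<bar>f $ dir k - m k j\<bar> < \<omega> k}" for k j
  have learn: "f \<in> GF_learnable \<Phi>" if f: "f \<in> cball 0 M" "\<And>k j. j < 2 ^ k \<Longrightarrow> f \<notin> slab k j" for f
  proof -
    define J where "J = rec_nat 0 (\<lambda>k j. if m k j < f $ dir k then 2 * j + 1 else 2 * j)"
    have J: "J 0 = 0" "J (Suc k) = (if m k (J k) < f $ dir k then 2 * J k + 1 else 2 * J k)" for k
      by (simp_all add: J_def)
    have J_less: "J k < 2 ^ k" for k by (induction k) (auto simp: J)
    have in_box: "lo k (J k) $ i \<le> f $ i \<and> f $ i \<le> hi k (J k) $ i" for k i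
    proof (induction k)
      case 0
      have "\<bar>f $ i\<bar> \<le> M" using f(1) component_le_norm_cart[of f i] by simp
      then show ?case by (simp add: box_0 abs_le_iff)
    next
      case (Suc k)
      then show ?case by (simp add: J box_Suc)
    qed
    show ?thesis
    proof (rule tracked_target_learnable)
      show "J 0 = 0" by (rule J)
      show "norm (f - c k (J k)) \<le> \<kappa> k" for k using in_box by (rule near)
      show "norm (f - c (Suc k) (J (Suc k))) \<le> \<kappa> k" for k
      proof -
        have "norm (f - c (Suc k) (J (Suc k))) \<le> \<kappa> (Suc k)" using in_box by (rule near)
        also have "\<dots> \<le> \<kappa> k" unfolding \<kappa>_def using \<beta> M(1) by (intro mult_left_mono power_decreasing) auto
        finally show ?thesis .
      qed
      show "J (Suc k) = 2 * J k + 1 \<and> \<omega> k \<le> (f - c k (J k)) $ dir k \<or>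
          J (Suc k) = 2 * J k \<and> (f - c k (J k)) $ dir k \<le> - \<omega> k" for k
        using f(2)[OF J_less[of k]] by (auto simp: J slab_def c_def)
    qed
  qed
  have slab: "slab k j \<in> sets \<mu>" "measure \<mu> (slab k j) \<le> \<epsilon> / 4 ^ (k + 2)" for k j
  proof -
    have "open (slab k j)" unfolding slab_def by (intro open_Collect_less continuous_intros)
    then show "slab k j \<in> sets \<mu>" unfolding \<mu> by (rule borel_open)
    show "measure \<mu> (slab k j) \<le> \<epsilon> / 4 ^ (k + 2)"
      using gd[of k j] N(2)[of k] by (simp add: good_def slab_def)
  qed
  define A where "A k = (\<Union>j<2^k. slab k j)" for k :: nat
  have A: "A k \<in> sets \<mu>" "measure \<mu> (A k) \<le> \<epsilon> / 16 * (1/2) ^ k" for k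
  proof -
    show "A k \<in> sets \<mu>" unfolding A_def using slab(1) by auto
    have "measure \<mu> (A k) \<le> (\<Sum>j<2^k. measure \<mu> (slab k j))"
      unfolding A_def using slab(1) by (intro finite_measure_subadditive_finite) auto
    also have "\<dots> \<le> (\<Sum>j<(2::nat)^k. \<epsilon> / 4 ^ (k + 2))" by (intro sum_mono slab)
    also have "\<dots> = \<epsilon> / 16 * (2 ^ k / 4 ^ k)" by simp
    also have "(2::real) ^ k / 4 ^ k = (1/2) ^ k" by (simp flip: power_divide)
    finally show "measure \<mu> (A k) \<le> \<epsilon> / 16 * (1/2) ^ k" .
  qed
  have geom: "(\<lambda>k. \<epsilon> / 16 * (1/2) ^ k) sums (\<epsilon> / 16 * 2)"
    using geometric_sums[of "1/2 :: real"] by (intro sums_mult) simp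
  have sumA: "summable (\<lambda>k. measure \<mu> (A k))"
    by (rule summable_comparison_test'[OF sums_summable[OF geom], of 0]) (use A(2) in auto)
  have "measure \<mu> (\<Union>k. A k) \<le> (\<Sum>k. measure \<mu> (A k))"
    using A(1) sumA by (intro finite_measure_subadditive_countably) auto
  also have "\<dots> \<le> \<epsilon> / 16 * 2"
    using suminf_le[OF A(2) sumA sums_summable[OF geom]] sums_unique[OF geom] by simp
  finally have UA: "measure \<mu> (\<Union>k. A k) \<le> \<epsilon> / 8" by simp
  have ball: "UNIV - cball 0 M \<in> sets \<mu>" unfolding \<mu> by auto
  have "UNIV - GF_learnable \<Phi> \<subseteq> (UNIV - cball 0 M) \<union> (\<Union>k. A k)"
    using learn by (auto simp: A_def)
  then have "measure \<mu> (UNIV - GF_learnable \<Phi>) \<le> measure \<mu> ((UNIV - cball 0 M) \<union> (\<Union>k. A k))"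
    using ball A(1) by (intro finite_measure_mono) auto
  also have "\<dots> \<le> measure \<mu> (UNIV - cball 0 M) + measure \<mu> (\<Union>k. A k)"
    using ball A(1) by (intro measure_Un_le) auto
  also have "\<dots> < \<epsilon>" using M(2) UA \<epsilon> by linarith
  finally show ?thesis using smooth_\<Phi> by blast
qed

text \<open>The map is the coordinate \<open>u\<close> itself, so the flow is
  \<open>u' = f - u\<close> and has the explicit solution \<open>f * (1 - exp (- t))\<close>, which
  tends to the target.\<close>

lemma one_dimensional_learnable:
  fixes f :: "real^'d"
  assumes dim: "CARD('d) = 1"
  defines "\<Phi> \<equiv> \<lambda>w :: real^2. w $ 1 *\<^sub>R (1 :: real^'d)"
  shows "f \<in> GF_learnable \<Phi>"
proof -
  obtain i :: 'd where i: "UNIV = {i}" using dim by (auto simp: card_1_singleton_iff)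
  have eq: "x = y \<longleftrightarrow> x $ i = y $ i" for x y :: "real^'d"
    by (metis (full_types) UNIV_I i singletonD vec_eq_iff)
  define w where "w t = (f $ i * (1 - exp (- t))) *\<^sub>R (axis 1 1 :: real^2)" for t
  have D: "(\<Phi> has_derivative (\<lambda>h. h $ 1 *\<^sub>R 1)) (at x)" for x
    unfolding \<Phi>_def by (intro bounded_linear_imp_has_derivative bounded_linear_compose[OF bounded_linear_scaleR_left bounded_linear_vec_nth])
  have ff: "flow_field \<Phi> f (w t) = (f $ i * exp (- t)) *\<^sub>R axis 1 1" for t
  proof (rule vector_eq_ldot[THEN iffD1, rule_format])
    fix h :: "real^2"
    have "flow_field \<Phi> f (w t) \<bullet> h = (f - \<Phi> (w t)) \<bullet> (h $ 1 *\<^sub>R 1)" by (rule flow_field_inner[OF D])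
    also have "\<dots> = (f $ i * exp (- t)) * h $ 1"
      unfolding inner_vec_def i by (simp add: \<Phi>_def w_def algebra_simps)
    also have "\<dots> = ((f $ i * exp (- t)) *\<^sub>R axis 1 1) \<bullet> h" by (simp add: inner_axis')
    finally show "h \<bullet> flow_field \<Phi> f (w t) = h \<bullet> ((f $ i * exp (- t)) *\<^sub>R axis 1 1)" by (simp add: inner_commute)
  qed
  have "(w has_vector_derivative flow_field \<Phi> f (w t)) (at t within {0..})" for t
    unfolding ff unfolding w_def
    by (rule has_vector_derivative_at_within, rule has_vector_derivative_scaleR_const)
       (auto intro!: derivative_eq_intros)
  then have "GF_solution \<Phi> f w" by (simp add: GF_solution_def flow_field_def w_def)
  moreover have "(INF t\<in>{0..}. loss \<Phi> f (w t)) = 0"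
  proof (subst INF_eq_0_iff)
    have "((\<lambda>t. (1/2) * (norm ((f $ i * exp (- t)) *\<^sub>R (1::real^'d)))\<^sup>2) \<longlongrightarrow> (1/2) * (norm ((f $ i * 0) *\<^sub>R (1::real^'d)))\<^sup>2) at_top"
      by (intro tendsto_intros filterlim_compose[OF exp_at_bot filterlim_uminus_at_bot_at_top])
    moreover have "f - \<Phi> (w t) = (f $ i * exp (- t)) *\<^sub>R 1" for t
      by (simp add: eq \<Phi>_def w_def algebra_simps)
    ultimately have lim: "((\<lambda>t. loss \<Phi> f (w t)) \<longlongrightarrow> 0) at_top" by (simp add: loss_def)
    show "\<forall>n. \<exists>t\<ge>0. loss \<Phi> f (w t) < 1 / real (Suc n)"
    proof
      fix n
      have "\<forall>\<^sub>F t in at_top. loss \<Phi> f (w t) < 1 / real (Suc n) \<and> 0 \<le> t"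
        using order_tendstoD(2)[OF lim, of "1 / real (Suc n)"] eventually_ge_at_top[of 0] by (intro eventually_conj) auto
      then show "\<exists>t\<ge>0. loss \<Phi> f (w t) < 1 / real (Suc n)"
        using eventually_happens'[OF trivial_limit_at_top_linorder] by fastforce
    qed
  qed (simp add: loss_def)
  ultimately show ?thesis by (auto simp: GF_learnable_def)
qed

theorem theorem4:
  fixes \<mu> :: "(real^'d) measure" and \<epsilon> :: real
  assumes "prob_space \<mu>" and "sets \<mu> = sets borel" and "\<epsilon> > 0"
  shows "\<exists>\<Phi> :: real^2 \<Rightarrow> real^'d. smooth \<Phi> \<and> GF_learnable \<Phi> \<in> sets borel \<and>
           measure \<mu> (UNIV - GF_learnable \<Phi>) < \<epsilon>"
proof (cases "2 \<le> CARD('d)")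
  case True
  then show ?thesis using almost_all_learnable[OF assms] GF_learnable_borel by blast
next
  case False
  then have "CARD('d) = 1" using zero_less_card_finite[where 'a = 'd] by linarith
  then have "GF_learnable (\<lambda>w :: real^2. w $ 1 *\<^sub>R (1 :: real^'d)) = UNIV"
    using one_dimensional_learnable by blast
  moreover have "smooth (\<lambda>w :: real^2. w $ 1 *\<^sub>R (1 :: real^'d))"
    by (intro smooth_scaleR smooth_vec_nth smooth_const)
  ultimately show ?thesis using \<open>\<epsilon> > 0\<close> by (intro exI[of _ "\<lambda>w. w $ 1 *\<^sub>R 1"]) simp
qed

end
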